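(* Let $\mathcal{G}$ be a Carnot group endowed with a gauge $x\mapsto\|x\|$ that is differentiable $\mathcal{L}^n$-a.e. and whose unit ball $B_1$ has finite horizontal perimeter. Let $p\ge1$ and let $u\in W^{1,p}_{\mathrm{h}}(\mathcal{G})$ be a nonnegative function with compact support, with rearrangement $u^{\star}$. There exists a positive constant $C_{sym}$ such that $$\int_{\mathcal{G}}\frac{|D_{\mathrm{h}}u^{\star}(x)|^p}{|D_{\mathrm{h}}(\|x\|)|^p}\,d\mathcal{L}^n(x)\le (C_{sym})^p\int_{\mathcal{G}}|D_{\mathrm{h}}u(x)|^p\,d\mathcal{L}^n(x).$$ In fact, one may take $$C_{sym}=\frac{\sigma(\partial B_1)}{\mathcal{P}_{\mathrm{h}}(B_1)}\,C_{per}.$$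
   Context: A Carnot group $\mathcal{G}$ of topological dimension $n$ is a simply connected nilpotent Lie group with stratified Lie algebra $\mathfrak{g}=V_1\oplus\cdots\oplus V_k$, identified with $\mathbb{R}^n$ so that the identity is $0$ and Haar measure is Lebesgue measure $\mathcal{L}^n$. $X_1,\dots,X_m$ are left-invariant vector fields forming a basis of $V_1$ (which generates $\mathfrak{g}$), taken orthonormal; $\delta_r$ ($r>0$) are the dilations, group automorphisms acting by $r^j$ on $V_j$; $Q=\sum_j j\dim V_j$ is the homogeneous dimension. A gauge is a continuous function $x\mapsto\|x\|\in[0,\infty)$ on $\mathcal{G}$ with $\|x\|=0$ iff $x=0$ and $\|\delta_r x\|=r\|x\|$. Put $B_r=\{x:\|x\|<r\}$ for $r>0$, $B_0=\emptyset$. Rearrangement: for nonnegative measurable $u$ with compact support, $u^{\star}(x)=\tilde\nu_u(\|x\|)$, where $\tilde\nu_u(r)=\sup\{t\ge 0:\mathcal{L}^n(\{u>t\})>\mathcal{L}^n(B_r)\}$ and $\sup\emptyset=0$. The horizontal gradient is $D_{\mathrm{h}}u=\sum_{i=1}^m (X_iu)X_i$ and $W^{1,p}_{\mathrm{h}}(\mathcal{G})=\{u\in L^p: D_{\mathrm{h}}u\in L^p\}$ (derivatives in the weak sense). On the left-hand side of the inequality, $D_{\mathrm{h}}(\|x\|)$ and $D_{\mathrm{h}}u^{\star}(x)=\tilde\nu_u'(\|x\|)\,D_{\mathrm{h}}(\|x\|)$ are the pointwise horizontal gradients, which exist for a.e. $x$. For a horizontal field $F=\sum_{i=1}^m F^iX_i$,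 $\operatorname{div}_{\mathrm{h}}F$ is defined by $\int\phi\operatorname{div}_{\mathrm{h}}F\,d\mathcal{L}^n=-\int\langle D_{\mathrm{h}}\phi,F\rangle\,d\mathcal{L}^n$ for all compactly supported smooth $\phi$. The horizontal perimeter of a measurable set $E$ is $\mathcal{P}_{\mathrm{h}}(E)=\sup\int_E\operatorname{div}_{\mathrm{h}}F\,d\mathcal{L}^n$ over smooth compactly supported horizontal $F$ with $\sum_i|F^i|^2\le1$. $\sigma$ is the Radon measure on $\partial B_1=\{\|x\|=1\}$ giving integration in polar coordinates: $\int_{\mathcal{G}}f\,d\mathcal{L}^n=\int_0^\infty\int_{\partial B_1}f(\delta_r y)\,d\sigma(y)\,r^{Q-1}\,dr$ for all $f\in L^1(\mathcal{G})$. $C_{per}\ge1$ denotes a constant (depending only on $\mathcal{G}$ and the gauge) such that $\mathcal{P}_{\mathrm{h}}(B_R)\le C_{per}\,\mathcal{P}_{\mathrm{h}}(E)$ for every measurable $E$ of finite measure, where $R\ge0$ is determined by $\mathcal{L}^n(B_R)=\mathcal{L}^n(E)$; such a constant exists. *)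

theory Defs
  imports "HOL-Analysis.Analysis"
begin

section \<open>Smooth functions and test functions\<close>

primrec Ck :: "nat \<Rightarrow> ('a::euclidean_space \<Rightarrow> 'b::real_normed_vector) \<Rightarrow> bool" where
  "Ck 0 f \<longleftrightarrow> continuous_on UNIV f"
| "Ck (Suc k) f \<longleftrightarrow>
     (\<forall>x. f differentiable (at x)) \<and> (\<forall>b\<in>Basis. Ck k (\<lambda>x. frechet_derivative f (at x) b))"

definition smooth :: "('a::euclidean_space \<Rightarrow> 'b::real_normed_vector) \<Rightarrow> bool" where
  "smooth f \<longleftrightarrow> (\<forall>k. Ck k f)"

definition test_function :: "('a::euclidean_space \<Rightarrow> real) \<Rightarrow> bool" where
  "test_function \<phi> \<longleftrightarrow> smooth \<phi> \<and> compact (closure {x. \<phi> x \<noteq> 0})"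

definition Lp :: "real \<Rightarrow> ('a::euclidean_space \<Rightarrow> real) \<Rightarrow> bool" where
  "Lp p f \<longleftrightarrow> f \<in> borel_measurable lebesgue \<and> integrable lebesgue (\<lambda>x. \<bar>f x\<bar> powr p)"

definition locally_integrable :: "('a::euclidean_space \<Rightarrow> real) \<Rightarrow> bool" where
  "locally_integrable f \<longleftrightarrow> f \<in> borel_measurable lebesgue \<and>
     (\<forall>K. compact K \<longrightarrow> set_integrable lebesgue K f)"

section \<open>Carnot groups\<close>

text \<open>The group is the space \<open>'a\<close> itself (so it is simply connected), with identity \<open>0\<close>.
  The Lie algebra is the tangent space \<open>'a\<close> at \<open>0\<close>, a vector \<open>v\<close> standing for the left-invariant
  field with value \<open>v\<close> at \<open>0\<close>. In particular \<open>frame G 0, \<dots>, frame G (rank G - 1)\<close> are the values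
  at \<open>0\<close> of the fields $X_1,\dots,X_m$. The field \<open>layer G j\<close> is $V_j$ for \<open>1 \<le> j \<le> step G\<close>
  and is irrelevant for other \<open>j\<close>; \<open>dil G r\<close> is relevant only for \<open>r > 0\<close>.\<close>

record 'a carnot =
  mult :: "'a \<Rightarrow> 'a \<Rightarrow> 'a"
  ginv :: "'a \<Rightarrow> 'a"
  step :: nat
  layer :: "nat \<Rightarrow> 'a set"
  rank :: nat
  frame :: "nat \<Rightarrow> 'a"
  dil :: "real \<Rightarrow> 'a \<Rightarrow> 'a"

definition left_field :: "('a::euclidean_space) carnot \<Rightarrow> 'a \<Rightarrow> 'a \<Rightarrow> 'a" where
  "left_field G v x = frechet_derivative (mult G x) (at 0) v"

definition vf_bracket :: "('a::euclidean_space \<Rightarrow> 'a) \<Rightarrow> ('a \<Rightarrow> 'a) \<Rightarrow> 'a \<Rightarrow> 'a" where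
  "vf_bracket X Y x = frechet_derivative Y (at x) (X x) - frechet_derivative X (at x) (Y x)"

definition lie_bracket :: "('a::euclidean_space) carnot \<Rightarrow> 'a \<Rightarrow> 'a \<Rightarrow> 'a" where
  "lie_bracket G v w = vf_bracket (left_field G v) (left_field G w) 0"

definition lie_group :: "('a::euclidean_space) carnot \<Rightarrow> bool" where
  "lie_group G \<longleftrightarrow>
     (\<forall>x y z. mult G (mult G x y) z = mult G x (mult G y z)) \<and>
     (\<forall>x. mult G 0 x = x \<and> mult G x 0 = x) \<and>
     (\<forall>x. mult G (ginv G x) x = 0 \<and> mult G x (ginv G x) = 0) \<and>
     smooth (\<lambda>(x, y). mult G x y) \<and> smooth (ginv G)"

text \<open>Nilpotency of the Lie algebra is a consequence of the last two clauses.\<close>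

definition stratification :: "('a::euclidean_space) carnot \<Rightarrow> bool" where
  "stratification G \<longleftrightarrow>
     1 \<le> step G \<and>
     (\<forall>j\<in>{1..step G}. subspace (layer G j)) \<and>
     layer G (step G) \<noteq> {0} \<and>
     (\<forall>v. \<exists>!w. (\<forall>j\<in>{1..step G}. w j \<in> layer G j) \<and> (\<forall>j. j \<notin> {1..step G} \<longrightarrow> w j = 0) \<and>
               v = (\<Sum>j = 1..step G. w j)) \<and>
     (\<forall>j\<in>{1..<step G}.
        layer G (Suc j) = span {lie_bracket G v w | v w. v \<in> layer G 1 \<and> w \<in> layer G j}) \<and>
     (\<forall>v\<in>layer G 1. \<forall>w\<in>layer G (step G). lie_bracket G v w = 0)"

definition dilations :: "('a::euclidean_space) carnot \<Rightarrow> bool" where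
  "dilations G \<longleftrightarrow>
     (\<forall>r>0. bij (dil G r) \<and> smooth (dil G r) \<and>
        (\<forall>x y. dil G r (mult G x y) = mult G (dil G r x) (dil G r y)) \<and>
        (\<forall>j\<in>{1..step G}. \<forall>v\<in>layer G j. frechet_derivative (dil G r) (at 0) v = r ^ j *\<^sub>R v))"

definition carnot_group :: "('a::euclidean_space) carnot \<Rightarrow> bool" where
  "carnot_group G \<longleftrightarrow>
     lie_group G \<and> stratification G \<and> dilations G \<and>
     (\<forall>g. distr lborel borel (mult G g) = lborel) \<and>
     inj_on (frame G) {..<rank G} \<and> independent (frame G ` {..<rank G}) \<and>
     span (frame G ` {..<rank G}) = layer G 1"

definition hom_dim :: "('a::euclidean_space) carnot \<Rightarrow> nat" where
  "hom_dim G = (\<Sum>j = 1..step G. j * dim (layer G j))"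

section \<open>Horizontal calculus\<close>

text \<open>Horizontal vectors $\sum_{i=1}^m c_i X_i$ are represented by their coefficients
  \<open>c i\<close>, \<open>i < rank G\<close>, with respect to the orthonormal frame.\<close>

definition hnorm :: "('a::euclidean_space) carnot \<Rightarrow> (nat \<Rightarrow> real) \<Rightarrow> real" where
  "hnorm G c = sqrt (\<Sum>i<rank G. (c i)\<^sup>2)"

text \<open>The pointwise horizontal gradient, meaningful where \<open>f\<close> is differentiable at \<open>x\<close>.\<close>

definition hgrad :: "('a::euclidean_space) carnot \<Rightarrow> ('a \<Rightarrow> real) \<Rightarrow> 'a \<Rightarrow> nat \<Rightarrow> real" where
  "hgrad G f x i = frechet_derivative f (at x) (left_field G (frame G i) x)"

text \<open>The formal adjoint of a left-invariant field $X_i$ with respect to the (bi-invariant) Haar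
  measure is $-X_i$.\<close>

definition has_weak_hgrad ::
    "('a::euclidean_space) carnot \<Rightarrow> ('a \<Rightarrow> real) \<Rightarrow> ('a \<Rightarrow> nat \<Rightarrow> real) \<Rightarrow> bool" where
  "has_weak_hgrad G u D \<longleftrightarrow> locally_integrable u \<and>
     (\<forall>i<rank G. locally_integrable (\<lambda>x. D x i) \<and>
        (\<forall>\<phi>. test_function \<phi> \<longrightarrow>
           (LINT x|lebesgue. \<phi> x * D x i) = - (LINT x|lebesgue. hgrad G \<phi> x i * u x)))"

definition sobolev :: "('a::euclidean_space) carnot \<Rightarrow> real \<Rightarrow> ('a \<Rightarrow> real) set" where
  "sobolev G p = {u. Lp p u \<and> (\<exists>D. has_weak_hgrad G u D \<and> (\<forall>i<rank G. Lp p (\<lambda>x. D x i)))}"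

definition is_hdiv ::
    "('a::euclidean_space) carnot \<Rightarrow> (nat \<Rightarrow> 'a \<Rightarrow> real) \<Rightarrow> ('a \<Rightarrow> real) \<Rightarrow> bool" where
  "is_hdiv G F g \<longleftrightarrow> locally_integrable g \<and>
     (\<forall>\<phi>. test_function \<phi> \<longrightarrow>
        (LINT x|lebesgue. \<phi> x * g x) = - (LINT x|lebesgue. (\<Sum>i<rank G. hgrad G \<phi> x i * F i x)))"

text \<open>Since \<open>F = 0\<close> is admissible, the supremum is nonnegative, and the truncation of negative
  reals by \<^const>\<open>ennreal\<close> does not affect it.\<close>

definition hperimeter :: "('a::euclidean_space) carnot \<Rightarrow> 'a set \<Rightarrow> ennreal" where
  "hperimeter G E = Sup {ennreal (LINT x:E|lebesgue. g x) | F g.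
     (\<forall>i<rank G. test_function (F i)) \<and> (\<forall>x. (\<Sum>i<rank G. (F i x)\<^sup>2) \<le> 1) \<and> is_hdiv G F g}"

section \<open>Gauges and rearrangements\<close>

definition carnot_gauge :: "('a::euclidean_space) carnot \<Rightarrow> ('a \<Rightarrow> real) \<Rightarrow> bool" where
  "carnot_gauge G N \<longleftrightarrow> continuous_on UNIV N \<and> (\<forall>x. 0 \<le> N x) \<and> (\<forall>x. N x = 0 \<longleftrightarrow> x = 0) \<and>
     (\<forall>r>0. \<forall>x. N (dil G r x) = r * N x)"

definition gball :: "('a \<Rightarrow> real) \<Rightarrow> real \<Rightarrow> 'a set" where
  "gball N r = {x. N x < r}"

definition polar_measure ::
    "('a::euclidean_space) carnot \<Rightarrow> ('a \<Rightarrow> real) \<Rightarrow> 'a measure \<Rightarrow> bool" where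
  "polar_measure G N \<sigma> \<longleftrightarrow>
     sets \<sigma> = sets (restrict_space borel {x. N x = 1}) \<and> finite_measure \<sigma> \<and>
     (\<forall>f::'a \<Rightarrow> real. integrable lborel f \<longrightarrow>
        (LINT x|lborel. f x) =
        (LINT r:{0<..}|lborel. (LINT y|\<sigma>. f (dil G r y)) * r ^ (hom_dim G - 1)))"

definition perimeter_constant ::
    "('a::euclidean_space) carnot \<Rightarrow> ('a \<Rightarrow> real) \<Rightarrow> real \<Rightarrow> bool" where
  "perimeter_constant G N C \<longleftrightarrow> 1 \<le> C \<and>
     (\<forall>E\<in>sets lebesgue. emeasure lebesgue E < \<infinity> \<longrightarrow>
        (\<forall>R\<ge>0. emeasure lebesgue (gball N R) = emeasure lebesgue E \<longrightarrow>
           hperimeter G (gball N R) \<le> ennreal C * hperimeter G E))"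

text \<open>The supremum is taken in \<^typ>\<open>ennreal\<close>, where the supremum of the empty set is \<open>0\<close>. It is
  finite for \<open>r > 0\<close> (for \<open>u\<close> of compact support); only for \<open>r = 0\<close>, that is at the single
  point \<open>x = 0\<close> below, can it be infinite, and then it is replaced by \<open>0\<close>.\<close>

definition profile :: "('a::euclidean_space \<Rightarrow> real) \<Rightarrow> ('a \<Rightarrow> real) \<Rightarrow> real \<Rightarrow> real" where
  "profile N u r = enn2real (Sup {ennreal t | t. 0 \<le> t \<and>
     emeasure lebesgue {x. t < u x} > emeasure lebesgue (gball N r)})"

definition rearrangement :: "('a::euclidean_space \<Rightarrow> real) \<Rightarrow> ('a \<Rightarrow> real) \<Rightarrow> 'a \<Rightarrow> real" where
  "rearrangement N u x = profile N u (N x)"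

text \<open>The integrand $|D_h u^\star|^p / |D_h \|x\||^p$. The points where the gradient of the gauge
  vanishes may form a set of positive measure. There
  $D_h u^\star(x) = \tilde\nu_u'(\|x\|) D_h \|x\|$ makes the quotient $0/0$, and it is given its
  cancelled value $|\tilde\nu_u'(\|x\|)|^p$ instead of the value $0$ of HOL division.\<close>

definition rearrangement_energy ::
    "('a::euclidean_space) carnot \<Rightarrow> ('a \<Rightarrow> real) \<Rightarrow> real \<Rightarrow> ('a \<Rightarrow> real) \<Rightarrow> 'a \<Rightarrow> real" where
  "rearrangement_energy G N p u x =
     (if hnorm G (hgrad G N x) = 0 then \<bar>deriv (profile N u) (N x)\<bar> powr p
      else hnorm G (hgrad G (rearrangement N u) x) powr p / hnorm G (hgrad G N x) powr p)"

end

theory Submission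
  imports Defs
begin

text \<open>Write \<open>\<psi>\<close> for the radial profile of the rearrangement and \<open>V r = \<sigma>(S) r ^ Q / Q\<close> for the
volume of the gauge ball of radius \<open>r\<close>, where \<open>S\<close> is the unit sphere. Fix radii \<open>r < s\<close>. For a
height \<open>t\<close> between \<open>\<psi> s\<close> and \<open>\<psi> r\<close> the superlevel set \<open>{u > t}\<close> has volume between \<open>V r\<close> and
\<open>V s\<close>, so the defining property of the perimeter constant and the scaling of the perimeter of balls
give it perimeter at least \<open>\<kappa> = P(B) r ^ (Q - 1) / C\<close>, with \<open>B\<close> the unit ball
(\<open>level_perimeter_lower_bound\<close>). One half of the coarea formula (\<open>coarea_lower_bound\<close>) then yields
that \<open>\<kappa> (\<psi> r - \<psi> s)\<close> is at most the integral of the norm of the horizontal gradient over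
\<open>{\<psi> s < u < \<psi> r}\<close>. This set has volume at most \<open>V s - V r\<close>, and \<open>V s - V r\<close> is at most
\<open>\<sigma>(S) s ^ (Q - 1) (s - r)\<close>. Jensen's inequality (\<open>power_mean_inequality\<close>) turns the estimate into one
for \<open>p\<close>-th powers: the \<open>p\<close>-th power of the difference quotient of \<open>\<psi>\<close>, integrated over the shell
between the radii \<open>r\<close> and \<open>s\<close>, is at most
\<open>(\<sigma>(S) / P(B) C (s / r) ^ (Q - 1)) powr p\<close> times the energy of \<open>u\<close> on \<open>{\<psi> s < u < \<psi> r}\<close>
(\<open>shell_estimate\<close>).

The space is now divided into shells by the radii \<open>exp (j / n)\<close>. All ratios \<open>s / r\<close> are equal, and
the sets \<open>{\<psi> s < u < \<psi> r}\<close> of different shells are disjoint because \<open>\<psi>\<close> is monotone, so the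
estimates add up (\<open>shell_sum_estimate\<close>). A monotone function is differentiable almost everywhere
(\<open>mono_AE_differentiable\<close>), hence the difference quotients converge almost everywhere to the derivative of
\<open>\<psi>\<close>, and Fatou's lemma gives the theorem: by the chain rule, the ratio of the norms of the two horizontal
gradients is the absolute value of this derivative, which is also its conventional value where the gradient
of the gauge vanishes (\<open>energy_pointwise\<close>).

The ingredients that concern the group are the following.

\<^item> Left-invariant fields are divergence free and Lebesgue measure is invariant under right translations
  (\<open>gdiv_layer\<close>, \<open>right_invariant\<close>). The divergence of such a field is constant by left invariance,
  and a nonzero constant is incompatible with dilations.
\<^item> The chain rule for weak horizontal derivatives (\<open>weak_chain_rule\<close>), on which the coarea inequality
  rests, follows by mollification with a group convolution that commutes with left-invariant fields.
\<^item> The scaling of volumes and perimeters of balls uses polar coordinates and the fact that the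
  dilations form a one-parameter group, which follows from their differentials at the identity
  (\<open>graded_hom_id\<close>).
\<^item> The unit ball has positive perimeter (\<open>hperimeter_unit_ball_pos\<close>). Otherwise its indicator would be
  annihilated by the first layer and thus, taking brackets, by all left-invariant fields; it would be
  constant, although its integral is finite and positive.\<close>

section \<open>Calculus of functions of class C^k\<close>

lemma Ck_SucD: "Ck (Suc k) f \<Longrightarrow> Ck k f"
proof (induction k arbitrary: f)
  case 0
  then show ?case
    by (auto intro!: differentiable_imp_continuous_on simp: differentiable_on_def)
next
  case (Suc k)
  then show ?case by (metis Ck.simps(2))
qed

lemma Ck_le: "Ck n f \<Longrightarrow> k \<le> n \<Longrightarrow> Ck k f"
proof (induction n)
  case (Suc n)
  show ?case
  proof (cases "k = Suc n")
    case False
    then show ?thesis using Suc.IH[OF Ck_SucD[OF Suc.prems(1)]] Suc.prems(2) by linarith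
  qed (use Suc.prems in blast)
qed simp

lemma Ck_SucI:
  assumes "\<And>x. (f has_derivative f' x) (at x)" "\<And>b. b \<in> Basis \<Longrightarrow> Ck k (\<lambda>x. f' x b)"
  shows "Ck (Suc k) f"
proof -
  have "frechet_derivative f (at x) = f' x" for x
    using assms(1) frechet_derivative_at by metis
  moreover have "f differentiable (at x)" for x using assms(1) differentiable_def by blast
  ultimately show ?thesis using assms(2) by simp
qed

lemma Ck_Suc_has_derivative:
  "Ck (Suc k) f \<Longrightarrow> (f has_derivative frechet_derivative f (at x)) (at x)"
  using frechet_derivative_works by auto

lemma Ck_1_has_derivative:
  "Ck 1 f \<Longrightarrow> (f has_derivative frechet_derivative f (at x)) (at x)"
  using Ck_Suc_has_derivative by (metis One_nat_def)

lemma Ck_continuous: "Ck k f \<Longrightarrow> continuous_on UNIV f"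
  using Ck_le[of k f 0] by simp

lemma Ck_const: "Ck k (\<lambda>x. c)"
  by (induction k arbitrary: c) auto

lemma Ck_bounded_linear: "bounded_linear f \<Longrightarrow> Ck k f"
proof (cases k)
  case 0 assume "bounded_linear f" then show ?thesis
    using 0 by (auto simp: linear_continuous_on)
next
  case (Suc n) assume f: "bounded_linear f"
  show ?thesis unfolding Suc
    by (rule Ck_SucI[where f'="\<lambda>_. f"]) (auto intro: bounded_linear_imp_has_derivative f Ck_const)
qed

lemma Ck_add:
  "Ck k f \<Longrightarrow> Ck k g \<Longrightarrow> Ck k (\<lambda>x. f x + g x)"
proof (induction k arbitrary: f g)
  case (Suc k)
  show ?case
    by (rule Ck_SucI[OF has_derivative_add[OF Ck_Suc_has_derivative[OF Suc.prems(1)]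
            Ck_Suc_has_derivative[OF Suc.prems(2)]]])
      (use Suc in auto)
qed (auto intro: continuous_intros)

text \<open>Products, scalar multiples and inner products are covered by one induction: by the product rule
the derivative is a sum of two terms of the same bilinear form.\<close>

lemma Ck_bilinear:
  assumes p: "bounded_bilinear p"
  shows "Ck k f \<Longrightarrow> Ck k g \<Longrightarrow> Ck k (\<lambda>x. p (f x) (g x))"
proof (induction k arbitrary: f g)
  case 0 then show ?case by (auto intro: bounded_bilinear.continuous_on[OF p])
next
  case (Suc k)
  show ?case
    by (rule Ck_SucI[OF bounded_bilinear.FDERIV[OF p Ck_Suc_has_derivative[OF Suc.prems(1)]
            Ck_Suc_has_derivative[OF Suc.prems(2)]]], rule Ck_add; rule Suc.IH)
      (use Suc.prems Ck_SucD[OF Suc.prems(1)] Ck_SucD[OF Suc.prems(2)] in auto)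
qed

lemmas Ck_mult = Ck_bilinear[OF bounded_bilinear_mult]
lemmas Ck_scaleR = Ck_bilinear[OF bounded_bilinear_scaleR]
lemmas Ck_inner = Ck_bilinear[OF bounded_bilinear_inner]

lemma Ck_sum: "finite S \<Longrightarrow> (\<And>s. s \<in> S \<Longrightarrow> Ck k (f s)) \<Longrightarrow> Ck k (\<lambda>x. \<Sum>s\<in>S. f s x)"
  by (induction S rule: finite_induct) (auto intro: Ck_const Ck_add)

lemma Ck_prod:
  fixes f :: "'s \<Rightarrow> 'a::euclidean_space \<Rightarrow> real"
  shows "finite S \<Longrightarrow> (\<And>s. s \<in> S \<Longrightarrow> Ck k (f s)) \<Longrightarrow> Ck k (\<lambda>x. \<Prod>s\<in>S. f s x)"
  by (induction S rule: finite_induct) (auto intro: Ck_const Ck_mult)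

lemma Ck_Pair: "Ck k f \<Longrightarrow> Ck k g \<Longrightarrow> Ck k (\<lambda>x. (f x, g x))"
proof (induction k arbitrary: f g)
  case (Suc k)
  show ?case
    by (rule Ck_SucI[OF has_derivative_Pair[OF Ck_Suc_has_derivative[OF Suc.prems(1)]
            Ck_Suc_has_derivative[OF Suc.prems(2)]]])
      (use Suc in auto)
qed (auto intro: continuous_intros)

lemma linear_Basis_sum:
  fixes v :: "'a::euclidean_space"
  assumes "linear f"
  shows "f v = (\<Sum>b\<in>Basis. (v \<bullet> b) *\<^sub>R f b)"
proof -
  have "f v = f (\<Sum>b\<in>Basis. (v \<bullet> b) *\<^sub>R b)" by (simp add: euclidean_representation)
  then show ?thesis by (simp add: linear_sum[OF assms] linear_scale[OF assms])
qed

text \<open>The chain rule produces derivatives of \<open>g\<close> at a moving point in a moving direction. Expanding the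
direction in the basis leaves derivatives in fixed directions, to which the induction hypothesis of
\<open>Ck_compose\<close> applies.\<close>

lemma Ck_derivative_along:
  assumes IH: "\<And>c. c \<in> Basis \<Longrightarrow> Ck k (\<lambda>x. frechet_derivative g (at (f x)) c)"
    and g: "\<And>y. g differentiable (at y)" and Y: "Ck k Y"
  shows "Ck k (\<lambda>x. frechet_derivative g (at (f x)) (Y x))"
proof -
  have "(\<lambda>x. frechet_derivative g (at (f x)) (Y x))
      = (\<lambda>x. \<Sum>c\<in>Basis. (Y x \<bullet> c) *\<^sub>R frechet_derivative g (at (f x)) c)"
    by (intro ext linear_Basis_sum linear_frechet_derivative g)
  moreover have "Ck k \<dots>"
    by (intro Ck_sum Ck_scaleR IH Ck_inner Y Ck_const finite_Basis)
  ultimately show ?thesis by simp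
qed

lemma Ck_compose:
  fixes f :: "'a::euclidean_space \<Rightarrow> 'b::euclidean_space"
  shows "Ck k g \<Longrightarrow> Ck k f \<Longrightarrow> Ck k (\<lambda>x. g (f x))"
proof (induction k arbitrary: g)
  case 0 then show ?case by (auto intro: continuous_on_compose2)
next
  case (Suc k)
  note f' = Ck_Suc_has_derivative[OF Suc.prems(2)] and g' = Ck_Suc_has_derivative[OF Suc.prems(1)]
  show ?case
  proof (rule Ck_SucI)
    show "((\<lambda>x. g (f x)) has_derivative
        (\<lambda>h. frechet_derivative g (at (f x)) (frechet_derivative f (at x) h))) (at x)" for x
      by (rule has_derivative_compose[OF f' g'])
    show "Ck k (\<lambda>x. frechet_derivative g (at (f x)) (frechet_derivative f (at x) b))"
      if "b \<in> Basis" for b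
      by (rule Ck_derivative_along)
        (use Suc.prems that Ck_SucD[OF Suc.prems(2)] in \<open>auto intro!: Suc.IH\<close>)
  qed
qed

lemma Ck_directional:
  assumes "Ck (Suc k) f" "Ck k Y"
  shows "Ck k (\<lambda>x. frechet_derivative f (at x) (Y x))"
  using Ck_derivative_along[where f="\<lambda>x. x" and g=f and Y=Y and k=k] assms by auto

lemma smooth_Ck: "smooth f \<Longrightarrow> Ck k f" by (simp add: smooth_def)

lemma smooth_has_derivative: "smooth f \<Longrightarrow> (f has_derivative frechet_derivative f (at x)) (at x)"
  using Ck_Suc_has_derivative smooth_Ck by blast

section \<open>Smooth bumps and test functions\<close>

text \<open>The classical flat function is the case \<open>n = 0\<close>. The powers of \<open>t\<close> make the family closed under
differentiation up to linear combinations, so that one induction over \<open>k\<close> shows that all its members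
are of class \<open>C^k\<close>.\<close>

definition flat :: "nat \<Rightarrow> real \<Rightarrow> real" where
  "flat n t = (if t > 0 then exp (- (1 / t)) / t ^ n else 0)"

lemma flat_tendsto_0: "((\<lambda>t. flat n t) \<longlongrightarrow> 0) (at 0)"
proof -
  \<comment> \<open>The substitution of the reciprocal of t turns this into the growth of exp at infinity.\<close>
  have "((\<lambda>x::real. x ^ n / exp x) \<longlongrightarrow> 0) at_top" by (rule tendsto_power_div_exp_0)
  then have "((\<lambda>t. inverse t ^ n / exp (inverse t)) \<longlongrightarrow> (0::real)) (at_right 0)"
    by (rule filterlim_compose[OF _ filterlim_inverse_at_top_right])
  then have "(flat n \<longlongrightarrow> 0) (at_right 0)"
    by (rule Lim_transform_eventually)
      (auto simp: eventually_at_filter flat_def field_simps exp_minus)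
  moreover have "(flat n \<longlongrightarrow> 0) (at_left 0)"
    by (rule tendsto_eventually) (auto simp: eventually_at_filter flat_def)
  ultimately show ?thesis using filterlim_split_at by blast
qed

lemma flat_deriv:
  "(flat n has_real_derivative (flat (n + 2) t - n * flat (Suc n) t)) (at t)"
proof -
  consider "t > 0" | "t = 0" | "t < 0" by linarith
  then show ?thesis
  proof cases
    case 1
    have "((\<lambda>t. exp (- (1 / t)) / t ^ n) has_real_derivative
         (flat (n + 2) t - n * flat (Suc n) t)) (at t)"
      using 1 apply (auto intro!: derivative_eq_intros simp: flat_def)
      apply (cases n)
       apply (simp_all add: field_simps power2_eq_square)
      done
    then show ?thesis
      by (rule has_field_derivative_transform_within_open[where S="{0<..}"])
        (use 1 in \<open>auto simp: flat_def\<close>)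
  next
    case 2
    have "((\<lambda>h. (flat n (0 + h) - flat n 0) / h) \<longlongrightarrow> 0) (at 0)"
      by (rule Lim_transform_eventually[OF flat_tendsto_0[of "Suc n"]])
        (auto simp: flat_def eventually_at_filter)
    then show ?thesis using 2 by (simp add: DERIV_def flat_def)
  next
    case 3
    have "((\<lambda>t. 0) has_real_derivative (flat (n + 2) t - n * flat (Suc n) t)) (at t)"
      using 3 by (simp add: flat_def)
    then show ?thesis
      by (rule has_field_derivative_transform_within_open[where S="{..<0}"])
        (use 3 in \<open>auto simp: flat_def\<close>)
  qed
qed

lemma Ck_flat: "Ck k (flat n)"
proof (induction k arbitrary: n)
  case 0
  show ?case using DERIV_isCont[OF flat_deriv] by (auto simp: continuous_on_eq_continuous_at)
next
  case (Suc k)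
  show ?case
  proof (rule Ck_SucI)
    show "(flat n has_derivative (\<lambda>h. (flat (n + 2) t - n * flat (Suc n) t) * h)) (at t)" for t
      using flat_deriv unfolding has_field_derivative_def .
    show "Ck k (\<lambda>x. (flat (n + 2) x - real n * flat (Suc n) x) * b)" if "b \<in> Basis" for b :: real
    proof -
      have "Ck k (\<lambda>x. (flat (n + 2) x + (- real n) * flat (Suc n) x) * b)"
        by (intro Ck_mult Ck_add Ck_const Suc.IH)
      then show ?thesis by simp
    qed
  qed
qed

lemma Ck_exp: "Ck k (exp :: real \<Rightarrow> real)"
proof (induction k)
  case (Suc k)
  show ?case
    by (rule Ck_SucI[where f'="\<lambda>x h. exp x * h"])
      (use DERIV_exp Suc in \<open>auto simp: has_field_derivative_def\<close>)
qed (auto intro: continuous_intros)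

lemma test_functionI:
  assumes "smooth f" "compact K" "\<And>x. x \<notin> K \<Longrightarrow> f x = 0"
  shows "test_function f"
proof -
  have "closure {x. f x \<noteq> 0} \<subseteq> K"
    using assms by (intro closure_minimal) (auto simp: compact_imp_closed)
  then show ?thesis unfolding test_function_def
    using assms(1,2) by (metis closed_closure compact_Int_closed inf.absorb_iff2)
qed

lemma test_functionE:
  assumes "test_function f"
  obtains K where "compact K" "\<And>x. x \<notin> K \<Longrightarrow> f x = 0" "smooth f"
  using assms that[of "closure {x. f x \<noteq> 0}"] closure_subset[of "{x. f x \<noteq> 0}"]
  unfolding test_function_def by blast

text \<open>Group mollifications are only shown to be \<open>C^1\<close> below. The integration by parts formulas are therefore
stated for this larger class.\<close>

definition C1_compact :: "('a::euclidean_space \<Rightarrow> real) \<Rightarrow> bool" where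
  "C1_compact f \<longleftrightarrow> Ck 1 f \<and> (\<exists>K. compact K \<and> (\<forall>x. x \<notin> K \<longrightarrow> f x = 0))"

lemma test_function_C1_compact: "test_function f \<Longrightarrow> C1_compact f"
  unfolding C1_compact_def by (metis smooth_Ck test_functionE)

lemma test_function_Ck: "test_function f \<Longrightarrow> Ck k f"
  by (metis smooth_Ck test_functionE)

lemma frechet_derivative_eq_0_outside:
  assumes "closed K" "\<And>x. x \<notin> K \<Longrightarrow> f x = 0" "x \<notin> K"
  shows "frechet_derivative f (at x) = (\<lambda>h. 0)"
proof -
  have "(f has_derivative (\<lambda>h. 0)) (at x)"
    by (rule has_derivative_transform_within_open[where s="- K" and f="\<lambda>_. 0"]) (use assms in auto)
  then show ?thesis using frechet_derivative_at by metis
qed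

text \<open>A product over the coordinates: a factor \<open>flat 0 t\<close> for each of the two faces orthogonal to a basis
vector, with \<open>t\<close> the signed distance to that face.\<close>

lemma test_function_box:
  fixes a c :: "'a::euclidean_space"
  obtains f :: "'a \<Rightarrow> real" where "smooth f" "\<And>x. 0 \<le> f x" "\<And>x. f x > 0 \<longleftrightarrow> x \<in> box a c"
    "\<And>x. x \<notin> cbox a c \<Longrightarrow> f x = 0"
proof -
  let ?g = "\<lambda>x::'a. \<Prod>b\<in>Basis. flat 0 (x \<bullet> b + (- (a \<bullet> b))) * flat 0 (c \<bullet> b + (- 1) * (x \<bullet> b))"
  have s: "smooth ?g" unfolding smooth_def
    by (intro allI Ck_prod Ck_mult Ck_compose[OF Ck_flat] Ck_add Ck_const Ck_inner
        Ck_bounded_linear bounded_linear_ident finite_Basis)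
  have nn: "0 \<le> flat 0 t" for t by (simp add: flat_def)
  have g0: "0 \<le> ?g x" for x by (intro prod_nonneg mult_nonneg_nonneg nn ballI)
  have p: "flat 0 t = 0 \<longleftrightarrow> t \<le> 0" for t by (simp add: flat_def)
  have pos: "0 < y \<longleftrightarrow> y \<noteq> 0" if "0 \<le> y" for y :: real using that by linarith
  have *: "?g x > 0 \<longleftrightarrow> x \<in> box a c" for x
    unfolding pos[OF g0] by (auto simp: p mem_box not_le)
  have "?g x = 0" if "x \<notin> cbox a c" for x
  proof -
    have "x \<notin> box a c" using that box_subset_cbox[of a c] by blast
    then have "\<not> ?g x > 0" using *[of x] by simp
    then show ?thesis using g0[of x] by linarith
  qed
  then show ?thesis by (intro that[of ?g] s g0 *)
qed

section \<open>Locally integrable weights and the fundamental lemma\<close>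

text \<open>Borel measurability is part of the notion because weights will be composed with continuous functions and
integrated over product spaces.\<close>

definition loc_int :: "('a::euclidean_space \<Rightarrow> real) \<Rightarrow> bool" where
  "loc_int w \<longleftrightarrow> w \<in> borel_measurable borel \<and>
     (\<forall>K. compact K \<longrightarrow> integrable lborel (\<lambda>x. indicator K x * w x))"

lemma loc_int_mult:
  assumes w: "loc_int w" and K: "compact K" and f: "f \<in> borel_measurable borel"
    "\<And>x. x \<notin> K \<Longrightarrow> f x = 0" "\<And>x. \<bar>f x\<bar> \<le> C"
  shows "integrable lborel (\<lambda>x. w x * f x)"
proof (rule Bochner_Integration.integrable_bound)
  show "integrable lborel (\<lambda>x. C * (indicator K x * w x))"
    using w K by (auto simp: loc_int_def)
  show "(\<lambda>x. w x * f x) \<in> borel_measurable lborel"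
    using w f(1) by (auto simp: loc_int_def)
  have "\<bar>w x * f x\<bar> \<le> \<bar>C * (indicator K x * w x)\<bar>" for x
  proof (cases "x \<in> K")
    case True
    have "\<bar>f x\<bar> \<le> \<bar>C\<bar>" using f(3)[of x] by linarith
    then show ?thesis using True by (auto simp: abs_mult mult.commute mult_right_mono)
  qed (use f(2) in auto)
  then show "AE x in lborel. norm (w x * f x) \<le> norm (C * (indicator K x * w x))" by auto
qed

lemma compact_supp_bounded:
  fixes f :: "'a::euclidean_space \<Rightarrow> real"
  assumes "continuous_on UNIV f" "compact K" "\<And>x. x \<notin> K \<Longrightarrow> f x = 0"
  obtains C where "C \<ge> 0" "\<And>x. \<bar>f x\<bar> \<le> C"
proof -
  have "compact (f ` K)" using assms compact_continuous_image continuous_on_subset by blast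
  then obtain C where "\<forall>y\<in>f ` K. norm y \<le> C" using compact_imp_bounded bounded_iff by blast
  then have "\<bar>f x\<bar> \<le> max C 0" for x using assms(3)[of x] by (cases "x \<in> K") auto
  then show ?thesis using that[of "max C 0"] by auto
qed

lemma loc_int_mult_cont:
  assumes w: "loc_int w" and f: "continuous_on UNIV f" "compact K" "\<And>x. x \<notin> K \<Longrightarrow> f x = 0"
  shows "integrable lborel (\<lambda>x. w x * f x)"
proof -
  obtain C where "\<And>x. \<bar>f x\<bar> \<le> C" using compact_supp_bounded[OF f] by blast
  then show ?thesis
    using f by (intro loc_int_mult[OF w f(2)]) (auto intro: borel_measurable_continuous_onI)
qed

lemma loc_int_continuous: "continuous_on UNIV w \<Longrightarrow> loc_int w"
  unfolding loc_int_def
  using borel_integrable_compact[where f=w] continuous_on_subset[of UNIV w]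
  by (auto intro: borel_measurable_continuous_onI)

lemma loc_int_integrable: "integrable lborel w \<Longrightarrow> loc_int w"
  unfolding loc_int_def
  using integrable_mult_indicator[where f=w and M=lborel] compact_imp_closed borel_closed by auto

lemma integrable_cont_compact:
  assumes f: "continuous_on UNIV f" "compact K" "\<And>x. x \<notin> K \<Longrightarrow> f x = (0::real)"
  shows "integrable lborel f"
  using loc_int_mult_cont[OF loc_int_continuous[OF continuous_on_const[of _ 1]] f] by simp

text \<open>The Borel sets whose part in a fixed box carries integral \<open>0\<close> form a Dynkin system. It contains the
boxes, which generate the Borel sets and are stable under intersection. Taking the sets where \<open>w\<close> is
nonnegative and where it is negative shows that the integral of \<open>\<bar>w\<bar>\<close> over each box vanishes.\<close>

lemma box_integrals_0_AE:
  fixes w :: "'a::euclidean_space \<Rightarrow> real"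
  assumes w: "loc_int w" and 0: "\<And>a c. (LINT x|lborel. indicator (box a c) x * w x) = 0"
  shows "AE x in lborel. w x = 0"
proof -
  have [measurable]: "w \<in> borel_measurable borel" using w by (auto simp: loc_int_def)
  have int: "integrable lborel (\<lambda>x. indicator A x * w x)"
    if "A \<subseteq> cbox a c" "A \<in> sets borel" for A a c
  proof (rule Bochner_Integration.integrable_bound)
    show "integrable lborel (\<lambda>x. indicator (cbox a c) x * w x)" using w by (auto simp: loc_int_def)
    show "AE x in lborel. norm (indicator A x * w x) \<le> norm (indicator (cbox a c) x * w x)"
      using that by (auto simp: indicator_def)
  qed (use that in measurable)
  have box0: "(LINT x|lborel. indicator (A \<inter> box a c) x * w x) = 0" if "A \<in> sets borel" for A a c
  proof -
    have 1: "A \<in> sigma_sets UNIV (range (\<lambda>(a, b). box a b))"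
      using that by (simp add: borel_eq_box sets_measure_of)
    have 2: "Int_stable (range (\<lambda>(a, b). box a b :: 'a set))"
      by (auto simp: Int_stable_def box_Int_box)
    have 3: "range (\<lambda>(a, b). box a b :: 'a set) \<subseteq> Pow UNIV" by auto
    from 2 3 1 show ?thesis
    proof (induction rule: sigma_sets_induct_disjoint)
      case (basic A)
      then obtain p q where "A = box p q" by auto
      then show ?case using 0 by (auto simp: box_Int_box)
    next
      case empty then show ?case by simp
    next
      case (compl A)
      have A: "A \<in> sets borel" using compl by (simp add: borel_eq_box sets_measure_of)
      have "(LINT x|lborel. indicator ((UNIV - A) \<inter> box a c) x * w x)
         = (LINT x|lborel. indicator (box a c) x * w x - indicator (A \<inter> box a c) x * w x)"
        by (rule Bochner_Integration.integral_cong) (auto simp: indicator_def)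
      also have "\<dots> = 0"
        using A by (subst Bochner_Integration.integral_diff)
          (auto intro!: int[of _ a c] simp: 0 compl subsetD[OF box_subset_cbox])
      finally show ?case .
    next
      case (union A)
      have A: "A i \<in> sets borel" for i using union by (auto simp: borel_eq_box sets_measure_of)
      have "(LINT x|lborel. indicator ((\<Union>i. A i) \<inter> box a c) x * w x)
          = (LINT x|lborel. indicator (\<Union>i. A i \<inter> box a c) x *\<^sub>R w x)"
        by (rule Bochner_Integration.integral_cong) (auto simp: indicator_def)
      also have "\<dots> = (\<Sum>i. (LINT x:(A i \<inter> box a c)|lborel. w x))"
        unfolding set_lebesgue_integral_def[symmetric]
        using A union(1) int[of "(\<Union>i. A i \<inter> box a c)" a c] box_subset_cbox[of a c]
        by (intro lebesgue_integral_countable_add)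
          (auto simp: set_integrable_def disjoint_family_on_def)
      also have "\<dots> = 0" using union by (simp add: set_lebesgue_integral_def)
      finally show ?case .
    qed
  qed
  have "AE x in lborel. \<forall>n::nat. x \<in> box (- (real n *\<^sub>R One)) (real n *\<^sub>R One) \<longrightarrow> w x = 0"
  proof (subst AE_all_countable, rule)
    fix n :: nat
    let ?B = "box (- (real n *\<^sub>R One)) (real n *\<^sub>R One) :: 'a set"
    have "AE x in lborel. indicator (A \<inter> ?B) x * \<bar>w x\<bar> = 0"
      if A: "A = {x. w x \<ge> 0} \<or> A = {x. w x < 0}" for A
    proof -
      have Am[measurable]: "A \<in> sets borel" using A by auto
      have i: "integrable lborel (\<lambda>x. indicator (A \<inter> ?B) x * \<bar>w x\<bar>)"
        using integrable_norm[OF int[OF _ _, of "A \<inter> ?B"], OF le_infI2[OF box_subset_cbox]]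
        by (auto simp: abs_mult)
      have "(LINT x|lborel. indicator (A \<inter> ?B) x * \<bar>w x\<bar>)
          = (LINT x|lborel. (if A = {x. w x \<ge> 0} then 1 else -1) * (indicator (A \<inter> ?B) x * w x))"
        using A by (intro Bochner_Integration.integral_cong) (auto simp: indicator_def)
      also have "\<dots> = 0" by (simp only: Bochner_Integration.integral_mult_right_zero) (simp add: box0)
      finally show ?thesis
        using integral_nonneg_eq_0_iff_AE[OF i] by auto
    qed
    from this[of "{x. w x \<ge> 0}"] this[of "{x. w x < 0}"]
    have "AE x in lborel. indicator ({x. w x \<ge> 0} \<inter> ?B) x * \<bar>w x\<bar> = 0 \<and>
       indicator ({x. w x < 0} \<inter> ?B) x * \<bar>w x\<bar> = 0" by auto
    then show "AE x in lborel. x \<in> ?B \<longrightarrow> w x = 0"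
      by eventually_elim (auto simp: indicator_def split: if_splits)
  qed
  moreover have *: "\<exists>n::nat. x \<in> box (- (real n *\<^sub>R One)) (real n *\<^sub>R One)" for x :: 'a
  proof -
    have "x \<in> (\<Union>n::nat. box (- (real n *\<^sub>R One)) (real n *\<^sub>R One))"
      by (simp only: UN_box_eq_UNIV UNIV_I)
    then show ?thesis by blast
  qed
  ultimately show ?thesis by (auto elim!: eventually_mono)
qed

text \<open>For a bump \<open>f\<close> that is positive exactly on a box, the test functions \<open>1 - exp (- n f)\<close> increase to the
indicator of the box.\<close>

lemma test_function_fundamental:
  fixes w :: "'a::euclidean_space \<Rightarrow> real"
  assumes w: "loc_int w" and 0: "\<And>\<phi>. test_function \<phi> \<Longrightarrow> (LINT x|lborel. w x * \<phi> x) = 0"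
  shows "AE x in lborel. w x = 0"
proof (rule box_integrals_0_AE[OF w])
  fix a c :: 'a
  have [measurable]: "w \<in> borel_measurable borel" using w by (auto simp: loc_int_def)
  obtain f :: "'a \<Rightarrow> real" where f: "smooth f" "\<And>x. 0 \<le> f x" "\<And>x. f x > 0 \<longleftrightarrow> x \<in> box a c"
    "\<And>x. x \<notin> cbox a c \<Longrightarrow> f x = 0" using test_function_box[of a c] by metis
  have [measurable]: "f \<in> borel_measurable borel"
    using Ck_continuous[OF smooth_Ck[OF f(1)]] by (rule borel_measurable_continuous_onI)
  define g where "g n x = 1 + (- 1) * exp ((- real n) * f x)" for n and x :: 'a
  have g0: "g n x = 0" if "x \<notin> cbox a c" for n x using f(4)[OF that] by (simp add: g_def)
  have "smooth (g n)" for n unfolding smooth_def g_def[abs_def]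
    by (intro allI Ck_add Ck_mult Ck_const Ck_compose[OF Ck_exp] smooth_Ck f)
  then have "test_function (g n)" for n
    using test_functionI[OF _ compact_cbox[of a c]] g0 by blast
  then have "(LINT x|lborel. w x * g n x) = 0" for n by (rule 0)
  moreover have "(\<lambda>n. LINT x|lborel. w x * g n x) \<longlonglongrightarrow> (LINT x|lborel. indicator (box a c) x * w x)"
  proof (rule integral_dominated_convergence)
    show "integrable lborel (\<lambda>x. \<bar>indicator (cbox a c) x * w x\<bar>)"
      using w by (auto simp: loc_int_def)
    have b: "\<bar>g n x\<bar> \<le> 1" for n x using f(2)[of x] by (auto simp: g_def)
    show "AE x in lborel. norm (w x * g n x) \<le> \<bar>indicator (cbox a c) x * w x\<bar>" for n
      using g0[of _ n] mult_left_mono[OF b[of n], of "\<bar>w _\<bar>"]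
      by (auto intro!: AE_I2 simp: abs_mult indicator_def)
    have "(\<lambda>n. w x * g n x) \<longlonglongrightarrow> indicator (box a c) x * w x" for x
    proof (cases "x \<in> box a c")
      case True
      then have "f x > 0" using f(3) by blast
      have "(\<lambda>n. exp (- f x) ^ n) \<longlonglongrightarrow> 0"
        using \<open>f x > 0\<close> by (intro LIMSEQ_realpow_zero) auto
      then have "(\<lambda>n. exp ((- real n) * f x)) \<longlonglongrightarrow> 0"
        by (simp add: exp_of_nat_mult[symmetric])
      then have "(\<lambda>n. w x * g n x) \<longlonglongrightarrow> w x * (1 + (- 1) * 0)"
        unfolding g_def by (intro tendsto_intros)
      then show ?thesis using True by simp
    next
      case False
      then have "f x = 0" using f(2,3)[of x] by linarith
      then show ?thesis using False by (simp add: g_def)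
    qed
    then show "AE x in lborel. (\<lambda>n. w x * g n x) \<longlonglongrightarrow> indicator (box a c) x * w x" by auto
  qed (auto simp: g_def)
  ultimately show "(LINT x|lborel. indicator (box a c) x * w x) = 0"
    using LIMSEQ_unique[OF _ tendsto_const[of 0]] by auto
qed

lemma continuous_AE_0:
  fixes w :: "'a::euclidean_space \<Rightarrow> real"
  assumes w: "continuous_on UNIV w" and ae: "AE x in lborel. w x = 0"
  shows "w x = 0"
proof -
  have "{x. w x \<noteq> 0} \<in> null_sets lborel"
    using ae borel_measurable_continuous_onI[OF w] by (subst (asm) AE_iff_null) auto
  then have "negligible {x. w x \<noteq> 0}" using null_sets_completionI negligible_iff_null_sets by blast
  moreover have "open {x. w x \<noteq> 0}" using w by (intro open_Collect_neq) (auto intro: continuous_intros)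
  ultimately show ?thesis using open_not_negligible by blast
qed

lemma test_function_fundamental_cont:
  fixes w :: "'a::euclidean_space \<Rightarrow> real"
  assumes w: "continuous_on UNIV w"
    and 0: "\<And>\<phi>. test_function \<phi> \<Longrightarrow> (LINT x|lborel. w x * \<phi> x) = 0"
  shows "w x = 0"
proof -
  have "AE x in lborel. w x = 0"
    by (rule test_function_fundamental[OF loc_int_continuous[OF w] 0])
  then show ?thesis by (rule continuous_AE_0[OF w])
qed

lemma test_function_bump:
  fixes U :: "'a::euclidean_space set"
  assumes "open U" "x0 \<in> U"
  obtains \<phi> where "test_function \<phi>" "\<And>x. 0 \<le> \<phi> x" "\<phi> x0 > 0" "\<And>x. x \<notin> U \<Longrightarrow> \<phi> x = 0"
proof -
  obtain a c where ac: "cbox a c \<subseteq> U" "x0 \<in> box a c" "\<forall>i\<in>Basis. a \<bullet> i < c \<bullet> i"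
    by (rule open_contains_cbox[OF assms])
  obtain f :: "'a \<Rightarrow> real" where f: "smooth f" "\<And>x. 0 \<le> f x" "\<And>x. f x > 0 \<longleftrightarrow> x \<in> box a c"
    "\<And>x. x \<notin> cbox a c \<Longrightarrow> f x = 0" using test_function_box[of a c] by metis
  have "test_function f" by (rule test_functionI[OF f(1) compact_cbox f(4)])
  then show ?thesis
  proof (rule that)
    show "f x = 0" if "x \<notin> U" for x using that ac(1) f(4)[of x] by blast
  qed (use f ac in auto)
qed

lemma test_function_cont: "test_function \<phi> \<Longrightarrow> continuous_on UNIV \<phi>"
  using Ck_continuous[OF test_function_Ck] .

lemma test_function_integrable: "test_function \<phi> \<Longrightarrow> integrable lborel \<phi>"
  by (metis test_functionE integrable_cont_compact test_function_cont)

lemma test_function_borel: "test_function \<phi> \<Longrightarrow> \<phi> \<in> borel_measurable borel"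
  using borel_measurable_continuous_onI[OF test_function_cont] .

section \<open>Continuous functions in L^1\<close>

lemma integral_pos_cont:
  fixes f :: "'a::euclidean_space \<Rightarrow> real"
  assumes "continuous_on UNIV f" "integrable lborel f" "\<And>x. 0 \<le> f x" "f x0 > 0"
  shows "(LINT x|lborel. f x) > 0"
proof -
  have "(LINT x|lborel. f x) \<noteq> 0"
  proof
    assume "(LINT x|lborel. f x) = 0"
    then have "AE x in lborel. f x = 0" using integral_nonneg_eq_0_iff_AE[of lborel f] assms by auto
    from continuous_AE_0[OF assms(1) this, of x0] show False using assms(4) by simp
  qed
  moreover have "(LINT x|lborel. f x) \<ge> 0" using assms(3) by simp
  ultimately show ?thesis by simp
qed

text \<open>For an indicator, outer regularity of the set and of its complement provides an open set around it and
a closed set inside it that differ by little; a Urysohn function between them is the approximation.\<close>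

lemma continuous_approx_L1:
  fixes f :: "'a::euclidean_space \<Rightarrow> real"
  assumes "integrable lborel f"
  shows "\<forall>e>0. \<exists>g. continuous_on UNIV g \<and> integrable lborel g \<and> (LINT x|lborel. \<bar>f x - g x\<bar>) < e"
  using assms
proof (induction rule: integrable_induct)
  case (base A c)
  show ?case
  proof (intro allI impI)
    fix e :: real assume e: "e > 0"
    define d where "d = e / (2 * (\<bar>c\<bar> + 1))"
    have d: "d > 0" using e by (auto simp: d_def)
    have A: "A \<in> sets borel" "- A \<in> sets borel" using base by auto
    obtain U where U: "open U" "A \<subseteq> U" "emeasure lborel (U - A) < ennreal d"
      using outer_regular_lborel[OF A(1) d] by blast
    obtain V where V: "open V" "- A \<subseteq> V" "emeasure lborel (V - (- A)) < ennreal d"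
      using outer_regular_lborel[OF A(2) d] by blast
    obtain h :: "'a \<Rightarrow> real" where h: "continuous_on UNIV h" "\<And>x. h x \<in> closed_segment 1 0"
       "\<And>x. x \<in> - V \<Longrightarrow> h x = 1" "\<And>x. x \<in> - U \<Longrightarrow> h x = 0"
      using Urysohn[of "- V" "- U" 1 0] U V by auto
    have h01: "0 \<le> h x" "h x \<le> 1" for x using h(2)[of x] by (auto simp: closed_segment_eq_real_ivl)
    have [measurable]: "h \<in> borel_measurable borel" using h(1) by (rule borel_measurable_continuous_onI)
    have [measurable]: "U \<in> sets borel" "V \<in> sets borel" "A \<in> sets borel" using U V A by auto
    \<comment> \<open>The closed set is the complement of V, so indicator and h differ only where U or V is too large.\<close>
    have le: "\<bar>indicator A x - h x\<bar> \<le> indicat_real (U - A) x + indicator (V - (- A)) x" for x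
      using h01[of x] h(3,4)[of x] U(2) V(2) by (auto simp: indicator_def)
    have fin: "emeasure lborel (U - A) < \<infinity>" "emeasure lborel (V - (- A)) < \<infinity>"
      using U(3) V(3) by (auto intro: less_trans)
    have i: "integrable lborel (\<lambda>x. indicat_real (U - A) x + indicator (V - (- A)) x)"
      using fin by (intro Bochner_Integration.integrable_add integrable_real_indicator) auto
    have ih: "integrable lborel (\<lambda>x. indicator A x - h x)"
      by (rule Bochner_Integration.integrable_bound[OF i]) (use le in \<open>auto intro: order_trans[OF _ abs_ge_self]\<close>)
    have iA: "integrable lborel (indicat_real A)" using base by (intro integrable_real_indicator) auto
    have "integrable lborel (\<lambda>x. indicator A x - (indicator A x - h x))"
      by (rule Bochner_Integration.integrable_diff[OF iA ih])
    then have ih': "integrable lborel h" by simp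
    have "(LINT x|lborel. \<bar>indicator A x *\<^sub>R c - h x * c\<bar>) = (LINT x|lborel. \<bar>c\<bar> * \<bar>indicator A x - h x\<bar>)"
      by (rule Bochner_Integration.integral_cong) (auto simp: abs_mult[symmetric] algebra_simps)
    also have "\<dots> = \<bar>c\<bar> * (LINT x|lborel. \<bar>indicator A x - h x\<bar>)" by simp
    also have "\<dots> \<le> \<bar>c\<bar> * (LINT x|lborel. indicat_real (U - A) x + indicator (V - (- A)) x)"
      using ih i le by (intro mult_left_mono integral_mono) auto
    also have "\<dots> = \<bar>c\<bar> * (measure lborel (U - A) + measure lborel (V - (- A)))"
      using fin by (subst Bochner_Integration.integral_add) (auto intro!: integrable_real_indicator)
    also have "\<dots> \<le> \<bar>c\<bar> * (d + d)"
    proof -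
      have "measure lborel S \<le> d" if "emeasure lborel S < ennreal d" for S :: "'a set"
        unfolding measure_def using d that by (intro enn2real_leI order.strict_implies_order) auto
      from this[OF U(3)] this[OF V(3)] have "measure lborel (U - A) \<le> d" "measure lborel (V - (- A)) \<le> d" .
      then show ?thesis by (intro mult_left_mono) auto
    qed
    also have "\<dots> < e"
    proof -
      have "0 < 2 * (\<bar>c\<bar> + 1)" using abs_ge_zero[of c] by (simp add: add_nonneg_pos)
      then have "2 * (\<bar>c\<bar> + 1) \<noteq> 0" by (rule less_imp_neq[symmetric])
      then have "d * (2 * (\<bar>c\<bar> + 1)) = e" unfolding d_def by (rule nonzero_eq_divide_eq[THEN iffD1, OF _ refl])
      then have "\<bar>c\<bar> * (d + d) + (d + d) = e" by (simp add: algebra_simps)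
      then show ?thesis using d by (smt (verit))
    qed
    finally show "\<exists>g. continuous_on UNIV g \<and> integrable lborel g \<and> (LINT x|lborel. \<bar>indicator A x *\<^sub>R c - g x\<bar>) < e"
      using h(1) ih' by (intro exI[of _ "\<lambda>x. h x * c"]) (auto intro!: continuous_intros)
  qed
next
  case (add f g)
  show ?case
  proof (intro allI impI)
    fix e :: real assume e: "e > 0"
    obtain f' where f': "continuous_on UNIV f'" "integrable lborel f'" "(LINT x|lborel. \<bar>f x - f' x\<bar>) < e / 2"
      using add.IH(1) e by (meson half_gt_zero)
    obtain g' where g': "continuous_on UNIV g'" "integrable lborel g'" "(LINT x|lborel. \<bar>g x - g' x\<bar>) < e / 2"
      using add.IH(2) e by (meson half_gt_zero)
    have "(LINT x|lborel. \<bar>f x + g x - (f' x + g' x)\<bar>) \<le> (LINT x|lborel. \<bar>f x - f' x\<bar> + \<bar>g x - g' x\<bar>)"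
      using add.hyps f' g' by (intro integral_mono) auto
    also have "\<dots> = (LINT x|lborel. \<bar>f x - f' x\<bar>) + (LINT x|lborel. \<bar>g x - g' x\<bar>)"
      using add.hyps f' g' by (intro Bochner_Integration.integral_add) auto
    also have "\<dots> < e" using f' g' by simp
    finally show "\<exists>h. continuous_on UNIV h \<and> integrable lborel h \<and> (LINT x|lborel. \<bar>f x + g x - h x\<bar>) < e"
      using f' g' by (intro exI[of _ "\<lambda>x. f' x + g' x"]) (auto intro: continuous_intros)
  qed
next
  case (lim f s)
  show ?case
  proof (intro allI impI)
    fix e :: real assume e: "e > 0"
    have "(\<lambda>i. LINT x|lborel. \<bar>f x - s i x\<bar>) \<longlonglongrightarrow> (LINT (x::'a)|lborel. 0)"
    proof (rule integral_dominated_convergence)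
      show "integrable lborel (\<lambda>x. 3 * \<bar>f x\<bar>)" using lim by auto
      have "\<bar>f x - s i x\<bar> \<le> 3 * \<bar>f x\<bar>" for i x
        using lim.hyps(3)[of x i] by auto
      then show "AE x in lborel. norm \<bar>f x - s i x\<bar> \<le> 3 * \<bar>f x\<bar>" for i by auto
      have "(\<lambda>i. \<bar>f x - s i x\<bar>) \<longlonglongrightarrow> \<bar>f x - f x\<bar>" for x
        using lim.hyps(2)[of x] by (intro tendsto_intros) auto
      then show "AE x in lborel. (\<lambda>i. \<bar>f x - s i x\<bar>) \<longlonglongrightarrow> 0" by simp
    qed (use lim in auto)
    then have "(\<lambda>i. LINT x|lborel. \<bar>f x - s i x\<bar>) \<longlonglongrightarrow> 0" by simp
    then have "\<forall>\<^sub>F i in sequentially. (LINT x|lborel. \<bar>f x - s i x\<bar>) < e / 2"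
      using e by (intro order_tendstoD(2)) auto
    then obtain i where i: "(LINT x|lborel. \<bar>f x - s i x\<bar>) < e / 2"
      by (auto simp: eventually_sequentially)
    obtain g where g: "continuous_on UNIV g" "integrable lborel g" "(LINT x|lborel. \<bar>s i x - g x\<bar>) < e / 2"
      using lim.IH[of i] e by (meson half_gt_zero)
    have "(LINT x|lborel. \<bar>f x - g x\<bar>) \<le> (LINT x|lborel. \<bar>f x - s i x\<bar> + \<bar>s i x - g x\<bar>)"
      using lim.hyps g by (intro integral_mono) auto
    also have "\<dots> = (LINT x|lborel. \<bar>f x - s i x\<bar>) + (LINT x|lborel. \<bar>s i x - g x\<bar>)"
      using lim.hyps g by (intro Bochner_Integration.integral_add) auto
    also have "\<dots> < e" using i g by simp
    finally show "\<exists>g. continuous_on UNIV g \<and> integrable lborel g \<and> (LINT x|lborel. \<bar>f x - g x\<bar>) < e"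
      using g by blast
  qed
qed

section \<open>Second derivatives\<close>

text \<open>Both mixed derivatives are limits of the same second difference, by two applications of the mean value
theorem in either order.\<close>

lemma second_derivative_symmetric:
  fixes f :: "'a::euclidean_space \<Rightarrow> real"
  assumes f: "Ck 2 f"
  shows "frechet_derivative (\<lambda>y. frechet_derivative f (at y) a) (at x) b
       = frechet_derivative (\<lambda>y. frechet_derivative f (at y) b) (at x) a"
proof -
  let ?D = "\<lambda>a y. frechet_derivative f (at y) a"
  let ?DD = "\<lambda>a b y. frechet_derivative (?D a) (at y) b"
  have f1: "Ck (Suc 1) f" using f by (simp add: numeral_2_eq_2)
  have f1': "Ck 1 f" using Ck_le[OF f1, of 1] by simp
  have D1: "Ck 1 (?D a)" for a by (rule Ck_directional[OF f1 Ck_const])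
  have cDD: "continuous_on UNIV (?DD a b)" for a b
    using Ck_directional[of 0 "?D a" "\<lambda>_. b"] D1 by (simp add: Ck_const)
  have line: "((\<lambda>s. g (y + s *\<^sub>R a)) has_real_derivative frechet_derivative g (at (y + s *\<^sub>R a)) a) (at s)"
    if "Ck 1 g" for g :: "'a \<Rightarrow> real" and y a s
  proof -
    have 1: "((\<lambda>s. y + s *\<^sub>R a) has_derivative (\<lambda>t. t *\<^sub>R a)) (at s)" by (auto intro!: derivative_eq_intros)
    have "frechet_derivative g (at (y + s *\<^sub>R a)) (t *\<^sub>R a) = frechet_derivative g (at (y + s *\<^sub>R a)) a * t" for t
      using linear_scale[OF has_derivative_linear[OF Ck_1_has_derivative[OF that]]] by simp
    then show ?thesis using has_derivative_compose[OF 1 Ck_1_has_derivative[OF that]]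
      unfolding has_field_derivative_def by simp
  qed
  have mvt: "\<exists>p q. 0 < p \<and> p < t \<and> 0 < q \<and> q < t \<and>
     f (x + t *\<^sub>R a + t *\<^sub>R b) - f (x + t *\<^sub>R a) - f (x + t *\<^sub>R b) + f x = t * (t * ?DD a b (x + p *\<^sub>R a + q *\<^sub>R b))"
    if t: "t > 0" for t a b
  proof -
    let ?p = "\<lambda>s. f (x + t *\<^sub>R b + s *\<^sub>R a) - f (x + s *\<^sub>R a)"
    have "(?p has_real_derivative (?D a (x + t *\<^sub>R b + s *\<^sub>R a) - ?D a (x + s *\<^sub>R a))) (at s)" for s
      by (rule DERIV_diff[OF line[OF f1'] line[OF f1']])
    from MVT2[of 0 t ?p, OF t this] obtain p where p: "0 < p" "p < t"
      "?p t - ?p 0 = (t - 0) * (?D a (x + t *\<^sub>R b + p *\<^sub>R a) - ?D a (x + p *\<^sub>R a))" by blast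
    let ?q = "\<lambda>s. ?D a ((x + p *\<^sub>R a) + s *\<^sub>R b)"
    from MVT2[of 0 t ?q, OF t line[OF D1]] obtain q where q: "0 < q" "q < t"
      "?q t - ?q 0 = (t - 0) * ?DD a b (x + p *\<^sub>R a + q *\<^sub>R b)" by blast
    have e: "x + t *\<^sub>R b + p *\<^sub>R a = x + p *\<^sub>R a + t *\<^sub>R b" by simp
    have "?p t - ?p 0 = t * (t * ?DD a b (x + p *\<^sub>R a + q *\<^sub>R b))"
      using p(3)[unfolded e] q(3) by simp
    moreover have "x + t *\<^sub>R b + t *\<^sub>R a = x + t *\<^sub>R a + t *\<^sub>R b" by simp
    ultimately show ?thesis using p q by (intro exI[of _ p] exI[of _ q]) (simp add: algebra_simps)
  qed
  have lim: "\<exists>z. z \<longlonglongrightarrow> x \<and> (\<forall>n. let t = 1 / real (Suc n) in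
     f (x + t *\<^sub>R a + t *\<^sub>R b) - f (x + t *\<^sub>R a) - f (x + t *\<^sub>R b) + f x = t * (t * ?DD a b (z n)))" for a b
  proof -
    let ?t = "\<lambda>n. 1 / real (Suc n)"
    have "\<forall>n. \<exists>p q. 0 < p \<and> p < ?t n \<and> 0 < q \<and> q < ?t n \<and>
     f (x + ?t n *\<^sub>R a + ?t n *\<^sub>R b) - f (x + ?t n *\<^sub>R a) - f (x + ?t n *\<^sub>R b) + f x
       = ?t n * (?t n * ?DD a b (x + p *\<^sub>R a + q *\<^sub>R b))"
      by (intro allI mvt) simp
    then obtain p q where pq: "\<And>n. 0 < p n \<and> p n < ?t n \<and> 0 < q n \<and> q n < ?t n \<and>
     f (x + ?t n *\<^sub>R a + ?t n *\<^sub>R b) - f (x + ?t n *\<^sub>R a) - f (x + ?t n *\<^sub>R b) + f x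
       = ?t n * (?t n * ?DD a b (x + p n *\<^sub>R a + q n *\<^sub>R b))" by metis
    have t0: "?t \<longlonglongrightarrow> 0" using LIMSEQ_inverse_real_of_nat by (simp add: inverse_eq_divide)
    have "p \<longlonglongrightarrow> 0" "q \<longlonglongrightarrow> 0"
      using pq by (auto intro!: tendsto_sandwich[OF _ _ tendsto_const t0] always_eventually less_imp_le)
    then have "(\<lambda>n. x + p n *\<^sub>R a + q n *\<^sub>R b) \<longlonglongrightarrow> x + 0 *\<^sub>R a + 0 *\<^sub>R b" by (intro tendsto_intros)
    then show ?thesis using pq by (intro exI[of _ "\<lambda>n. x + p n *\<^sub>R a + q n *\<^sub>R b"]) (simp add: Let_def)
  qed
  obtain z where z: "z \<longlonglongrightarrow> x" "\<And>n. let t = 1 / real (Suc n) in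
     f (x + t *\<^sub>R a + t *\<^sub>R b) - f (x + t *\<^sub>R a) - f (x + t *\<^sub>R b) + f x = t * (t * ?DD a b (z n))"
    using lim[of a b] by blast
  obtain y where y: "y \<longlonglongrightarrow> x" "\<And>n. let t = 1 / real (Suc n) in
     f (x + t *\<^sub>R b + t *\<^sub>R a) - f (x + t *\<^sub>R b) - f (x + t *\<^sub>R a) + f x = t * (t * ?DD b a (y n))"
    using lim[of b a] by blast
  have eq: "?DD a b (z n) = ?DD b a (y n)" for n
  proof -
    define t where "t = 1 / real (Suc n)"
    have t: "t \<noteq> 0" by (simp add: t_def)
    have e: "x + t *\<^sub>R b + t *\<^sub>R a = x + t *\<^sub>R a + t *\<^sub>R b" by simp
    have "t * (t * ?DD a b (z n)) = t * (t * ?DD b a (y n))"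
      using z(2)[of n] y(2)[of n] unfolding Let_def t_def[symmetric] e by linarith
    then show ?thesis using t by simp
  qed
  have "(\<lambda>n. ?DD a b (z n)) \<longlonglongrightarrow> ?DD a b x" "(\<lambda>n. ?DD b a (y n)) \<longlonglongrightarrow> ?DD b a x"
    using continuous_on_tendsto_compose[OF cDD z(1)] continuous_on_tendsto_compose[OF cDD y(1)] by auto
  then show ?thesis unfolding eq using LIMSEQ_unique by blast
qed

text \<open>The product rule for \<open>Y f\<close>. In the commutator of two fields the terms with second derivatives
of \<open>f\<close> cancel by symmetry, and the terms with derivatives of the fields make up the bracket.\<close>

lemma frechet_derivative_along_field:
  fixes f :: "'a::euclidean_space \<Rightarrow> real"
  assumes f: "Ck 2 f" and Y: "Ck 1 Y"
  shows "frechet_derivative (\<lambda>y. frechet_derivative f (at y) (Y y)) (at x) v =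
     frechet_derivative (\<lambda>y. frechet_derivative f (at y) (Y x)) (at x) v
     + frechet_derivative f (at x) (frechet_derivative Y (at x) v)"
proof -
  let ?D = "\<lambda>a y. frechet_derivative f (at y) a"
  have f1: "Ck (Suc 1) f" using f by (simp add: numeral_2_eq_2)
  have f1': "Ck 1 f" using Ck_le[OF f1, of 1] by simp
  have D1: "Ck 1 (?D a)" for a by (rule Ck_directional[OF f1 Ck_const])
  have lin: "linear (frechet_derivative f (at y))" for y
    by (rule has_derivative_linear[OF Ck_1_has_derivative[OF f1']])
  have exp: "?D w y = (\<Sum>b\<in>Basis. (w \<bullet> b) * ?D b y)" for w y
    using linear_Basis_sum[OF lin, of y w] by simp
  have e1: "(\<lambda>y. ?D (Y y) y) = (\<lambda>y. \<Sum>b\<in>Basis. (Y y \<bullet> b) * ?D b y)" by (intro ext exp)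
  have e2: "(\<lambda>y. ?D (Y x) y) = (\<lambda>y. \<Sum>b\<in>Basis. (Y x \<bullet> b) * ?D b y)" by (intro ext exp)
  have 1: "((\<lambda>y. ?D (Y y) y) has_derivative (\<lambda>v. \<Sum>b\<in>Basis. (Y x \<bullet> b) * frechet_derivative (?D b) (at x) v
      + (frechet_derivative Y (at x) v \<bullet> b) * ?D b x)) (at x)"
    unfolding e1
    by (intro has_derivative_sum has_derivative_mult Ck_1_has_derivative[OF D1]
        has_derivative_inner_left Ck_1_has_derivative[OF Y])
  have 2: "((\<lambda>y. ?D (Y x) y) has_derivative (\<lambda>v. \<Sum>b\<in>Basis. (Y x \<bullet> b) * frechet_derivative (?D b) (at x) v)) (at x)"
    unfolding e2
    by (intro has_derivative_sum has_derivative_mult_right Ck_1_has_derivative[OF D1])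
  have "frechet_derivative (\<lambda>y. ?D (Y y) y) (at x) v = (\<Sum>b\<in>Basis. (Y x \<bullet> b) * frechet_derivative (?D b) (at x) v
      + (frechet_derivative Y (at x) v \<bullet> b) * ?D b x)"
    by (simp only: frechet_derivative_at[OF 1, symmetric])
  moreover have "frechet_derivative (?D (Y x)) (at x) v = (\<Sum>b\<in>Basis. (Y x \<bullet> b) * frechet_derivative (?D b) (at x) v)"
    by (simp only: frechet_derivative_at[OF 2, symmetric])
  ultimately show ?thesis using exp[where w="frechet_derivative Y (at x) v" and y=x] by (simp only: sum.distrib)
qed

section \<open>Differentiation under the integral sign\<close>

text \<open>The weight is merely locally integrable, as it will be a Sobolev function or the indicator of a ball;
all the regularity comes from the kernel.\<close>

lemma continuous_integral_param:
  fixes \<Psi> :: "'b::euclidean_space \<times> 'a::euclidean_space \<Rightarrow> real"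
  assumes w: "loc_int w" and \<Psi>: "continuous_on UNIV \<Psi>" and K: "compact K" and e: "e > 0"
    and supp: "\<And>x z. x \<in> ball x0 e \<Longrightarrow> z \<notin> K \<Longrightarrow> \<Psi> (x, z) = 0"
  shows "isCont (\<lambda>x. LINT z|lborel. w z * \<Psi> (x, z)) x0"
proof -
  let ?C = "cball x0 (e/2) \<times> K"
  have [measurable]: "w \<in> borel_measurable borel" using w by (auto simp: loc_int_def)
  have "compact (\<Psi> ` ?C)"
    using \<Psi> K by (intro compact_continuous_image compact_Times continuous_on_subset[OF \<Psi>]) auto
  then obtain C where C: "\<forall>y\<in>\<Psi> ` ?C. norm y \<le> C" using compact_imp_bounded bounded_iff by blast
  have cont: "continuous_on UNIV (\<lambda>z. \<Psi> (x, z))" for x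
    by (rule continuous_on_compose2[OF \<Psi>]) (auto intro!: continuous_intros)
  have [measurable]: "(\<lambda>z. \<Psi> (x, z)) \<in> borel_measurable borel" for x
    using cont by (rule borel_measurable_continuous_onI)
  have "(\<lambda>n. LINT z|lborel. w z * \<Psi> (X n, z)) \<longlonglongrightarrow> (LINT z|lborel. w z * \<Psi> (x0, z))"
    if X: "X \<longlonglongrightarrow> x0" for X
  proof -
    have "\<forall>\<^sub>F n in sequentially. X n \<in> cball x0 (e/2)"
      using tendstoD[OF X, of "e/2"] e by (auto elim!: eventually_mono simp: dist_commute)
    then obtain N where N: "\<And>n. n \<ge> N \<Longrightarrow> X n \<in> cball x0 (e/2)"
      by (auto simp: eventually_sequentially)
    have "(\<lambda>n. LINT z|lborel. w z * \<Psi> (X (n + N), z)) \<longlonglongrightarrow> (LINT z|lborel. w z * \<Psi> (x0, z))"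
    proof (rule integral_dominated_convergence)
      show "integrable lborel (\<lambda>z. \<bar>C\<bar> * \<bar>indicator K z * w z\<bar>)"
        using w K by (auto simp: loc_int_def)
      have "\<bar>w z * \<Psi> (X (n + N), z)\<bar> \<le> \<bar>C\<bar> * \<bar>indicator K z * w z\<bar>" for n z
      proof (cases "z \<in> K")
        case True
        then have "\<Psi> (X (n + N), z) \<in> \<Psi> ` ?C" using N[of "n+N"] by (intro imageI) auto
        then have "norm (\<Psi> (X (n + N), z)) \<le> C" using C by blast
        then have "\<bar>\<Psi> (X (n + N), z)\<bar> \<le> \<bar>C\<bar>" by simp
        from mult_left_mono[OF this, of "\<bar>w z\<bar>"] True show ?thesis
          by (simp add: abs_mult mult.commute)
      next
        case False
        then have "\<Psi> (X (n + N), z) = 0" using supp[of "X (n+N)" z] N[of "n+N"] e by auto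
        then show ?thesis by simp
      qed
      then show "AE z in lborel. norm (w z * \<Psi> (X (n + N), z)) \<le> \<bar>C\<bar> * \<bar>indicator K z * w z\<bar>" for n
        by auto
      have "(\<lambda>n. \<Psi> (X (n + N), z)) \<longlonglongrightarrow> \<Psi> (x0, z)" for z
        by (rule continuous_on_tendsto_compose[OF \<Psi>
              tendsto_Pair[OF LIMSEQ_ignore_initial_segment[OF X] tendsto_const]]) auto
      then show "AE z in lborel. (\<lambda>n. w z * \<Psi> (X (n + N), z)) \<longlonglongrightarrow> w z * \<Psi> (x0, z)"
        by (auto intro!: tendsto_intros)
    qed auto
    then show ?thesis by (rule LIMSEQ_offset)
  qed
  then show ?thesis unfolding continuous_at_sequentially by (auto simp: o_def)
qed

text \<open>The remainders of first order, divided by the increment, are supported in \<open>K\<close> and bounded by twice a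
Lipschitz constant \<open>C\<close> of the kernel in its first argument, so that \<open>2 * C * \<bar>w\<bar>\<close> on \<open>K\<close> dominates the
integrands.\<close>

lemma has_derivative_integral_param:
  fixes \<Psi> :: "'b::euclidean_space \<times> 'a::euclidean_space \<Rightarrow> real"
  assumes w: "loc_int w" and \<Psi>: "Ck 1 \<Psi>" and K: "compact K" and e: "e > 0"
    and supp: "\<And>x z. x \<in> ball x0 e \<Longrightarrow> z \<notin> K \<Longrightarrow> \<Psi> (x, z) = 0"
  shows "((\<lambda>x. LINT z|lborel. w z * \<Psi> (x, z)) has_derivative
          (\<lambda>h. LINT z|lborel. w z * frechet_derivative \<Psi> (at (x0, z)) (h, 0))) (at x0)"
proof -
  let ?C = "cball x0 (e/2) \<times> K"
  let ?D = "\<lambda>x z h. frechet_derivative \<Psi> (at (x, z)) (h, 0)"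
  have [measurable]: "w \<in> borel_measurable borel" using w by (auto simp: loc_int_def)
  have cont: "continuous_on UNIV (\<lambda>z. \<Psi> (x, z))" for x
    by (rule continuous_on_compose2[OF Ck_continuous[OF \<Psi>]]) (auto intro!: continuous_intros)
  have [measurable]: "(\<lambda>z. \<Psi> (x, z)) \<in> borel_measurable borel" for x
    using cont by (rule borel_measurable_continuous_onI)
  have der: "((\<lambda>x. \<Psi> (x, z)) has_derivative ?D x z) (at x)" for x z
  proof -
    have "((\<lambda>x. (x, z)) has_derivative (\<lambda>h. (h, 0))) (at x)" by (auto intro!: derivative_eq_intros)
    from has_derivative_compose[OF this Ck_1_has_derivative[OF \<Psi>]] show ?thesis .
  qed
  have lin: "linear (?D x z)" for x z using has_derivative_linear[OF der] .
  have contD: "continuous_on UNIV (\<lambda>p. frechet_derivative \<Psi> (at p) (b, 0))" for b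
    using Ck_directional[of 0 \<Psi> "\<lambda>_. (b, 0)"] \<Psi> by (auto simp: Ck_const)
  have contD2: "continuous_on UNIV (\<lambda>z. ?D x z b)" for x b
    by (rule continuous_on_compose2[OF contD]) (auto intro!: continuous_intros)
  have mD[measurable]: "(\<lambda>z. ?D x z b) \<in> borel_measurable borel" for x b
    using contD2 by (rule borel_measurable_continuous_onI)
  have D0: "?D x z h = 0" if "x \<in> ball x0 e" "z \<notin> K" for x z h
  proof -
    have "((\<lambda>x. \<Psi> (x, z)) has_derivative (\<lambda>_. 0)) (at x)"
      by (rule has_derivative_transform_within_open[where s="ball x0 e" and f="\<lambda>_. 0"])
        (use that supp in auto)
    then show ?thesis using has_derivative_unique[OF der] by metis
  qed
  have "\<exists>C. \<forall>p\<in>?C. \<bar>frechet_derivative \<Psi> (at p) (b, 0)\<bar> \<le> C" for b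
  proof -
    have "compact ((\<lambda>p. frechet_derivative \<Psi> (at p) (b, 0)) ` ?C)"
      using K by (intro compact_continuous_image compact_Times continuous_on_subset[OF contD]) auto
    then obtain C where "\<forall>y\<in>(\<lambda>p. frechet_derivative \<Psi> (at p) (b, 0)) ` ?C. norm y \<le> C"
      using compact_imp_bounded bounded_iff by blast
    then show ?thesis by (intro exI[of _ C]) simp
  qed
  then have "\<exists>C0. \<forall>b. \<forall>p\<in>?C. \<bar>frechet_derivative \<Psi> (at p) (b, 0)\<bar> \<le> C0 b"
    by (intro choice allI)
  then obtain C0 where C0: "\<And>b p. p \<in> ?C \<Longrightarrow> \<bar>frechet_derivative \<Psi> (at p) (b, 0)\<bar> \<le> C0 b"
    by blast
  define C where "C = (\<Sum>b\<in>Basis. \<bar>C0 b\<bar>)"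
  have bound: "\<bar>?D x z h\<bar> \<le> C * norm h" if "x \<in> cball x0 (e/2)" "z \<in> K" for x z h
  proof -
    have "\<bar>?D x z h\<bar> = \<bar>\<Sum>b\<in>Basis. (h \<bullet> b) *\<^sub>R ?D x z b\<bar>"
      by (subst linear_Basis_sum[OF lin]) (rule refl)
    also have "\<dots> \<le> (\<Sum>b\<in>Basis. \<bar>(h \<bullet> b) *\<^sub>R ?D x z b\<bar>)" by (rule sum_abs)
    also have "\<dots> \<le> (\<Sum>b\<in>Basis. \<bar>C0 b\<bar> * norm h)"
    proof (rule sum_mono)
      fix b :: 'b assume "b \<in> Basis"
      then have 1: "\<bar>h \<bullet> b\<bar> \<le> norm h" by (rule Basis_le_norm)
      have "\<bar>?D x z b\<bar> \<le> \<bar>C0 b\<bar>" using C0[of "(x, z)" b] that by auto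
      from mult_mono[OF this 1] show "\<bar>(h \<bullet> b) *\<^sub>R ?D x z b\<bar> \<le> \<bar>C0 b\<bar> * norm h"
        by (simp add: abs_mult mult.commute)
    qed
    also have "\<dots> = C * norm h" by (simp add: C_def sum_distrib_right)
    finally show ?thesis .
  qed
  have C0': "0 \<le> C" by (simp add: C_def sum_nonneg)
  \<comment> \<open>The closed ball of half the radius is compact and convex: compactness bounds the derivative, convexity turns the bound into a Lipschitz constant.\<close>
  have lip: "\<bar>\<Psi> (y, z) - \<Psi> (x0, z)\<bar> \<le> C * norm (y - x0)" if "y \<in> cball x0 (e/2)" "z \<in> K" for y z
  proof -
    have "norm (\<Psi> (y, z) - \<Psi> (x0, z)) \<le> C * norm (y - x0)"
    proof (rule differentiable_bound[OF convex_cball[of x0 "e/2"]])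
      show "((\<lambda>x. \<Psi> (x, z)) has_derivative ?D x z) (at x within cball x0 (e/2))" for x
        by (rule has_derivative_at_withinI[OF der])
      show "onorm (?D x z) \<le> C" if "x \<in> cball x0 (e/2)" for x
        by (rule onorm_le) (use bound[OF that \<open>z \<in> K\<close>] in auto)
    qed (use that e in auto)
    then show ?thesis by simp
  qed
  have intD: "integrable lborel (\<lambda>z. w z * ?D x0 z h)" for h
    by (rule loc_int_mult_cont[OF w contD2 K]) (use D0[of x0] e in auto)
  have int\<Psi>: "integrable lborel (\<lambda>z. w z * \<Psi> (x, z))" if "x \<in> ball x0 e" for x
    by (rule loc_int_mult_cont[OF w cont K]) (use supp[of x] that in auto)
  have linI: "linear (\<lambda>h. LINT z|lborel. w z * ?D x0 z h)"
    using intD by (intro linearI)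
      (simp_all add: linear_add[OF lin] linear_scale[OF lin] distrib_left mult.left_commute)
  show ?thesis
  proof (rule has_derivativeI)
    show "bounded_linear (\<lambda>h. LINT z|lborel. w z * ?D x0 z h)"
      using linI linear_conv_bounded_linear by blast
    show "((\<lambda>y. ((LINT z|lborel. w z * \<Psi> (y, z)) - (LINT z|lborel. w z * \<Psi> (x0, z))
        - (LINT z|lborel. w z * ?D x0 z (y - x0))) /\<^sub>R norm (y - x0)) \<longlongrightarrow> 0) (at x0)"
      unfolding tendsto_at_iff_sequentially
    proof (intro allI impI)
      fix X assume X: "\<forall>i. X i \<in> UNIV - {x0}" "X \<longlonglongrightarrow> x0"
      have "\<forall>\<^sub>F n in sequentially. X n \<in> cball x0 (e/2)"
        using tendstoD[OF X(2), of "e/2"] e by (auto elim!: eventually_mono simp: dist_commute)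
      then obtain N where N: "\<And>n. n \<ge> N \<Longrightarrow> X n \<in> cball x0 (e/2)"
        by (auto simp: eventually_sequentially)
      define Y where "Y n = X (n + N)" for n
      have Y: "Y n \<in> cball x0 (e/2)" "Y n \<noteq> x0" "Y \<longlonglongrightarrow> x0" for n
        using N X unfolding Y_def by (auto intro: LIMSEQ_ignore_initial_segment)
      have Y': "Y n \<in> ball x0 e" for n using Y(1)[of n] e by auto
      let ?R = "\<lambda>n z. (\<Psi> (Y n, z) - \<Psi> (x0, z) - ?D x0 z (Y n - x0)) /\<^sub>R norm (Y n - x0)"
      have R: "\<bar>?R n z\<bar> \<le> 2 * C" "z \<notin> K \<Longrightarrow> ?R n z = 0" for n z
      proof -
        show 0: "?R n z = 0" if "z \<notin> K" using that supp Y' D0[of x0] e by simp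
        show "\<bar>?R n z\<bar> \<le> 2 * C"
        proof (cases "z \<in> K")
          case True
          have p: "norm (Y n - x0) > 0" using Y(2) by auto
          have "\<bar>\<Psi> (Y n, z) - \<Psi> (x0, z) - ?D x0 z (Y n - x0)\<bar> \<le> 2 * C * norm (Y n - x0)"
            using lip[OF Y(1)[of n] True] bound[of x0 z "Y n - x0"] True e by auto
          then show ?thesis using p by (simp add: abs_mult field_simps)
        next
          case False
          show ?thesis using C0' by (subst 0[OF False]) simp
        qed
      qed
      have "(\<lambda>n. LINT z|lborel. w z * ?R n z) \<longlonglongrightarrow> (LINT (z::'a)|lborel. 0)"
      proof (rule integral_dominated_convergence)
        show "integrable lborel (\<lambda>z. 2 * C * \<bar>indicator K z * w z\<bar>)"
          using w K by (auto simp: loc_int_def)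
        have "\<bar>w z * ?R n z\<bar> \<le> 2 * C * \<bar>indicator K z * w z\<bar>" for n z
        proof (cases "z \<in> K")
          case True
          then show ?thesis using mult_left_mono[OF R(1)[of n z], of "\<bar>w z\<bar>"]
            by (simp add: abs_mult mult_ac)
        qed (use R(2) in simp)
        then show "AE z in lborel. norm (w z * ?R n z) \<le> 2 * C * \<bar>indicator K z * w z\<bar>" for n
          by auto
        have "(\<lambda>n. ?R n z) \<longlonglongrightarrow> 0" for z
        proof -
          have "((\<lambda>y. (\<Psi> (y, z) - \<Psi> (x0, z) - ?D x0 z (y - x0)) /\<^sub>R norm (y - x0)) \<longlongrightarrow> 0) (at x0)"
            using der[of z x0] unfolding has_derivative_at_within by blast
          then show ?thesis
            using Y by (auto simp: tendsto_at_iff_sequentially o_def)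
        qed
        then show "AE z in lborel. (\<lambda>n. w z * ?R n z) \<longlonglongrightarrow> 0"
          by (auto intro!: tendsto_mult_right_zero)
      qed auto
      moreover have "(LINT z|lborel. w z * ?R n z) =
        ((LINT z|lborel. w z * \<Psi> (Y n, z)) - (LINT z|lborel. w z * \<Psi> (x0, z))
        - (LINT z|lborel. w z * ?D x0 z (Y n - x0))) /\<^sub>R norm (Y n - x0)" for n
      proof -
        have "(LINT z|lborel. w z * ?R n z) = (LINT z|lborel. (w z * \<Psi> (Y n, z) - w z * \<Psi> (x0, z)
            - w z * ?D x0 z (Y n - x0)) /\<^sub>R norm (Y n - x0))"
          by (rule Bochner_Integration.integral_cong) (auto simp: algebra_simps)
        also have "\<dots> = (LINT z|lborel. (w z * \<Psi> (Y n, z) - w z * \<Psi> (x0, z)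
            - w z * ?D x0 z (Y n - x0))) /\<^sub>R norm (Y n - x0)" by simp
        also have "(LINT z|lborel. (w z * \<Psi> (Y n, z) - w z * \<Psi> (x0, z)
            - w z * ?D x0 z (Y n - x0))) = (LINT z|lborel. w z * \<Psi> (Y n, z)) - (LINT z|lborel. w z * \<Psi> (x0, z))
        - (LINT z|lborel. w z * ?D x0 z (Y n - x0))"
          using int\<Psi>[OF Y'[of n]] int\<Psi>[of x0] e intD[of "Y n - x0"]
          by (simp add: Bochner_Integration.integral_diff Bochner_Integration.integrable_diff)
        finally show ?thesis .
      qed
      ultimately have "(\<lambda>n. ((LINT z|lborel. w z * \<Psi> (Y n, z)) - (LINT z|lborel. w z * \<Psi> (x0, z))
        - (LINT z|lborel. w z * ?D x0 z (Y n - x0))) /\<^sub>R norm (Y n - x0)) \<longlonglongrightarrow> 0" by simp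
      then show "((\<lambda>y. ((LINT z|lborel. w z * \<Psi> (y, z)) - (LINT z|lborel. w z * \<Psi> (x0, z))
        - (LINT z|lborel. w z * ?D x0 z (y - x0))) /\<^sub>R norm (y - x0)) \<circ> X) \<longlonglongrightarrow> 0"
        unfolding Y_def o_def by (rule LIMSEQ_offset)
    qed
  qed
qed

lemma Ck_1_integral_param:
  fixes \<Psi> :: "'b::euclidean_space \<times> 'a::euclidean_space \<Rightarrow> real"
  assumes w: "loc_int w" and \<Psi>: "Ck 1 \<Psi>"
    and supp: "\<And>x0. \<exists>K e. compact K \<and> e > 0 \<and> (\<forall>x z. x \<in> ball x0 e \<longrightarrow> z \<notin> K \<longrightarrow> \<Psi> (x, z) = 0)"
  shows "Ck 1 (\<lambda>x. LINT z|lborel. w z * \<Psi> (x, z))"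
    and "frechet_derivative (\<lambda>x. LINT z|lborel. w z * \<Psi> (x, z)) (at x) =
         (\<lambda>h. LINT z|lborel. w z * frechet_derivative \<Psi> (at (x, z)) (h, 0))"
proof -
  have der: "((\<lambda>x. LINT z|lborel. w z * \<Psi> (x, z)) has_derivative
          (\<lambda>h. LINT z|lborel. w z * frechet_derivative \<Psi> (at (x0, z)) (h, 0))) (at x0)" for x0
    using supp[of x0] has_derivative_integral_param[OF w \<Psi>, of _ _ x0] by blast
  show "frechet_derivative (\<lambda>x. LINT z|lborel. w z * \<Psi> (x, z)) (at x) =
         (\<lambda>h. LINT z|lborel. w z * frechet_derivative \<Psi> (at (x, z)) (h, 0))"
    using frechet_derivative_at[OF der] by simp
  have "continuous_on UNIV (\<lambda>x0. LINT z|lborel. w z * frechet_derivative \<Psi> (at (x0, z)) (h, 0))" for h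
    unfolding continuous_on_eq_continuous_at[OF open_UNIV]
  proof
    fix x0
    obtain K e where K: "compact K" "e > 0" "\<And>x z. x \<in> ball x0 e \<Longrightarrow> z \<notin> K \<Longrightarrow> \<Psi> (x, z) = 0"
      using supp[of x0] by blast
    show "isCont (\<lambda>x0. LINT z|lborel. w z * frechet_derivative \<Psi> (at (x0, z)) (h, 0)) x0"
    proof (rule continuous_integral_param[OF w _ K(1,2), where \<Psi>="\<lambda>p. frechet_derivative \<Psi> (at p) (h, 0)"])
      show "continuous_on UNIV (\<lambda>p. frechet_derivative \<Psi> (at p) (h, 0))"
        using Ck_directional[of 0 \<Psi> "\<lambda>_. (h, 0)"] \<Psi> by (auto simp: Ck_const)
      show "frechet_derivative \<Psi> (at (x, z)) (h, 0) = 0" if "x \<in> ball x0 e" "z \<notin> K" for x z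
      proof -
        have "((\<lambda>x. (x, z)) has_derivative (\<lambda>h. (h, 0))) (at x)" by (auto intro!: derivative_eq_intros)
        from has_derivative_compose[OF this Ck_1_has_derivative[OF \<Psi>]]
        have "((\<lambda>x. \<Psi> (x, z)) has_derivative (\<lambda>h. frechet_derivative \<Psi> (at (x, z)) (h, 0))) (at x)" .
        moreover have "((\<lambda>x. \<Psi> (x, z)) has_derivative (\<lambda>_. 0)) (at x)"
          by (rule has_derivative_transform_within_open[where s="ball x0 e" and f="\<lambda>_. 0"])
            (use that K in auto)
        ultimately show ?thesis using has_derivative_unique by metis
      qed
    qed
  qed
  then show "Ck 1 (\<lambda>x. LINT z|lborel. w z * \<Psi> (x, z))"
    unfolding One_nat_def by (intro Ck_SucI[OF der]) simp
qed

lemma integral_translate: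
  fixes f :: "'a::euclidean_space \<Rightarrow> real"
  assumes [measurable]: "f \<in> borel_measurable borel"
  shows "(LINT x|lborel. f (t + x)) = (LINT x|lborel. f x)"
proof -
  have "(LINT x|lborel. f x) = (LINT x|distr lborel borel ((+) t). f x)"
    by (simp add: lborel_distr_plus)
  also have "\<dots> = (LINT x|lborel. f (t + x))" by (rule integral_distr) auto
  finally show ?thesis by simp
qed

text \<open>The integral of \<open>f (t b + z)\<close> over \<open>z\<close> does not depend on \<open>t\<close>; differentiate it under the integral sign
at \<open>t = 0\<close>.\<close>

lemma integral_directional_derivative_0:
  fixes f :: "'a::euclidean_space \<Rightarrow> real"
  assumes f: "C1_compact f"
  shows "(LINT x|lborel. frechet_derivative f (at x) b) = 0"
proof -
  obtain K where K: "compact K" "\<And>x. x \<notin> K \<Longrightarrow> f x = 0" and f1: "Ck 1 f"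
    using f unfolding C1_compact_def by blast
  have [measurable]: "f \<in> borel_measurable borel"
    using Ck_continuous[OF f1] by (rule borel_measurable_continuous_onI)
  let ?\<Psi> = "\<lambda>p::real \<times> 'a. f (fst p *\<^sub>R b + snd p)"
  have k: "Ck 1 (\<lambda>p::real \<times> 'a. fst p *\<^sub>R b + snd p)"
    by (intro Ck_add Ck_scaleR Ck_const Ck_bounded_linear bounded_linear_fst bounded_linear_snd)
  have \<Psi>: "Ck 1 ?\<Psi>" by (rule Ck_compose[OF f1 k])
  let ?K = "(\<lambda>p. snd p - fst p *\<^sub>R b) ` (cball 0 1 \<times> K)"
  have "compact ?K"
    using K by (intro compact_continuous_image compact_Times) (auto intro!: continuous_intros)
  moreover have "?\<Psi> (t, z) = 0" if "t \<in> ball 0 1" "z \<notin> ?K" for t z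
  proof (rule ccontr)
    assume "?\<Psi> (t, z) \<noteq> 0"
    then have "t *\<^sub>R b + z \<in> K" using K by auto
    then have "z \<in> ?K" using that by (intro image_eqI[where x="(t, t *\<^sub>R b + z)"]) auto
    then show False using that by blast
  qed
  ultimately have "((\<lambda>t. LINT z|lborel. 1 * ?\<Psi> (t, z)) has_derivative
     (\<lambda>h. LINT z|lborel. 1 * frechet_derivative ?\<Psi> (at (0, z)) (h, 0))) (at 0)"
    by (intro has_derivative_integral_param[OF loc_int_continuous \<Psi>, of _ ?K 1]) auto
  moreover have "frechet_derivative ?\<Psi> (at (0, z)) (h, 0) = frechet_derivative f (at z) (h *\<^sub>R b)" for h z
  proof -
    have 1: "((\<lambda>p::real \<times> 'a. fst p *\<^sub>R b + snd p) has_derivative (\<lambda>q. fst q *\<^sub>R b + snd q)) (at (0, z))"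
      by (auto intro!: derivative_eq_intros)
    have "(f has_derivative frechet_derivative f (at z)) (at (fst (0::real, z) *\<^sub>R b + snd (0::real, z)))"
      using Ck_1_has_derivative[OF f1] by simp
    from has_derivative_compose[OF 1 this]
    have "frechet_derivative ?\<Psi> (at (0, z)) = (\<lambda>q. frechet_derivative f (at z) (fst q *\<^sub>R b + snd q))"
      by (rule frechet_derivative_at[symmetric])
    then show ?thesis by simp
  qed
  ultimately have "((\<lambda>t. LINT z|lborel. f z) has_derivative
     (\<lambda>h. LINT z|lborel. frechet_derivative f (at z) (h *\<^sub>R b))) (at (0::real))"
    by (simp add: integral_translate)
  then have "(\<lambda>h. LINT z|lborel. frechet_derivative f (at z) (h *\<^sub>R b)) = (\<lambda>h::real. 0)"
    using has_derivative_unique has_derivative_const by blast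
  from fun_cong[OF this, of 1] show ?thesis by simp
qed

section \<open>Monotone functions of one variable\<close>

text \<open>Lebesgue's differentiation theorem for averages over intervals that start at the point gives the right
derivative. Applied to \<open>x \<mapsto> - h (- x)\<close> it gives the left derivative.\<close>

lemma AE_has_real_derivative_indefinite_integral:
  fixes h k :: "real \<Rightarrow> real"
  assumes k: "\<And>a b. a \<le> b \<Longrightarrow> (k has_integral (h b - h a)) {a..b}"
  shows "AE y in lborel. (h has_real_derivative k y) (at y)"
proof -
  have right: "AE y in lborel. ((\<lambda>t. (h (y + t) - h y) / t) \<longlongrightarrow> k y) (at_right 0)"
    if k: "\<And>a b. a \<le> b \<Longrightarrow> (k has_integral (h b - h a)) {a..b}" for h k :: "real \<Rightarrow> real"
  proof -
    have int: "k integrable_on cbox a b" for a b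
    proof (cases "a \<le> b")
      case True then show ?thesis using k[OF True] by (auto simp: integrable_on_def)
    qed (simp add: integrable_on_empty)
    obtain Z where Z: "negligible Z" "\<And>x e. \<lbrakk>x \<notin> Z; 0 < e\<rbrakk> \<Longrightarrow> \<exists>d>0. \<forall>t. 0 < t \<and> t < d \<longrightarrow>
        norm (integral (cbox x (x + t *\<^sub>R One)) k /\<^sub>R t ^ DIM(real) - k x) < e"
      using integrable_ccontinuous_explicit[OF int] by blast
    have "((\<lambda>t. (h (y + t) - h y) / t) \<longlongrightarrow> k y) (at_right 0)" if "y \<notin> Z" for y
    proof (rule tendstoI)
      fix e :: real assume "e > 0"
      then obtain d where d: "d > 0" "\<And>t. 0 < t \<Longrightarrow> t < d \<Longrightarrow>
          norm (integral (cbox y (y + t *\<^sub>R One)) k /\<^sub>R t ^ DIM(real) - k y) < e"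
        using Z(2)[OF \<open>y \<notin> Z\<close>] by blast
      have "dist ((h (y + t) - h y) / t) (k y) < e" if "0 < t" "t < d" for t
      proof -
        have "integral {y..y + t} k = h (y + t) - h y" using k[of y "y + t"] that by (auto intro: integral_unique)
        then show ?thesis using d(2)[OF that] by (simp add: dist_real_def divide_inverse mult.commute)
      qed
      then show "\<forall>\<^sub>F t in at_right 0. dist ((h (y + t) - h y) / t) (k y) < e"
        unfolding eventually_at_right[OF zero_less_one] using d(1) by (intro exI[of _ d]) auto
    qed
    then have "{y. \<not> ((\<lambda>t. (h (y + t) - h y) / t) \<longlongrightarrow> k y) (at_right 0)} \<subseteq> Z" by blast
    then have "AE y in lebesgue. ((\<lambda>t. (h (y + t) - h y) / t) \<longlongrightarrow> k y) (at_right 0)"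
      using Z(1) by (intro AE_I'[of Z]) (auto simp: negligible_iff_null_sets)
    then show ?thesis by (simp add: AE_completion_iff)
  qed
  have "((\<lambda>x. k (- x)) has_integral (- h (- b) - - h (- a))) {a..b}" if "a \<le> b" for a b
  proof -
    have "(k has_integral (h (- a) - h (- b))) {- b..- a}" using k[of "- b" "- a"] that by simp
    then show ?thesis using has_integral_reflect_real[of k "h (- a) - h (- b)" "- a" "- b"] by simp
  qed
  from right[OF this] have "AE y in lborel. ((\<lambda>t. (- h (- (y + t)) - - h (- y)) / t) \<longlongrightarrow> k (- y)) (at_right 0)" .
  then have "AE y in distr lborel borel uminus. ((\<lambda>t. (- h (- (y + t)) - - h (- y)) / t) \<longlongrightarrow> k (- y)) (at_right 0)"
    by (simp only: lborel_distr_uminus)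
  from AE_distrD[OF _ this] have left: "AE y in lborel. ((\<lambda>t. (- h (- (- y + t)) - - h (- (- y))) / t) \<longlongrightarrow> k (- (- y))) (at_right 0)"
    by simp
  have "AE y in lborel. ((\<lambda>t. (h (y + t) - h y) / t) \<longlongrightarrow> k y) (at_right 0)" by (rule right[OF k])
  with left show ?thesis
  proof eventually_elim
    case (elim y)
    have fn: "(\<lambda>x. (h (y + - x) - h y) / - x) = (\<lambda>t. (- h (- (- y + t)) - - h (- (- y))) / t)"
    proof
      show "(h (y + - x) - h y) / - x = (- h (- (- y + x)) - - h (- (- y))) / x" for x
        by (cases "x = 0") (simp_all add: field_simps)
    qed
    have "((\<lambda>t. (h (y + t) - h y) / t) \<longlongrightarrow> k y) (at_left 0)"
      using elim(1) unfolding filterlim_at_left_to_right fn minus_zero by simp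
    with elim(2) have "((\<lambda>t. (h (y + t) - h y) / t) \<longlongrightarrow> k y) (at 0)"
      using filterlim_split_at by blast
    then show ?case by (simp add: DERIV_def)
  qed
qed

text \<open>Lebesgue's theorem on monotone functions, derived from differentiation of integrals. The
function \<open>g x = x + f x\<close> does not decrease distances, so it has a monotone left inverse \<open>h\<close> with
Lipschitz constant \<open>1\<close>. The image \<open>\<mu>\<close> of Lebesgue measure under \<open>g\<close> gives the interval \<open>{a<..b}\<close> the
mass \<open>h b - h a\<close>, and it is absolutely continuous because \<open>h\<close> maps null sets to null sets. Hence \<open>h\<close> is the
indefinite integral of the density of \<open>\<mu>\<close>, and it is differentiable almost everywhere with this density
as derivative. The density is positive \<open>\<mu>\<close>-almost everywhere. Pulled back along \<open>g\<close>, this says that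
at almost every \<open>x\<close> the function \<open>h\<close> has a nonzero derivative at \<open>g x\<close>, and the inverse function rule
applies at every such point of continuity of \<open>g\<close>.\<close>

lemma mono_AE_differentiable:
  fixes f :: "real \<Rightarrow> real"
  assumes f: "mono f"
  shows "AE x in lborel. f differentiable (at x)"
proof -
  define g where "g x = x + f x" for x
  have gap: "x' - x \<le> g x' - g x" if "x \<le> x'" for x x' using monoD[OF f that] by (simp add: g_def)
  have gmono: "mono g" using gap by (intro monoI) (smt (verit))
  have gle: "g x \<le> g x' \<longleftrightarrow> x \<le> x'" for x x' using gap[of x x'] gap[of x' x] by linarith
  define h where "h y = Sup {x. g x \<le> y}" for y
  have ne: "{x. g x \<le> y} \<noteq> {}" for y
  proof -
    have "g (min 0 (y - f 0)) \<le> y" using monoD[OF f, of "min 0 (y - f 0)" 0] by (simp add: g_def)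
    then show ?thesis by blast
  qed
  have bd: "bdd_above {x. g x \<le> y}" for y
  proof (rule bdd_aboveI)
    fix x assume "x \<in> {x. g x \<le> y}"
    then show "x \<le> max 0 (y - f 0)" using monoD[OF f, of 0 x] by (cases "0 \<le> x") (auto simp: g_def)
  qed
  have le_h: "x \<le> h y" if "g x \<le> y" for x y unfolding h_def using that bd by (intro cSup_upper) auto
  have h_less: "g x \<le> y" if xh: "x < h y" for x y
  proof -
    obtain x' where "g x' \<le> y" "x < x'" using less_cSupD[OF ne xh[unfolded h_def]] by blast
    then show ?thesis using gle[of x x'] by linarith
  qed
  have hg: "h (g x) = x" for x
  proof -
    have "{x'. g x' \<le> g x} = {..x}" using gle by auto
    then show ?thesis by (simp add: h_def)
  qed
  have h_mono: "h y \<le> h y'" if "y \<le> y'" for y y'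
    unfolding h_def by (rule cSup_subset_mono[OF ne bd]) (use that in auto)
  have h_lip: "h y' \<le> h y + (y' - y)" if "y \<le> y'" for y y'
  proof (rule ccontr)
    assume "\<not> h y' \<le> h y + (y' - y)"
    then obtain x where x: "h y + (y' - y) < x" "x < h y'" using dense not_le by blast
    then obtain z where z: "h y < z" "z < x - (y' - y)" using dense[of "h y" "x - (y' - y)"] by auto
    have "g z > y" using le_h[of z y] z(1) by linarith
    moreover have "g x \<le> y'" by (rule h_less[OF x(2)])
    moreover have "z \<le> x" using z(2) that by linarith
    ultimately show False using gap[of z x] z(2) by linarith
  qed
  have gm[measurable]: "g \<in> borel_measurable borel" by (rule borel_measurable_mono[OF gmono])
  let ?\<mu> = "distr lborel borel g"
  have \<mu>: "emeasure ?\<mu> {a<..b} = ennreal (h b - h a)" if "a \<le> b" for a b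
  proof -
    have "emeasure ?\<mu> {a<..b} = emeasure lborel (g -` {a<..b})" by (subst emeasure_distr) auto
    also have "\<dots> = ennreal (h b - h a)"
    proof (rule antisym)
      have "g -` {a<..b} \<subseteq> {h a..h b}" using le_h[of _ b] h_less[of _ a] by (auto simp: not_le) (metis leI not_le)
      then have "emeasure lborel (g -` {a<..b}) \<le> emeasure lborel {h a..h b}" by (intro emeasure_mono) auto
      then show "emeasure lborel (g -` {a<..b}) \<le> ennreal (h b - h a)" using h_mono[OF that] by simp
      have "{h a<..<h b} \<subseteq> g -` {a<..b}" using h_less[of _ b] le_h[of _ a] by (auto simp: not_le[symmetric])
      then have "emeasure lborel {h a<..<h b} \<le> emeasure lborel (g -` {a<..b})"
        using measurable_sets[OF gm, of "{a<..b}"] by (intro emeasure_mono) auto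
      then show "ennreal (h b - h a) \<le> emeasure lborel (g -` {a<..b})" using h_mono[OF that] by simp
    qed
    finally show ?thesis .
  qed
  have "absolutely_continuous lborel ?\<mu>" unfolding absolutely_continuous_def
  proof
    fix A :: "real set" assume A: "A \<in> null_sets lborel"
    then have Am: "A \<in> sets borel" by auto
    have "negligible (h ` A)"
    proof (rule negligible_locally_Lipschitz_image)
      show "negligible A" using A null_sets_completionI negligible_iff_null_sets by blast
      fix x assume "x \<in> A"
      have "norm (h y - h x) \<le> 1 * norm (y - x)" for y
        using h_lip[of x y] h_lip[of y x] h_mono[of x y] h_mono[of y x] by (cases "x \<le> y") auto
      then show "\<exists>T B. open T \<and> x \<in> T \<and> (\<forall>y\<in>A \<inter> T. norm (h y - h x) \<le> B * norm (y - x))"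
        by (intro exI[of _ UNIV] exI[of _ 1]) auto
    qed simp
    moreover have "g -` A \<subseteq> h ` A" using hg by (auto intro!: image_eqI[where x="g _"])
    ultimately have "g -` A \<in> null_sets lebesgue" using negligible_subset negligible_iff_null_sets by blast
    moreover have "g -` A \<in> sets lborel" using measurable_sets[OF gm Am] by simp
    ultimately have "emeasure lborel (g -` A) = 0" by (simp add: null_sets_def)
    then show "A \<in> null_sets ?\<mu>" using Am by (auto simp: null_sets_def emeasure_distr)
  qed
  then obtain k where k[measurable]: "k \<in> borel_measurable lborel" and dk: "density lborel k = ?\<mu>"
    using sigma_finite_measure.Radon_Nikodym[OF sigma_finite_lborel, of ?\<mu>] by auto
  have kI: "(\<integral>\<^sup>+y. k y * indicator {a<..b} y \<partial>lborel) = ennreal (h b - h a)" if "a \<le> b" for a b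
    using \<mu>[OF that] unfolding dk[symmetric] by (subst (asm) emeasure_density) auto
  \<comment> \<open>A density could be infinite; its integrals over bounded intervals are finite, so it is finite almost everywhere.\<close>
  have "AE y in lborel. \<forall>n::nat. k y * indicator {- real n<..real n} y \<noteq> \<infinity>"
    unfolding AE_all_countable by (intro allI nn_integral_PInf_AE) (auto simp: kI)
  then have kfin: "AE y in lborel. k y \<noteq> \<infinity>"
  proof eventually_elim
    case (elim y)
    obtain n :: nat where "\<bar>y\<bar> < real n" using reals_Archimedean2 by blast
    then have "y \<in> {- real n<..real n}" by auto
    then show ?case using elim[rule_format, of n] by simp
  qed
  define r where "r y = enn2real (k y)" for y
  have [measurable]: "r \<in> borel_measurable borel" unfolding r_def[abs_def] using k by simp
  have rk: "AE y in lborel. ennreal (r y) = k y" using kfin by eventually_elim (simp add: r_def less_top)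
  have rI: "(r has_integral (h b - h a)) {a..b}" if "a \<le> b" for a b
  proof -
    have "(\<integral>\<^sup>+y. ennreal (r y * indicator {a..b} y) \<partial>lborel) = (\<integral>\<^sup>+y. k y * indicator {a<..b} y \<partial>lborel)"
    proof (rule nn_integral_cong_AE)
      show "AE y in lborel. ennreal (r y * indicator {a..b} y) = k y * indicator {a<..b} y"
        using rk AE_lborel_singleton[of a] by eventually_elim (auto simp: indicator_def)
    qed
    then have "((\<lambda>y. r y * indicator {a..b} y) has_integral (h b - h a)) UNIV"
      using h_mono[OF that] kI[OF that] by (intro nn_integral_has_integral) (auto simp: r_def)
    moreover have "(\<lambda>y. r y * indicator {a..b} y) = (\<lambda>y. if y \<in> {a..b} then r y else 0)"
      by (auto simp: indicator_def)
    ultimately show ?thesis using has_integral_restrict_UNIV[of "{a..b}" r] by simp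
  qed
  have "AE y in lborel. (h has_real_derivative r y) (at y)"
    by (rule AE_has_real_derivative_indefinite_integral[OF rI])
  \<comment> \<open>The density vanishes only on a set of image measure zero, which the conditional form encodes.\<close>
  then have "AE y in lborel. 0 < k y \<longrightarrow> (h has_real_derivative r y) (at y) \<and> r y \<noteq> 0"
    using rk by eventually_elim (metis ennreal_0 less_irrefl)
  then have "AE y in ?\<mu>. (h has_real_derivative r y) (at y) \<and> r y \<noteq> 0"
    unfolding dk[symmetric] by (subst AE_density) auto
  then have d: "AE x in lborel. (h has_real_derivative r (g x)) (at (g x)) \<and> r (g x) \<noteq> 0"
    by (rule AE_distrD[rotated]) simp
  have c: "AE x in lborel. isCont g x"
    using AE_not_in[OF countable_imp_null_set_lborel[OF mono_ctble_discont[OF gmono]]] by eventually_elim simp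
  from d c show ?thesis
  proof eventually_elim
    case (elim x)
    have "(g has_real_derivative inverse (r (g x))) (at x)"
      by (rule DERIV_inverse_function[where f=h and a="x - 1" and b="x + 1"]) (use elim hg in auto)
    then have "((\<lambda>x. g x - x) has_real_derivative inverse (r (g x)) - 1) (at x)"
      by (intro DERIV_diff DERIV_ident)
    moreover have "(\<lambda>x. g x - x) = f" by (auto simp: g_def)
    ultimately show ?case unfolding real_differentiable_def by metis
  qed
qed

text \<open>A lower bound for the right lower derivative of a monotone function bounds its increments, even
without continuity. The supremum of the points up to which the estimate holds is again such a point, since
\<open>M\<close> can only jump upwards, and it is \<open>b\<close>, since the local bound would otherwise carry the estimate
further.\<close>

lemma increment_lower_bound:
  fixes M :: "real \<Rightarrow> real"
  assumes mono: "\<And>s t. a \<le> s \<Longrightarrow> s \<le> t \<Longrightarrow> t \<le> b \<Longrightarrow> M s \<le> M t"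
    and der: "\<And>t. a \<le> t \<Longrightarrow> t < b \<Longrightarrow> \<exists>\<eta>>0. \<forall>s. t < s \<and> s < t + \<eta> \<and> s \<le> b \<longrightarrow> \<kappa> * (s - t) \<le> M s - M t"
    and \<kappa>: "\<kappa> \<ge> 0" and ab: "a \<le> b"
  shows "\<kappa> * (b - a) \<le> M b - M a"
proof -
  define S where "S = {t \<in> {a..b}. \<kappa> * (t - a) \<le> M t - M a}"
  have aS: "a \<in> S" using ab by (simp add: S_def)
  have bdd: "bdd_above S" by (rule bdd_aboveI[of _ b]) (auto simp: S_def)
  define c where "c = Sup S"
  have ac: "a \<le> c" unfolding c_def by (rule cSup_upper[OF aS bdd])
  have cb: "c \<le> b" unfolding c_def by (rule cSup_least) (use aS in \<open>auto simp: S_def\<close>)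
  have cS: "\<kappa> * (c - a) \<le> M c - M a"
  proof (rule ccontr)
    assume n: "\<not> \<kappa> * (c - a) \<le> M c - M a"
    have "M a \<le> M c" using mono[of a c] ac cb by simp
    then have "\<kappa> \<noteq> 0" using n by auto
    then have \<kappa>0: "\<kappa> > 0" using \<kappa> by simp
    then have "a + (M c - M a) / \<kappa> < c" using n by (simp add: field_simps)
    then obtain s where s: "s \<in> S" "a + (M c - M a) / \<kappa> < s" using less_cSupD[of S] aS unfolding c_def by blast
    then have "M c - M a < \<kappa> * (s - a)" using \<kappa>0 by (simp add: field_simps)
    also have "\<dots> \<le> M s - M a" using s by (simp add: S_def)
    also have "M s \<le> M c" using s cSup_upper[OF s(1) bdd] cb by (intro mono) (auto simp: S_def c_def)
    finally show False by simp
  qed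
  have "c = b"
  proof (rule ccontr)
    assume "c \<noteq> b"
    then have "c < b" using cb by simp
    then obtain \<eta> where \<eta>: "\<eta> > 0" "\<And>s. c < s \<Longrightarrow> s < c + \<eta> \<Longrightarrow> s \<le> b \<Longrightarrow> \<kappa> * (s - c) \<le> M s - M c"
      using der[OF ac] by blast
    let ?s = "min (c + \<eta> / 2) b"
    have s: "c < ?s" "?s < c + \<eta>" "?s \<le> b" using \<eta>(1) \<open>c < b\<close> by auto
    have "\<kappa> * (?s - c) \<le> M ?s - M c" by (rule \<eta>(2)[OF s])
    then have "\<kappa> * (?s - a) \<le> M ?s - M a" using cS by (simp add: right_diff_distrib)
    then have "?s \<in> S" using s ac by (simp add: S_def)
    then have "?s \<le> c" unfolding c_def using bdd by (rule cSup_upper)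
    then show False using s(1) by simp
  qed
  then show ?thesis using cS by simp
qed

text \<open>Since \<open>x\<close> lies between the endpoints, their errors of first order, each at most a small multiple of the
distance to \<open>x\<close>, add up to the same small multiple of the length of the interval.\<close>

lemma straddle_difference_quotient:
  fixes f :: "real \<Rightarrow> real"
  assumes f: "(f has_real_derivative D) (at x)" and a: "a \<longlonglongrightarrow> x" and b: "b \<longlonglongrightarrow> x"
    and ab: "\<And>n. a n \<le> x" "\<And>n. x \<le> b n" "\<And>n. a n < b n"
  shows "(\<lambda>n. (f (b n) - f (a n)) / (b n - a n)) \<longlonglongrightarrow> D"
proof (rule LIMSEQ_I)
  fix r :: real assume r: "r > 0"
  have "(f has_derivative (\<lambda>h. D * h)) (at x)" using f by (simp add: has_field_derivative_def)
  then obtain d where d: "d > 0" "\<And>y. norm (y - x) < d \<Longrightarrow> norm (f y - f x - D * (y - x)) \<le> r / 2 * norm (y - x)"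
    unfolding has_derivative_at_alt using r by (meson half_gt_zero)
  obtain n1 where n1: "\<And>n. n \<ge> n1 \<Longrightarrow> norm (a n - x) < d" using LIMSEQ_D[OF a d(1)] by blast
  obtain n2 where n2: "\<And>n. n \<ge> n2 \<Longrightarrow> norm (b n - x) < d" using LIMSEQ_D[OF b d(1)] by blast
  have "norm ((f (b n) - f (a n)) / (b n - a n) - D) < r" if n: "n \<ge> max n1 n2" for n
  proof -
    have 1: "\<bar>f (a n) - f x - D * (a n - x)\<bar> \<le> r / 2 * (x - a n)" using d(2)[OF n1[of n]] n ab(1)[of n] by simp
    have 2: "\<bar>f (b n) - f x - D * (b n - x)\<bar> \<le> r / 2 * (b n - x)" using d(2)[OF n2[of n]] n ab(2)[of n] by simp
    have "f (b n) - f (a n) - D * (b n - a n) = (f (b n) - f x - D * (b n - x)) - (f (a n) - f x - D * (a n - x))"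
      by (simp add: algebra_simps)
    then have "\<bar>f (b n) - f (a n) - D * (b n - a n)\<bar> \<le> r / 2 * (b n - x) + r / 2 * (x - a n)"
      using 1 2 by (simp only: abs_triangle_ineq4[THEN order_trans] add_mono)
    also have "r / 2 * (b n - x) + r / 2 * (x - a n) = r / 2 * (b n - a n)"
      by (simp only: distrib_left[symmetric]) simp
    finally have "\<bar>f (b n) - f (a n) - D * (b n - a n)\<bar> \<le> r / 2 * (b n - a n)" .
    then have "\<bar>f (b n) - f (a n) - D * (b n - a n)\<bar> / (b n - a n) \<le> r / 2"
      using ab(3)[of n] by (simp add: divide_le_eq)
    moreover have "(f (b n) - f (a n)) / (b n - a n) - D = (f (b n) - f (a n) - D * (b n - a n)) / (b n - a n)"
      using ab(3)[of n] by (simp add: field_simps)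
    ultimately have "norm ((f (b n) - f (a n)) / (b n - a n) - D) \<le> r / 2"
      using ab(3)[of n] by (simp add: abs_divide)
    then show ?thesis using r by linarith
  qed
  then show "\<exists>n0. \<forall>n\<ge>n0. norm ((f (b n) - f (a n)) / (b n - a n) - D) < r" by blast
qed

text \<open>A profile may be unbounded near \<open>0\<close>. Truncating the argument at \<open>1 / (n + 1)\<close> gives functions
monotone on the whole line that agree with \<open>- f\<close> beyond that point.\<close>

lemma antimono_AE_differentiable:
  fixes f :: "real \<Rightarrow> real"
  assumes f: "\<And>r s. 0 < r \<Longrightarrow> r \<le> s \<Longrightarrow> f s \<le> f r"
  shows "AE r in lborel. 0 < r \<longrightarrow> f differentiable (at r)"
proof -
  let ?e = "\<lambda>n::nat. 1 / real (Suc n)"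
  define g where "g n r = - f (max (?e n) r)" for n r
  have "mono (g n)" for n
  proof (rule monoI)
    fix r s :: real assume "r \<le> s"
    then have "max (?e n) r \<le> max (?e n) s" by (intro max.mono) auto
    moreover have "0 < max (?e n) r" by (simp add: less_max_iff_disj)
    ultimately show "g n r \<le> g n s" using f[of "max (?e n) r" "max (?e n) s"] by (simp add: g_def)
  qed
  then have "AE r in lborel. \<forall>n. g n differentiable (at r)"
    unfolding AE_all_countable using mono_AE_differentiable by blast
  then show ?thesis
  proof eventually_elim
    case (elim r)
    show ?case
    proof
      assume r: "0 < r"
      obtain n where n: "?e n < r" using nat_approx_posE[OF r] by blast
      obtain D where "(g n has_real_derivative D) (at r)"
        using elim unfolding real_differentiable_def by blast
      from DERIV_minus[OF this] have "((\<lambda>s. - g n s) has_real_derivative - D) (at r)" .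
      then have "(f has_real_derivative - D) (at r)"
        by (rule has_field_derivative_transform_within_open[where S="{?e n<..}"]) (use n in \<open>auto simp: g_def\<close>)
      then show "f differentiable (at r)" unfolding real_differentiable_def by blast
    qed
  qed
qed

section \<open>Jensen's inequality for powers\<close>

text \<open>Convexity, from the mean value theorem and the monotonicity of the derivative on positive arguments. The
endpoint \<open>y = 0\<close> is checked directly.\<close>

lemma powr_above_tangent:
  fixes p :: real
  assumes p: "p \<ge> 1" and c: "c > 0" and y: "y \<ge> 0"
  shows "c powr p + p * c powr (p - 1) * (y - c) \<le> y powr p"
proof -
  have cp: "c powr (p - 1) * c = c powr p" using powr_add[of c "p - 1" 1] c by simp
  have der: "((\<lambda>y. y powr p) has_real_derivative p * z powr (p - 1)) (at z)" if "z > 0" for z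
    using has_real_derivative_powr[OF that] by simp
  consider "y = 0" | "0 < y" "y < c" | "y = c" | "c < y" using y by linarith
  then show ?thesis
  proof cases
    case 1
    have "c powr p \<le> p * c powr p" using mult_right_mono[OF p, of "c powr p"] by simp
    then show ?thesis using 1 cp by (simp add: mult.assoc)
  next
    case 2
    have "\<exists>z>y. z < c \<and> c powr p - y powr p = (c - y) * (p * z powr (p - 1))"
      by (rule MVT2[OF 2(2)]) (use der 2 in simp)
    then obtain z where z: "y < z" "z < c" "c powr p - y powr p = (c - y) * (p * z powr (p - 1))" by blast
    have "p * z powr (p - 1) \<le> p * c powr (p - 1)" using z 2 p by (intro mult_left_mono powr_mono2) auto
    then have "(c - y) * (p * z powr (p - 1)) \<le> (c - y) * (p * c powr (p - 1))" by (rule mult_left_mono) (use 2 in simp)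
    then show ?thesis using z(3) by (simp add: algebra_simps)
  next
    case 4
    have "\<exists>z>c. z < y \<and> y powr p - c powr p = (y - c) * (p * z powr (p - 1))"
      by (rule MVT2[OF 4]) (use der c in simp)
    then obtain z where z: "c < z" "z < y" "y powr p - c powr p = (y - c) * (p * z powr (p - 1))" by blast
    have "p * c powr (p - 1) \<le> p * z powr (p - 1)" using z c p by (intro mult_left_mono powr_mono2) auto
    then have "(y - c) * (p * c powr (p - 1)) \<le> (y - c) * (p * z powr (p - 1))" by (rule mult_left_mono) (use 4 in simp)
    then show ?thesis using z(3) by (simp add: algebra_simps)
  qed simp
qed

lemma measure_0_imp_null_set:
  "A \<in> sets M \<Longrightarrow> emeasure M A < \<infinity> \<Longrightarrow> measure M A = 0 \<Longrightarrow> A \<in> null_sets M"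
  using emeasure_eq_ennreal_measure[of M A] by (simp add: null_sets_def less_top)

text \<open>Jensen's inequality on \<open>A\<close>: integrate the tangent line inequality at the mean value of \<open>v\<close>, at which
the linear term integrates to zero. The integral of the \<open>p\<close>-th power is allowed to be infinite.\<close>

lemma power_mean_inequality:
  fixes v :: "'b \<Rightarrow> real"
  assumes p: "p \<ge> 1" and A[measurable]: "A \<in> sets M" and fin: "emeasure M A < \<infinity>"
    and v0: "\<And>x. 0 \<le> v x" and [measurable]: "v \<in> borel_measurable M"
    and int: "integrable M (\<lambda>x. indicator A x * v x)"
  shows "ennreal ((LINT x|M. indicator A x * v x) powr p)
     \<le> ennreal (measure M A powr (p - 1)) * (\<integral>\<^sup>+x. indicator A x * ennreal (v x powr p) \<partial>M)"
proof -
  let ?I = "LINT x|M. indicator A x * v x" and ?m = "measure M A"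
  let ?J = "\<integral>\<^sup>+x. indicator A x * ennreal (v x powr p) \<partial>M"
  have I0: "?I \<ge> 0" using v0 by (intro integral_nonneg_AE) auto
  have iA: "integrable M (indicat_real A)" using fin by (intro integrable_real_indicator) auto
  have m0: "?m > 0" if "?I > 0"
  proof (rule ccontr)
    assume "\<not> ?m > 0"
    then have "?m = 0" using measure_nonneg[of M A] by linarith
    then have "A \<in> null_sets M" using measure_0_imp_null_set[OF A fin] by simp
    then have "AE x in M. indicator A x * v x = 0" by (rule AE_not_in[THEN eventually_mono]) simp
    then have "?I = (LINT x|M. 0)" by (intro integral_cong_AE) auto
    then show False using that by simp
  qed
  consider "?I = 0" | "?I > 0" "?J = \<infinity>" | "?I > 0" "?J < \<infinity>" using I0 by (fastforce simp: less_top)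
  then show ?thesis
  proof cases
    case 1 then show ?thesis by simp
  next
    case 2
    then have "ennreal (?m powr (p - 1)) \<noteq> 0" using m0 by simp
    then show ?thesis using 2(2) by (simp add: ennreal_mult_eq_top_iff)
  next
    case 3
    note m0 = m0[OF 3(1)]
    define c where "c = ?I / ?m"
    have c0: "c > 0" using 3 m0 by (simp add: c_def)
    have Ic: "?I = c * ?m" using m0 by (simp add: c_def)
    have Jeq: "?J = (\<integral>\<^sup>+x. ennreal (indicator A x * v x powr p) \<partial>M)"
      by (rule nn_integral_cong) (auto simp: indicator_def)
    have iJ: "integrable M (\<lambda>x. indicator A x * v x powr p)"
      using 3(2) unfolding Jeq by (intro integrableI_nonneg) auto
    have "c powr p * ?m = (LINT x|M. c powr p * indicator A x + p * c powr (p - 1) * (indicator A x * v x - c * indicator A x))"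
      using iA int by (simp add: Ic)
    also have "\<dots> \<le> (LINT x|M. indicator A x * v x powr p)"
    proof (rule integral_mono)
      show "integrable M (\<lambda>x. c powr p * indicator A x + p * c powr (p - 1) * (indicator A x * v x - c * indicator A x))"
        using iA int by (intro Bochner_Integration.integrable_add integrable_mult_right Bochner_Integration.integrable_diff) auto
      show "c powr p * indicator A x + p * c powr (p - 1) * (indicator A x * v x - c * indicator A x)
         \<le> indicator A x * v x powr p" for x
        using powr_above_tangent[OF p c0 v0[of x]] by (auto simp: indicator_def)
    qed (rule iJ)
    finally have le: "c powr p * ?m \<le> (LINT x|M. indicator A x * v x powr p)" .
    have "?I powr p = ?m powr (p - 1) * (c powr p * ?m)"
    proof -
      have "?m powr (p - 1) * ?m = ?m powr p" using powr_add[of ?m "p - 1" 1] m0 by simp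
      then show ?thesis unfolding Ic using c0 m0 by (simp add: powr_mult)
    qed
    also have "\<dots> \<le> ?m powr (p - 1) * (LINT x|M. indicator A x * v x powr p)"
      using le by (intro mult_left_mono) auto
    finally have "ennreal (?I powr p) \<le> ennreal (?m powr (p - 1) * (LINT x|M. indicator A x * v x powr p))"
      by (rule ennreal_leI)
    also have "\<dots> = ennreal (?m powr (p - 1)) * ?J"
      unfolding Jeq using nn_integral_eq_integral[OF iJ] by (simp add: ennreal_mult' )
    finally show ?thesis .
  qed
qed

section \<open>Ramps and smooth approximations of the absolute value\<close>

text \<open>The function is \<open>0\<close> up to \<open>t\<close>, linear between \<open>t\<close> and \<open>s\<close>, and \<open>1\<close> from \<open>s\<close> on. It is written with absolute
values so that a smooth approximation of \<open>\<bar>\<cdot>\<bar>\<close> approximates it by functions to which the chain rule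
applies.\<close>

definition ramp :: "real \<Rightarrow> real \<Rightarrow> real \<Rightarrow> real" where
  "ramp t s y = (\<bar>y - t\<bar> - \<bar>y - s\<bar>) / (2 * (s - t)) + 1 / 2"

definition soft_abs :: "nat \<Rightarrow> real \<Rightarrow> real" where "soft_abs n a = sqrt (a\<^sup>2 + (1 / real (Suc n))\<^sup>2)"

lemma soft_abs_pos: "soft_abs n a > 0"
  unfolding soft_abs_def by (intro real_sqrt_gt_zero add_nonneg_pos) auto

lemma soft_abs_deriv: "(soft_abs n has_real_derivative a / soft_abs n a) (at a)"
proof -
  have "a\<^sup>2 + (1 / real (Suc n))\<^sup>2 > 0" by (intro add_nonneg_pos) auto
  then show ?thesis unfolding soft_abs_def[abs_def]
    by (auto intro!: derivative_eq_intros simp: divide_simps)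
qed

lemma soft_abs_ratio_le: "\<bar>a / soft_abs n a\<bar> \<le> 1"
proof -
  have "\<bar>a\<bar> \<le> soft_abs n a" unfolding soft_abs_def by (rule real_sqrt_ge_abs1)
  then show ?thesis using soft_abs_pos[of n a] by (simp add: abs_div_pos[symmetric])
qed

text \<open>\<open>soft_abs n a\<close> is the Euclidean norm of the pair of \<open>a\<close> and \<open>1 / (n + 1)\<close>, and norms are Lipschitz.\<close>

lemma soft_abs_lipschitz: "\<bar>soft_abs n a - soft_abs n b\<bar> \<le> \<bar>a - b\<bar>"
proof -
  have "norm (a, 1 / real (Suc n)) = soft_abs n a" for a by (simp add: norm_Pair soft_abs_def)
  then show ?thesis using norm_triangle_ineq3[of "(a, 1 / real (Suc n))" "(b, 1 / real (Suc n))"]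
    by (simp add: norm_Pair)
qed

lemma soft_abs_lim: "(\<lambda>n. soft_abs n a) \<longlonglongrightarrow> \<bar>a\<bar>"
proof -
  have "(\<lambda>n. 1 / real (Suc n)) \<longlonglongrightarrow> 0" using LIMSEQ_inverse_real_of_nat by (simp add: inverse_eq_divide)
  then have "(\<lambda>n. soft_abs n a) \<longlonglongrightarrow> sqrt (a\<^sup>2 + 0\<^sup>2)" unfolding soft_abs_def by (intro tendsto_intros)
  then show ?thesis by simp
qed

lemma soft_abs_ratio_lim: "(\<lambda>n. a / soft_abs n a) \<longlonglongrightarrow> sgn a"
proof (cases "a = 0")
  case False
  have "(\<lambda>n. a / soft_abs n a) \<longlonglongrightarrow> a / \<bar>a\<bar>" using False by (intro tendsto_divide soft_abs_lim tendsto_const) auto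
  moreover have "a / \<bar>a\<bar> = sgn a" using False by (simp add: sgn_real_def)
  ultimately show ?thesis by simp
qed simp

section \<open>Left-invariant vector fields\<close>

locale carnot_polar =
  fixes G :: "('a::euclidean_space) carnot" and N :: "'a \<Rightarrow> real" and \<sigma> :: "'a measure"
  assumes carnot: "carnot_group G" and gauge: "carnot_gauge G N" and polar: "polar_measure G N \<sigma>"
begin

abbreviation gmult (infixl "\<odot>" 70) where "x \<odot> y \<equiv> mult G x y"
abbreviation ginverse ("\<iota>") where "\<iota> x \<equiv> ginv G x"
abbreviation LF where "LF \<equiv> left_field G"

lemma lie: "lie_group G" and strat: "stratification G" and dils: "dilations G"
  using carnot by (auto simp: carnot_group_def)

lemma g_assoc: "(x \<odot> y) \<odot> z = x \<odot> (y \<odot> z)"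
  and g_0 [simp]: "0 \<odot> x = x" "x \<odot> 0 = x"
  and g_inv [simp]: "\<iota> x \<odot> x = 0" "x \<odot> \<iota> x = 0"
  and smooth_mult: "smooth (\<lambda>(x, y). x \<odot> y)" and smooth_inv: "smooth \<iota>"
  using lie by (auto simp: lie_group_def)

lemma g_cancel [simp]: "\<iota> x \<odot> (x \<odot> y) = y" "x \<odot> (\<iota> x \<odot> y) = y"
  "(y \<odot> x) \<odot> \<iota> x = y" "(y \<odot> \<iota> x) \<odot> x = y"
  by (simp_all add: g_assoc[symmetric]) (simp_all add: g_assoc)

lemma g_left_cancel: "x \<odot> y = x \<odot> z \<longleftrightarrow> y = z" by (metis g_cancel(1))
lemma g_inv_inv [simp]: "\<iota> (\<iota> x) = x" by (metis g_0(1) g_cancel(4) g_inv(1))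
lemma g_inv_0 [simp]: "\<iota> 0 = 0" by (metis g_0(1) g_inv(2))
lemma g_inv_mult: "\<iota> (x \<odot> y) = \<iota> y \<odot> \<iota> x"
  by (metis g_assoc g_cancel(1) g_inv(2) g_0(2))

lemma Ck_op: "Ck k f \<Longrightarrow> Ck k g \<Longrightarrow> Ck k (\<lambda>x. f x \<odot> g x)"
  using Ck_compose[OF smooth_Ck[OF smooth_mult] Ck_Pair] by fastforce

lemma Ck_inv: "Ck k f \<Longrightarrow> Ck k (\<lambda>x. \<iota> (f x))"
  by (rule Ck_compose[OF smooth_Ck[OF smooth_inv]])

lemma Ck_id: "Ck k (\<lambda>x::'b::euclidean_space. x)"
  by (rule Ck_bounded_linear[OF bounded_linear_ident])

lemma continuous_op [continuous_intros]:
  "continuous_on S f \<Longrightarrow> continuous_on S g \<Longrightarrow> continuous_on S (\<lambda>x. f x \<odot> g x)"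
  using continuous_on_compose2[OF Ck_continuous[OF smooth_Ck[OF smooth_mult]] continuous_on_Pair, of S f g]
  by simp

lemma continuous_inv [continuous_intros]:
  "continuous_on S f \<Longrightarrow> continuous_on S (\<lambda>x. \<iota> (f x))"
  using continuous_on_compose2[OF Ck_continuous[OF smooth_Ck[OF smooth_inv]]] by blast

lemma Ck_left: "Ck k ((\<odot>) g)" using Ck_op[OF Ck_const Ck_id] by fastforce
lemma Ck_right: "Ck k (\<lambda>x. x \<odot> g)" by (rule Ck_op[OF Ck_id Ck_const])

lemma left_has_derivative:
  "(((\<odot>) g) has_derivative frechet_derivative ((\<odot>) g) (at x)) (at x)"
  by (rule Ck_1_has_derivative[OF Ck_left])

lemma right_has_derivative:
  "((\<lambda>x. x \<odot> g) has_derivative frechet_derivative (\<lambda>x. x \<odot> g) (at x)) (at x)"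
  by (rule Ck_1_has_derivative[OF Ck_right])

lemma LF_eq: "LF v x = frechet_derivative (\<lambda>(x, y). x \<odot> y) (at (x, 0)) (0, v)"
proof -
  have "((\<lambda>y. (x, y)) has_derivative (\<lambda>h. (0, h))) (at 0)" by (auto intro!: derivative_eq_intros)
  from has_derivative_compose[OF this smooth_has_derivative[OF smooth_mult]]
  have "((\<odot>) x has_derivative (\<lambda>h. frechet_derivative (\<lambda>(x, y). x \<odot> y) (at (x, 0)) (0, h))) (at 0)"
    by simp
  from frechet_derivative_at[OF this] show ?thesis
    unfolding left_field_def by metis
qed

lemma Ck_LF: "Ck k (LF v)"
proof -
  have "Ck k (\<lambda>x. frechet_derivative (\<lambda>(x, y). x \<odot> y) (at x) (0, v))"
    by (rule Ck_directional[OF smooth_Ck[OF smooth_mult] Ck_const])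
  from Ck_compose[OF this Ck_Pair[OF Ck_id Ck_const[of _ 0]]]
  show ?thesis by (simp add: LF_eq[symmetric])
qed

lemma linear_LF: "linear (\<lambda>v. LF v x)"
  unfolding left_field_def by (rule has_derivative_linear[OF left_has_derivative])

text \<open>Left invariance: differentiate \<open>g \<odot> (x \<odot> y) = (g \<odot> x) \<odot> y\<close> in \<open>y\<close> at the identity.\<close>

lemma LF_push: "frechet_derivative ((\<odot>) g) (at x) (LF v x) = LF v (g \<odot> x)"
proof -
  have "((\<odot>) g has_derivative frechet_derivative ((\<odot>) g) (at x)) (at (x \<odot> 0))"
    using left_has_derivative by simp
  from has_derivative_compose[OF left_has_derivative[of x 0] this]
  have "((\<lambda>y. g \<odot> (x \<odot> y)) has_derivative (\<lambda>v. frechet_derivative ((\<odot>) g) (at x) (LF v x))) (at 0)"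
    unfolding left_field_def .
  moreover have "(\<lambda>y. g \<odot> (x \<odot> y)) = (\<odot>) (g \<odot> x)" by (auto simp: g_assoc)
  ultimately have "(\<lambda>v. frechet_derivative ((\<odot>) g) (at x) (LF v x)) = frechet_derivative ((\<odot>) (g \<odot> x)) (at 0)"
    using frechet_derivative_at by simp
  then show ?thesis unfolding left_field_def[of G v "g \<odot> x"] by metis
qed

lemma LF_0 [simp]: "LF v 0 = v"
proof -
  have "(\<odot>) 0 = (\<lambda>x. x)" by auto
  then show ?thesis unfolding left_field_def by (metis frechet_derivative_ident)
qed

text \<open>The differential of the translation by \<open>\<iota> x\<close> inverts the one that defines the fields at \<open>x\<close>.\<close>

lemma LF_surj: obtains v where "LF v x = w"
proof
  let ?v = "frechet_derivative ((\<odot>) (\<iota> x)) (at x) w"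
  have "((\<odot>) x has_derivative frechet_derivative ((\<odot>) x) (at 0)) (at (\<iota> x \<odot> x))"
    using left_has_derivative by simp
  from has_derivative_compose[OF left_has_derivative[of "\<iota> x" x] this]
  have "((\<lambda>y. y) has_derivative (\<lambda>w. frechet_derivative ((\<odot>) x) (at 0)
     (frechet_derivative ((\<odot>) (\<iota> x)) (at x) w))) (at x)" by simp
  from has_derivative_unique[OF this has_derivative_ident]
  show "LF ?v x = w" unfolding left_field_def by metis
qed

definition Xd :: "'a \<Rightarrow> ('a \<Rightarrow> real) \<Rightarrow> 'a \<Rightarrow> real" where
  "Xd v f x = frechet_derivative f (at x) (LF v x)"

lemma hgrad_Xd: "hgrad G f x i = Xd (frame G i) f x" by (simp add: hgrad_def Xd_def)

lemma Xd_unique: "(f has_derivative f') (at x) \<Longrightarrow> Xd v f x = f' (LF v x)"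
  unfolding Xd_def using frechet_derivative_at by metis

text \<open>The common form of the behaviour of left-invariant fields under left translations and under dilations.\<close>

lemma Xd_compose:
  assumes \<Psi>: "(\<Psi> has_derivative D) (at x)" and D: "D (LF v x) = LF v' (\<Psi> x)"
    and f: "f differentiable (at (\<Psi> x))"
  shows "Xd v (\<lambda>x. f (\<Psi> x)) x = Xd v' f (\<Psi> x)"
  using Xd_unique[OF has_derivative_compose[OF \<Psi> f[unfolded frechet_derivative_works]]] D
  by (simp add: Xd_def)

lemma Ck_Xd: "Ck (Suc k) f \<Longrightarrow> Ck k (Xd v f)"
  unfolding Xd_def[abs_def] by (rule Ck_directional[OF _ Ck_LF])

lemma C1_Xd: "Ck 1 f \<Longrightarrow> continuous_on UNIV (Xd v f)"
  using Ck_Xd[of 0 f] by simp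

lemma Xd_outside: "closed K \<Longrightarrow> (\<And>x. x \<notin> K \<Longrightarrow> f x = 0) \<Longrightarrow> x \<notin> K \<Longrightarrow> Xd v f x = 0"
  unfolding Xd_def using frechet_derivative_eq_0_outside[of K f x] by metis

lemma Xd_linear: 
  assumes "f differentiable (at x)"
  shows "Xd (v + w) f x = Xd v f x + Xd w f x" "Xd (c *\<^sub>R v) f x = c * Xd v f x" "Xd 0 f x = 0"
  using assms linear_frechet_derivative[OF assms]
  by (simp_all add: Xd_def linear_add[OF linear_LF] linear_scale[OF linear_LF] linear_0[OF linear_LF]
      linear_add linear_scale linear_0)

lemma Xd_mult:
  assumes "f differentiable (at x)" "g differentiable (at x)"
  shows "Xd v (\<lambda>x. f x * g x) x = f x * Xd v g x + Xd v f x * g x"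
  using Xd_unique[OF has_derivative_mult[OF assms[unfolded frechet_derivative_works]]]
  by (simp add: Xd_def)

lemma Xd_left: "f differentiable (at (g \<odot> x)) \<Longrightarrow> Xd v (\<lambda>x. f (g \<odot> x)) x = Xd v f (g \<odot> x)"
  by (rule Xd_compose[OF left_has_derivative LF_push])

lemma integral_left:
  assumes [measurable]: "f \<in> borel_measurable borel"
  shows "(LINT x|lborel. f (g \<odot> x)) = (LINT x|lborel. (f x :: real))"
proof -
  have [measurable]: "(\<odot>) g \<in> borel_measurable borel"
    using Ck_continuous[OF Ck_left] by (rule borel_measurable_continuous_onI)
  have "distr lborel borel ((\<odot>) g) = lborel" using carnot by (simp add: carnot_group_def)
  then have "(LINT x|lborel. f x) = (LINT x|distr lborel borel ((\<odot>) g). f x)" by simp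
  also have "\<dots> = (LINT x|lborel. f (g \<odot> x))" by (rule integral_distr) auto
  finally show ?thesis by simp
qed

lemma C1_compact_left: "C1_compact f \<Longrightarrow> C1_compact (\<lambda>x. f (g \<odot> x))"
proof -
  assume "C1_compact f"
  then obtain K where K: "compact K" "\<And>x. x \<notin> K \<Longrightarrow> f x = 0" "Ck 1 f" by (auto simp: C1_compact_def)
  have "compact ((\<odot>) (\<iota> g) ` K)"
    using K by (intro compact_continuous_image continuous_on_subset[OF Ck_continuous[OF Ck_left]]) auto
  moreover have "f (g \<odot> x) = 0" if "x \<notin> (\<odot>) (\<iota> g) ` K" for x
    using that K(2)[of "g \<odot> x"] by (metis g_cancel(1) imageI)
  ultimately show ?thesis unfolding C1_compact_def using Ck_compose[OF K(3) Ck_left] by blast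
qed

lemma test_function_compose:
  assumes \<phi>: "test_function \<phi>" and \<Psi>: "smooth \<Psi>" and \<Phi>: "continuous_on UNIV \<Phi>" "\<And>x. \<Phi> (\<Psi> x) = x"
  shows "test_function (\<lambda>x. \<phi> (\<Psi> x))"
proof -
  obtain K where K: "compact K" "\<And>x. x \<notin> K \<Longrightarrow> \<phi> x = 0" "smooth \<phi>"
    using test_functionE[OF \<phi>] by blast
  show ?thesis
  proof (rule test_functionI)
    show "smooth (\<lambda>x. \<phi> (\<Psi> x))" unfolding smooth_def
      by (intro allI Ck_compose[OF smooth_Ck[OF K(3)] smooth_Ck[OF \<Psi>]])
    show "compact (\<Phi> ` K)"
      using K by (intro compact_continuous_image continuous_on_subset[OF \<Phi>(1)]) auto
    show "\<phi> (\<Psi> x) = 0" if "x \<notin> \<Phi> ` K" for x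
      using that K(2)[of "\<Psi> x"] \<Phi>(2)[of x] by (metis imageI)
  qed
qed

lemma test_function_right: "test_function \<phi> \<Longrightarrow> test_function (\<lambda>x. \<phi> (x \<odot> g))"
  by (rule test_function_compose[where \<Phi>="\<lambda>x. x \<odot> \<iota> g"])
    (auto simp: smooth_def Ck_right intro!: continuous_intros)

section \<open>The divergence of left-invariant fields\<close>

text \<open>The Euclidean divergence of the left-invariant field of \<open>v\<close>. That it vanishes, so that left-invariant
fields are skew-adjoint, is shown in \<open>gdiv_layer\<close>.\<close>

definition gdiv :: "'a \<Rightarrow> 'a \<Rightarrow> real" where
  "gdiv v x = (\<Sum>b\<in>Basis. frechet_derivative (LF v) (at x) b \<bullet> b)"

lemma continuous_gdiv: "continuous_on UNIV (gdiv v)"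
proof -
  have "Ck 0 (gdiv v)" unfolding gdiv_def[abs_def]
    by (intro Ck_sum Ck_inner Ck_const Ck_directional[OF Ck_LF] finite_Basis)
  then show ?thesis by simp
qed

text \<open>The divergence theorem for the product of \<open>f\<close> and the field.\<close>

lemma integral_Xd_gdiv:
  assumes f: "C1_compact f"
  shows "(LINT x|lborel. Xd v f x) = - (LINT x|lborel. gdiv v x * f x)"
proof -
  obtain K where K: "compact K" "\<And>x. x \<notin> K \<Longrightarrow> f x = 0" and f1: "Ck 1 f"
    using f by (auto simp: C1_compact_def)
  have c: "Ck 1 (\<lambda>x. f x * (LF v x \<bullet> b))" for b
    by (intro Ck_mult Ck_inner Ck_LF Ck_const f1)
  have cc: "C1_compact (\<lambda>x. f x * (LF v x \<bullet> b))" for b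
    using c K unfolding C1_compact_def by (metis mult_zero_left)
  have der: "frechet_derivative (\<lambda>x. f x * (LF v x \<bullet> b)) (at x) =
     (\<lambda>h. f x * (frechet_derivative (LF v) (at x) h \<bullet> b) + frechet_derivative f (at x) h * (LF v x \<bullet> b))" for b x
    by (rule frechet_derivative_at[symmetric])
      (auto intro!: derivative_eq_intros Ck_1_has_derivative[OF f1] Ck_1_has_derivative[OF Ck_LF])
  have eq: "(\<Sum>b\<in>Basis. frechet_derivative (\<lambda>x. f x * (LF v x \<bullet> b)) (at x) b) = gdiv v x * f x + Xd v f x" for x
  proof -
    have "linear (frechet_derivative f (at x))"
      using Ck_1_has_derivative[OF f1] has_derivative_linear by blast
    then have "Xd v f x = (\<Sum>b\<in>Basis. frechet_derivative f (at x) b * (LF v x \<bullet> b))"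
      unfolding Xd_def using linear_Basis_sum[of "frechet_derivative f (at x)" "LF v x"] by (simp add: mult.commute)
    then show ?thesis by (simp add: der gdiv_def sum.distrib sum_distrib_left sum_distrib_right mult.commute)
  qed
  have int: "integrable lborel (\<lambda>x. frechet_derivative (\<lambda>x. f x * (LF v x \<bullet> b)) (at x) b)" for b
  proof (rule integrable_cont_compact[OF _ K(1)])
    show "continuous_on UNIV (\<lambda>x. frechet_derivative (\<lambda>x. f x * (LF v x \<bullet> b)) (at x) b)"
      using Ck_directional[of 0 "\<lambda>x. f x * (LF v x \<bullet> b)" "\<lambda>_. b"] c by (auto simp: Ck_const)
    show "frechet_derivative (\<lambda>x. f x * (LF v x \<bullet> b)) (at x) b = 0" if "x \<notin> K" for x
      using frechet_derivative_eq_0_outside[OF compact_imp_closed[OF K(1)], of "\<lambda>x. f x * (LF v x \<bullet> b)" x] K that by simp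
  qed
  have i1: "integrable lborel (\<lambda>x. gdiv v x * f x)"
    by (rule loc_int_mult_cont[OF loc_int_continuous[OF continuous_gdiv] Ck_continuous[OF f1] K])
  have i2: "integrable lborel (Xd v f)"
    using K compact_imp_closed by (intro integrable_cont_compact[OF C1_Xd[OF f1] K(1)] Xd_outside[of K]) auto
  have "(LINT x|lborel. gdiv v x * f x) + (LINT x|lborel. Xd v f x)
      = (LINT x|lborel. (\<Sum>b\<in>Basis. frechet_derivative (\<lambda>x. f x * (LF v x \<bullet> b)) (at x) b))"
    using i1 i2 by (simp add: eq)
  also have "\<dots> = 0" using int by (simp add: integral_directional_derivative_0[OF cc])
  finally show ?thesis by linarith
qed

text \<open>Lebesgue measure and the field are both invariant under left translations, hence so is the function that
represents the defect of skew-adjointness in \<open>integral_Xd_gdiv\<close>.\<close>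

lemma gdiv_const: "gdiv v x = gdiv v 0"
proof -
  have "gdiv v (\<iota> g \<odot> x) - gdiv v x = 0" for g x
  proof (rule test_function_fundamental_cont[where w="\<lambda>x. gdiv v (\<iota> g \<odot> x) - gdiv v x"])
    have c: "continuous_on UNIV (\<lambda>x. gdiv v (\<iota> g \<odot> x))"
      by (rule continuous_on_compose2[OF continuous_gdiv]) (auto intro!: continuous_intros)
    then show "continuous_on UNIV (\<lambda>x. gdiv v (\<iota> g \<odot> x) - gdiv v x)"
      by (intro continuous_intros continuous_gdiv)
    fix \<phi> :: "'a \<Rightarrow> real" assume \<phi>: "test_function \<phi>"
    obtain K where K: "compact K" "\<And>x. x \<notin> K \<Longrightarrow> \<phi> x = 0" "smooth \<phi>"
      using test_functionE[OF \<phi>] by blast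
    have [measurable]: "\<phi> \<in> borel_measurable borel" "gdiv v \<in> borel_measurable borel" "Xd v \<phi> \<in> borel_measurable borel"
      "(\<odot>) g \<in> borel_measurable borel" "(\<odot>) (\<iota> g) \<in> borel_measurable borel"
      using Ck_continuous[OF test_function_Ck[OF \<phi>]] continuous_gdiv C1_Xd[OF smooth_Ck[OF K(3)]] Ck_continuous[OF Ck_left]
      by (auto intro: borel_measurable_continuous_onI)
    have "(LINT x|lborel. gdiv v (\<iota> g \<odot> x) * \<phi> x) = (LINT x|lborel. (\<lambda>x. gdiv v (\<iota> g \<odot> x) * \<phi> x) (g \<odot> x))"
      by (rule integral_left[symmetric]) measurable
    also have "\<dots> = (LINT x|lborel. gdiv v x * \<phi> (g \<odot> x))" by simp
    also have "\<dots> = - (LINT x|lborel. Xd v (\<lambda>x. \<phi> (g \<odot> x)) x)"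
      by (simp add: integral_Xd_gdiv[OF C1_compact_left[OF test_function_C1_compact[OF \<phi>]]])
    also have "(LINT x|lborel. Xd v (\<lambda>x. \<phi> (g \<odot> x)) x) = (LINT x|lborel. Xd v \<phi> (g \<odot> x))"
      using smooth_has_derivative[OF K(3)] differentiable_def by (subst Xd_left) blast+
    also have "\<dots> = (LINT x|lborel. Xd v \<phi> x)" by (rule integral_left) measurable
    also have "\<dots> = - (LINT x|lborel. gdiv v x * \<phi> x)"
      by (rule integral_Xd_gdiv[OF test_function_C1_compact[OF \<phi>]])
    finally have "(LINT x|lborel. gdiv v (\<iota> g \<odot> x) * \<phi> x) = (LINT x|lborel. gdiv v x * \<phi> x)" by simp
    moreover have "integrable lborel (\<lambda>x. gdiv v (\<iota> g \<odot> x) * \<phi> x)" "integrable lborel (\<lambda>x. gdiv v x * \<phi> x)"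
      by (rule loc_int_mult_cont[OF loc_int_continuous Ck_continuous[OF test_function_Ck[OF \<phi>]] K(1,2)]; use c continuous_gdiv in simp)+
    ultimately show "(LINT x|lborel. (gdiv v (\<iota> g \<odot> x) - gdiv v x) * \<phi> x) = 0"
      by (simp add: left_diff_distrib)
  qed
  from this[of x x] show ?thesis by simp
qed

section \<open>Dilations and polar coordinates\<close>

text \<open>Homomorphisms that act on the layers as the dilation by \<open>c\<close> does. Compositions of dilations are of this
kind, and \<open>graded_hom_id\<close> identifies them.\<close>

definition graded_hom :: "('a \<Rightarrow> 'a) \<Rightarrow> real \<Rightarrow> bool" where
  "graded_hom \<Phi> c \<longleftrightarrow> smooth \<Phi> \<and> (\<forall>x y. \<Phi> (x \<odot> y) = \<Phi> x \<odot> \<Phi> y) \<and>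
     (\<forall>j\<in>{1..step G}. \<forall>v\<in>layer G j. frechet_derivative \<Phi> (at 0) v = c ^ j *\<^sub>R v)"

lemma graded_hom_0: "graded_hom \<Phi> c \<Longrightarrow> \<Phi> 0 = 0"
  unfolding graded_hom_def by (metis g_0(1) g_left_cancel g_0(2))

lemma graded_hom_dil: "r > 0 \<Longrightarrow> graded_hom (dil G r) r"
  using dils unfolding dilations_def graded_hom_def by blast

lemma subspace_layer: "j \<in> {1..step G} \<Longrightarrow> subspace (layer G j)"
  using strat by (auto simp: stratification_def)

lemma graded_hom_compose:
  assumes f: "graded_hom f a" and g: "graded_hom g b"
  shows "graded_hom (\<lambda>x. f (g x)) (a * b)"
proof -
  have s: "smooth f" "smooth g" using f g by (auto simp: graded_hom_def)
  have "frechet_derivative (\<lambda>x. f (g x)) (at 0) v = (a * b) ^ j *\<^sub>R v"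
    if j: "j \<in> {1..step G}" "v \<in> layer G j" for j v
  proof -
    have "(f has_derivative frechet_derivative f (at 0)) (at (g 0))"
      using smooth_has_derivative[OF s(1)] graded_hom_0[OF g] by simp
    from frechet_derivative_at[OF has_derivative_compose[OF smooth_has_derivative[OF s(2)] this]]
    have "frechet_derivative (\<lambda>x. f (g x)) (at 0) v
        = frechet_derivative f (at 0) (frechet_derivative g (at 0) v)" by metis
    also have "frechet_derivative g (at 0) v = b ^ j *\<^sub>R v" using g j by (auto simp: graded_hom_def)
    also have "frechet_derivative f (at 0) (b ^ j *\<^sub>R v) = a ^ j *\<^sub>R (b ^ j *\<^sub>R v)"
      using f j subspace_scale[OF subspace_layer[OF j(1)] j(2)] by (auto simp: graded_hom_def)
    finally show ?thesis by (simp add: power_mult_distrib)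
  qed
  then show ?thesis using f g s unfolding graded_hom_def smooth_def by (auto intro: Ck_compose)
qed

lemma layer_decomposition:
  obtains w where "\<And>j. j \<in> {1..step G} \<Longrightarrow> w j \<in> layer G j" "v = (\<Sum>j = 1..step G. w j)"
  using strat unfolding stratification_def by blast

text \<open>A homomorphism is determined by its differential at the identity. With \<open>q x = h x \<odot> \<iota> x\<close> one has
\<open>q (g \<odot> y) = h g \<odot> (q y \<odot> \<iota> g)\<close>, so the derivative of \<open>q\<close>, which vanishes at \<open>0\<close>, vanishes
everywhere.\<close>

lemma graded_hom_id:
  assumes h: "graded_hom h 1"
  shows "h x = x"
proof -
  have s: "smooth h" and hom: "\<And>x y. h (x \<odot> y) = h x \<odot> h y" using h by (auto simp: graded_hom_def)
  note h0 = graded_hom_0[OF h]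
  have dh: "frechet_derivative h (at 0) v = v" for v
  proof -
    obtain w where w: "\<And>j. j \<in> {1..step G} \<Longrightarrow> w j \<in> layer G j" "v = (\<Sum>j = 1..step G. w j)"
      using layer_decomposition by blast
    have "frechet_derivative h (at 0) v = (\<Sum>j = 1..step G. frechet_derivative h (at 0) (w j))"
      unfolding w(2) using has_derivative_linear[OF smooth_has_derivative[OF s]] by (rule linear_sum)
    also have "\<dots> = (\<Sum>j = 1..step G. w j)"
      using h w(1) by (intro sum.cong) (auto simp: graded_hom_def)
    finally show ?thesis using w(2) by simp
  qed
  define q where "q x = h x \<odot> \<iota> x" for x
  have q1: "Ck 1 q" unfolding q_def[abs_def] by (intro Ck_op Ck_inv Ck_id smooth_Ck s)
  have q0: "q 0 = 0" by (simp add: q_def h0)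
  have dq0: "frechet_derivative q (at 0) v = 0" for v
  proof -
    let ?M = "frechet_derivative (\<lambda>(x, y). x \<odot> y) (at (0::'a, 0::'a))"
    have M: "((\<lambda>(x, y). x \<odot> y) has_derivative ?M) (at (0::'a, 0::'a))"
      by (rule smooth_has_derivative[OF smooth_mult])
    \<comment> \<open>The derivative of k x times the inverse of x at 0 depends only on the derivative of k, so h may be compared with the identity, for which the product is constant.\<close>
    have *: "((\<lambda>x. k x \<odot> \<iota> x) has_derivative (\<lambda>v. ?M (v, frechet_derivative \<iota> (at 0) v))) (at 0)"
      if "(k has_derivative (\<lambda>v. v)) (at 0)" "k 0 = 0" for k
    proof -
      have "((\<lambda>x. (k x, \<iota> x)) has_derivative (\<lambda>v. (v, frechet_derivative \<iota> (at 0) v))) (at 0)"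
        by (rule has_derivative_Pair[OF that(1) smooth_has_derivative[OF smooth_inv]])
      from has_derivative_compose[OF this, of "\<lambda>(x, y). x \<odot> y" ?M] M that(2) show ?thesis by simp
    qed
    have "frechet_derivative h (at 0) = (\<lambda>v. v)" using dh by auto
    then have "(h has_derivative (\<lambda>v. v)) (at 0)" using smooth_has_derivative[OF s, of 0] by simp
    from *[OF this h0] have "(q has_derivative (\<lambda>v. ?M (v, frechet_derivative \<iota> (at 0) v))) (at 0)"
      unfolding q_def[abs_def] .
    from frechet_derivative_at[OF this] have 1: "frechet_derivative q (at 0) v = ?M (v, frechet_derivative \<iota> (at 0) v)" by metis
    have "((\<lambda>x. 0) has_derivative (\<lambda>v. ?M (v, frechet_derivative \<iota> (at 0) v))) (at 0)"
      using *[of "\<lambda>x. x"] by simp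
    from has_derivative_unique[OF this has_derivative_const] show ?thesis using 1 by metis
  qed
  have "(q has_derivative (\<lambda>h. 0)) (at g)" for g
  proof -
    have qg: "q (g \<odot> y) = h g \<odot> (q y \<odot> \<iota> g)" for y
      by (simp add: q_def hom g_inv_mult g_assoc)
    let ?\<Psi> = "\<lambda>z. h g \<odot> (z \<odot> \<iota> g)"
    have "Ck 1 ?\<Psi>" by (intro Ck_op Ck_const Ck_id)
    then have \<Psi>: "(?\<Psi> has_derivative frechet_derivative ?\<Psi> (at 0)) (at (q 0))"
      unfolding q0 by (rule Ck_1_has_derivative)
    have "(q has_derivative frechet_derivative q (at g)) (at (g \<odot> 0))"
      using Ck_1_has_derivative[OF q1] by simp
    from has_derivative_compose[OF left_has_derivative this]
    have "((\<lambda>y. q (g \<odot> y)) has_derivative (\<lambda>v. frechet_derivative q (at g) (LF v g))) (at 0)"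
      unfolding left_field_def .
    moreover have "((\<lambda>y. q (g \<odot> y)) has_derivative (\<lambda>v. frechet_derivative ?\<Psi> (at 0) (frechet_derivative q (at 0) v))) (at 0)"
      unfolding qg by (rule has_derivative_compose[OF Ck_1_has_derivative[OF q1] \<Psi>])
    ultimately have "frechet_derivative q (at g) (LF v g) = frechet_derivative ?\<Psi> (at 0) (frechet_derivative q (at 0) v)" for v
      using has_derivative_unique by metis
    then have "frechet_derivative q (at g) (LF v g) = 0" for v
      using linear_0[OF has_derivative_linear[OF \<Psi>]] by (simp add: dq0)
    then have "frechet_derivative q (at g) w = 0" for w using LF_surj[of g w] by metis
    then have "frechet_derivative q (at g) = (\<lambda>h. 0)" by auto
    then show ?thesis using Ck_1_has_derivative[OF q1, of g] by simp
  qed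
  then have "q x = q 0" using has_derivative_zero_unique[of UNIV q 0 x] by auto
  then have "h x \<odot> \<iota> x = 0" using q0 by (simp add: q_def)
  then show ?thesis by (metis g_0(1) g_cancel(4))
qed

lemma dil_inverse: "r > 0 \<Longrightarrow> dil G r (dil G (1 / r) x) = x"
  using graded_hom_id[OF graded_hom_compose[OF graded_hom_dil[of r] graded_hom_dil[of "1 / r"], simplified]]
  by simp

text \<open>The dilation by \<open>1 / (r * s)\<close> followed by those by \<open>s\<close> and \<open>r\<close> acts trivially on all layers and hence is
the identity.\<close>

lemma dil_dil: "r > 0 \<Longrightarrow> s > 0 \<Longrightarrow> dil G r (dil G s x) = dil G (r * s) x"
proof -
  assume r: "r > 0" "s > 0"
  have "graded_hom (\<lambda>x. dil G r (dil G s (dil G (1 / (r * s)) x))) (r * (s * (1 / (r * s))))"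
    using r by (intro graded_hom_compose graded_hom_dil) auto
  then have "graded_hom (\<lambda>x. dil G r (dil G s (dil G (1 / (r * s)) x))) 1" using r by simp
  from graded_hom_id[OF this, of "dil G (r * s) x"]
  show ?thesis using dil_inverse[of "1 / (r * s)" x] r by simp
qed

lemma dil_inverse': "r > 0 \<Longrightarrow> dil G (1 / r) (dil G r x) = x"
  using dil_inverse[of "1/r"] by simp

lemma smooth_dil: "r > 0 \<Longrightarrow> smooth (dil G r)"
  using graded_hom_dil by (auto simp: graded_hom_def)

lemma dil_measurable [measurable]: "r > 0 \<Longrightarrow> dil G r \<in> borel_measurable borel"
  using Ck_continuous[OF smooth_Ck[OF smooth_dil]] by (rule borel_measurable_continuous_onI)

lemma N_dil: "r > 0 \<Longrightarrow> N (dil G r x) = r * N x"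
  and N_nonneg: "0 \<le> N x" and N_0: "N x = 0 \<longleftrightarrow> x = 0" and continuous_N: "continuous_on UNIV N"
  using gauge by (auto simp: carnot_gauge_def)

lemma N_measurable [measurable]: "N \<in> borel_measurable borel"
  using continuous_N by (rule borel_measurable_continuous_onI)

text \<open>Differentiate \<open>dil G r (x \<odot> y) = dil G r x \<odot> dil G r y\<close> in \<open>y\<close> at the identity.\<close>

lemma dil_push:
  assumes r: "r > 0" and v: "j \<in> {1..step G}" "v \<in> layer G j"
  shows "frechet_derivative (dil G r) (at x) (LF v x) = LF (r ^ j *\<^sub>R v) (dil G r x)"
proof -
  note h = graded_hom_dil[OF r] and s = smooth_dil[OF r]
  have "(dil G r has_derivative frechet_derivative (dil G r) (at x)) (at (x \<odot> 0))"
    using smooth_has_derivative[OF s] by simp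
  from has_derivative_compose[OF left_has_derivative this]
  have 1: "((\<lambda>y. dil G r (x \<odot> y)) has_derivative (\<lambda>v. frechet_derivative (dil G r) (at x) (LF v x))) (at 0)"
    unfolding left_field_def .
  have "((\<odot>) (dil G r x) has_derivative frechet_derivative ((\<odot>) (dil G r x)) (at 0)) (at (dil G r 0))"
    using left_has_derivative graded_hom_0[OF h] by simp
  from has_derivative_compose[OF smooth_has_derivative[OF s] this]
  have "((\<lambda>y. dil G r (x \<odot> y)) has_derivative (\<lambda>v. LF (frechet_derivative (dil G r) (at 0) v) (dil G r x))) (at 0)"
    using h unfolding left_field_def by (simp add: graded_hom_def)
  from has_derivative_unique[OF 1 this] have "frechet_derivative (dil G r) (at x) (LF v x)
      = LF (frechet_derivative (dil G r) (at 0) v) (dil G r x)" by metis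
  then show ?thesis using h v by (simp add: graded_hom_def)
qed

lemma Xd_dil:
  assumes r: "r > 0" and v: "j \<in> {1..step G}" "v \<in> layer G j" and f: "f differentiable (at (dil G r x))"
  shows "Xd v (\<lambda>x. f (dil G r x)) x = r ^ j * Xd v f (dil G r x)"
  using Xd_compose[OF smooth_has_derivative[OF smooth_dil[OF r]] dil_push[OF r v] f] Xd_linear(2)[OF f]
  by simp

abbreviation Q where "Q \<equiv> hom_dim G"

lemma Q_pos: "1 \<le> Q"
proof -
  let ?k = "step G"
  have k: "1 \<le> ?k" "layer G ?k \<noteq> {0}" using strat by (auto simp: stratification_def)
  have "0 \<in> layer G ?k" using subspace_layer[of ?k] k subspace_0 by auto
  then have "dim (layer G ?k) \<noteq> 0" using k dim_eq_0 by blast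
  then have "1 \<le> dim (layer G ?k)" by linarith
  from mult_le_mono[OF k(1) this] have "1 \<le> ?k * dim (layer G ?k)" by simp
  also have "\<dots> \<le> Q" unfolding hom_dim_def using k(1)
    by (intro member_le_sum[of ?k "{1..?k}" "\<lambda>j. j * dim (layer G j)"]) auto
  finally show ?thesis .
qed

lemma polar_formula: "integrable lborel f \<Longrightarrow> (LINT x|lborel. f x) =
    (LINT r:{0<..}|lborel. (LINT y|\<sigma>. f (dil G r y)) * r ^ (Q - 1))" for f :: "'a \<Rightarrow> real"
  using polar by (auto simp: polar_measure_def)

text \<open>In polar coordinates the dilation multiplies the radius by \<open>R\<close>, and \<open>r ^ (Q - 1) dr\<close> contributes the
factor \<open>R ^ Q\<close>. The measures are compared on boxes, which determine Lebesgue measure.\<close>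

lemma dil_lborel:
  assumes R: "R > 0"
  shows "lborel = density (distr lborel borel (dil G R)) (\<lambda>_. ennreal (R ^ Q))"
proof (rule lborel_eqI)
  note [measurable] = dil_measurable[OF R]
  fix l u :: 'a assume lu: "\<And>b. b \<in> Basis \<Longrightarrow> l \<bullet> b \<le> u \<bullet> b"
  let ?B = "box l u" and ?A = "dil G R -` box l u"
  have A: "?A \<in> sets borel" using measurable_sets[OF dil_measurable[OF R], of ?B] by simp
  have "?A \<subseteq> dil G (1/R) ` cbox l u"
    using box_subset_cbox[of l u] dil_inverse'[OF R] by (auto simp: image_iff subset_iff) (metis)
  moreover have "compact (dil G (1/R) ` cbox l u)"
    using R by (intro compact_continuous_image continuous_on_subset[OF Ck_continuous[OF smooth_Ck[OF smooth_dil]]]) auto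
  ultimately have fin: "emeasure lborel ?A < \<infinity>"
    using emeasure_mono[of ?A "dil G (1/R) ` cbox l u" lborel] emeasure_compact_finite
    by (metis borel_compact sets_lborel order.strict_trans1)
  have i1: "integrable lborel (indicat_real ?A)" using A fin by simp
  have i2: "integrable lborel (indicat_real ?B)"
    by (intro integrable_real_indicator) (use emeasure_lborel_box_finite[of l u] in simp_all)
  let ?I = "\<lambda>s. LINT y|\<sigma>. indicat_real ?B (dil G s y)"
  have "measure lborel ?B = (LINT x|lborel. indicat_real ?B x)" by simp
  also have "\<dots> = (LINT s|lborel. indicator {0<..} s *\<^sub>R (?I s * s ^ (Q - 1)))"
    using polar_formula[OF i2] by (simp add: set_lebesgue_integral_def)
  also have "\<dots> = \<bar>R\<bar> *\<^sub>R (LINT r|lborel. indicator {0<..} (0 + R * r) *\<^sub>R (?I (0 + R * r) * (0 + R * r) ^ (Q - 1)))"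
    using R by (intro lborel_integral_real_affine) auto
  also have "\<dots> = R * (LINT r|lborel. R ^ (Q - 1) * (indicator {0<..} r *\<^sub>R ((LINT y|\<sigma>. indicat_real ?A (dil G r y)) * r ^ (Q - 1))))"
  proof -
    have "indicator {0<..} (0 + R * r) *\<^sub>R (?I (0 + R * r) * (0 + R * r) ^ (Q - 1))
      = R ^ (Q - 1) * (indicator {0<..} r *\<^sub>R ((LINT y|\<sigma>. indicat_real ?A (dil G r y)) * r ^ (Q - 1)))" for r
    proof (cases "r > 0")
      case True
      have "indicat_real ?A (dil G r y) = indicat_real ?B (dil G (R * r) y)" for y
        using dil_dil[OF R True, of y] by (simp add: indicator_def)
      then show ?thesis using True R by (simp add: power_mult_distrib)
    next
      case False
      then show ?thesis using R by (simp add: indicator_def zero_less_mult_iff)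
    qed
    then show ?thesis using R by simp
  qed
  also have "\<dots> = R ^ Q * (LINT r:{0<..}|lborel. (LINT y|\<sigma>. indicat_real ?A (dil G r y)) * r ^ (Q - 1))"
  proof -
    have "R * R ^ (Q - 1) = R ^ Q" using Q_pos by (metis Suc_diff_1 less_eq_Suc_le One_nat_def power_Suc)
    then show ?thesis unfolding set_lebesgue_integral_def
      by (subst Bochner_Integration.integral_mult_right_zero) (simp only: mult.assoc[symmetric])
  qed
  also have "\<dots> = R ^ Q * measure lborel ?A" using polar_formula[OF i1] by simp
  finally have *: "measure lborel ?B = R ^ Q * measure lborel ?A" .
  have "emeasure (density (distr lborel borel (dil G R)) (\<lambda>_. ennreal (R ^ Q))) ?B
      = ennreal (R ^ Q) * emeasure lborel ?A"
    by (simp add: emeasure_density_const emeasure_distr)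
  also have "\<dots> = ennreal (R ^ Q * measure lborel ?A)"
    using fin R emeasure_eq_ennreal_measure[of lborel ?A] by (simp add: ennreal_mult less_top)
  also have "\<dots> = ennreal (measure lborel ?B)" using * by simp
  also have "\<dots> = ennreal (\<Prod>b\<in>Basis. (u - l) \<bullet> b)" using lu by simp
  finally show "emeasure (density (distr lborel borel (dil G R)) (\<lambda>_. ennreal (R ^ Q))) ?B
      = ennreal (\<Prod>b\<in>Basis. (u - l) \<bullet> b)" .
qed simp

lemma integral_dil:
  assumes R: "R > 0" and [measurable]: "f \<in> borel_measurable borel"
  shows "(LINT x|lborel. f x) = R ^ Q * (LINT x|lborel. (f (dil G R x) :: real))"
proof -
  note [measurable] = dil_measurable[OF R]
  have "(LINT x|lborel. f x) = (LINT x|density (distr lborel borel (dil G R)) (\<lambda>_. ennreal (R ^ Q)). f x)"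
    using dil_lborel[OF R] by metis
  also have "\<dots> = (LINT x|distr lborel borel (dil G R). R ^ Q *\<^sub>R f x)"
    using R by (intro integral_density) auto
  also have "\<dots> = (LINT x|lborel. R ^ Q *\<^sub>R f (dil G R x))" by (rule integral_distr) auto
  finally show ?thesis by simp
qed

section \<open>Integration by parts and right invariance\<close>

lemma Xd_integrable: "C1_compact f \<Longrightarrow> integrable lborel (Xd v f)"
  unfolding C1_compact_def using integrable_cont_compact[OF C1_Xd] Xd_outside compact_imp_closed by metis

lemma test_function_dil: "r > 0 \<Longrightarrow> test_function \<phi> \<Longrightarrow> test_function (\<lambda>x. \<phi> (dil G r x))"
  by (rule test_function_compose[where \<Phi>="dil G (1/r)"])
    (auto simp: smooth_dil dil_inverse' intro!: Ck_continuous[OF smooth_Ck[OF smooth_dil]])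

lemma test_function_diff: "test_function \<phi> \<Longrightarrow> \<phi> differentiable (at x)"
  using test_function_Ck[of \<phi> "Suc 0"] by simp

text \<open>By \<open>gdiv_const\<close> the integral of \<open>Xd v \<psi>\<close> is a fixed multiple \<open>- c\<close> of the integral of \<open>\<psi>\<close>. Replacing a
bump \<open>\<psi>\<close> by its composition with the dilation by \<open>2\<close> divides the integral of \<open>\<psi>\<close> by \<open>2 ^ Q\<close>, but that of
the derivative by \<open>2 ^ (Q - j)\<close> only. Hence \<open>c = 2 ^ j * c\<close>.\<close>

lemma gdiv_layer:
  assumes v: "j \<in> {1..step G}" "v \<in> layer G j"
  shows "gdiv v x = 0"
proof -
  obtain \<phi> :: "'a \<Rightarrow> real" where \<phi>: "test_function \<phi>" "\<And>x. 0 \<le> \<phi> x" "\<phi> 0 > 0"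
    using test_function_bump[of UNIV 0] by auto
  let ?c = "gdiv v 0"
  have pos: "(LINT x|lborel. \<phi> x) > 0"
    by (rule integral_pos_cont[OF test_function_cont[OF \<phi>(1)] test_function_integrable[OF \<phi>(1)] \<phi>(2,3)])
  have *: "(LINT x|lborel. Xd v \<psi> x) = - ?c * (LINT x|lborel. \<psi> x)" if "test_function \<psi>" for \<psi>
  proof -
    have "(\<lambda>x. gdiv v x * \<psi> x) = (\<lambda>x. ?c * \<psi> x)" by (rule ext, subst gdiv_const, rule refl)
    from arg_cong[OF this, of "integral\<^sup>L lborel"]
    have "(LINT x|lborel. gdiv v x * \<psi> x) = ?c * (LINT x|lborel. \<psi> x)" by simp
    then show ?thesis using integral_Xd_gdiv[OF test_function_C1_compact[OF that], of v] by linarith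
  qed
  have t2: "test_function (\<lambda>x. \<phi> (dil G 2 x))" by (rule test_function_dil[OF _ \<phi>(1)]) simp
  have X: "Xd v \<phi> \<in> borel_measurable borel"
    using C1_Xd[OF test_function_Ck[OF \<phi>(1)]] by (rule borel_measurable_continuous_onI)
  have "(LINT x|lborel. Xd v (\<lambda>x. \<phi> (dil G 2 x)) x) = 2 ^ j * (LINT x|lborel. Xd v \<phi> (dil G 2 x))"
    by (subst Xd_dil[OF _ v test_function_diff[OF \<phi>(1)]]) auto
  then have "2 ^ Q * (LINT x|lborel. Xd v (\<lambda>x. \<phi> (dil G 2 x)) x) = 2 ^ j * (LINT x|lborel. Xd v \<phi> x)"
    using integral_dil[OF _ X, of 2] by simp
  then have "?c * (2 ^ Q * (LINT x|lborel. \<phi> (dil G 2 x))) = 2 ^ j * (?c * (LINT x|lborel. \<phi> x))"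
    unfolding *[OF t2] *[OF \<phi>(1)] by (simp add: algebra_simps)
  then have "?c * (LINT x|lborel. \<phi> x) = 2 ^ j * (?c * (LINT x|lborel. \<phi> x))"
    using integral_dil[OF _ test_function_borel[OF \<phi>(1)], of 2] by simp
  then have "(2 ^ j - 1) * ?c = 0" using pos by (simp add: algebra_simps)
  moreover have "(2::real) ^ j > 1" using v(1) by (intro one_less_power) auto
  ultimately have "?c = 0" by simp
  then show ?thesis by (subst gdiv_const)
qed

text \<open>By linearity in \<open>v\<close> this reduces to the layers.\<close>

lemma integral_Xd_0:
  assumes f: "C1_compact f"
  shows "(LINT x|lborel. Xd v f x) = 0"
proof -
  obtain w where w: "\<And>j. j \<in> {1..step G} \<Longrightarrow> w j \<in> layer G j" "v = (\<Sum>j = 1..step G. w j)"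
    using layer_decomposition by blast
  have "Xd v f x = (\<Sum>j = 1..step G. Xd (w j) f x)" for x
  proof -
    have "linear (frechet_derivative f (at x))"
      using f Ck_1_has_derivative has_derivative_linear unfolding C1_compact_def by blast
    then show ?thesis unfolding Xd_def w(2) by (simp add: linear_sum[OF linear_LF] linear_sum)
  qed
  then have "(LINT x|lborel. Xd v f x) = (\<Sum>j = 1..step G. LINT x|lborel. Xd (w j) f x)"
    using Xd_integrable[OF f] by simp
  also have "\<dots> = 0"
    using integral_Xd_gdiv[OF f] gdiv_layer w(1) by (intro sum.neutral) simp
  finally show ?thesis .
qed

lemma C1_compact_mult: "Ck 1 f \<Longrightarrow> C1_compact g \<Longrightarrow> C1_compact (\<lambda>x. f x * g x)"
  unfolding C1_compact_def using Ck_mult by (metis mult_zero_right)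

lemma C1_compact_Xd_mult_integrable:
  assumes "Ck 1 f" "C1_compact g"
  shows "integrable lborel (\<lambda>x. f x * Xd v g x)" "integrable lborel (\<lambda>x. Xd v f x * g x)"
proof -
  obtain K where K: "compact K" "\<And>x. x \<notin> K \<Longrightarrow> g x = 0" "Ck 1 g" using assms(2) by (auto simp: C1_compact_def)
  show "integrable lborel (\<lambda>x. f x * Xd v g x)"
    using Xd_outside[OF compact_imp_closed[OF K(1)] K(2)]
    by (intro loc_int_mult_cont[OF loc_int_continuous[OF Ck_continuous[OF assms(1)]] C1_Xd[OF K(3)] K(1)]) auto
  show "integrable lborel (\<lambda>x. Xd v f x * g x)"
    by (intro loc_int_mult_cont[OF loc_int_continuous[OF C1_Xd[OF assms(1)]] Ck_continuous[OF K(3)] K(1,2)])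
qed

lemma integral_Xd_by_parts:
  assumes f: "Ck 1 f" and g: "C1_compact g"
  shows "(LINT x|lborel. f x * Xd v g x) = - (LINT x|lborel. Xd v f x * g x)"
proof -
  have d: "f differentiable (at x)" "g differentiable (at x)" for x
    using f g by (auto simp: C1_compact_def)
  have "0 = (LINT x|lborel. f x * Xd v g x + Xd v f x * g x)"
    using integral_Xd_0[OF C1_compact_mult[OF f g], of v] by (simp add: Xd_mult[OF d])
  also have "\<dots> = (LINT x|lborel. f x * Xd v g x) + (LINT x|lborel. Xd v f x * g x)"
    by (rule Bochner_Integration.integral_add[OF C1_compact_Xd_mult_integrable[OF f g]])
  finally show ?thesis by simp
qed

text \<open>Left-invariant fields generate the right translations: the derivative in \<open>s\<close> of the
integral of \<open>w z * \<phi> (z \<odot> (s *\<^sub>R h))\<close> over \<open>z\<close> is the integral of \<open>w\<close> times the derivative of a test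
function along some left-invariant field. For \<open>w = 1\<close> this shows that the group is unimodular. For the
indicator of a ball it gives the contradiction in \<open>hperimeter_unit_ball_pos\<close>.\<close>

lemma weight_right_invariant:
  assumes w: "loc_int w" and 0: "\<And>v \<phi>. test_function \<phi> \<Longrightarrow> (LINT x|lborel. w x * Xd v \<phi> x) = 0"
    and \<phi>: "test_function \<phi>"
  shows "(LINT x|lborel. w x * \<phi> (x \<odot> h)) = (LINT x|lborel. w x * \<phi> x)"
proof -
  obtain K0 where K0: "compact K0" "\<And>x. x \<notin> K0 \<Longrightarrow> \<phi> x = 0" "smooth \<phi>"
    using test_functionE[OF \<phi>] by blast
  let ?\<Psi> = "\<lambda>p::real \<times> 'a. \<phi> (snd p \<odot> (fst p *\<^sub>R h))"
  have "Ck 1 (\<lambda>p::real \<times> 'a. snd p \<odot> (fst p *\<^sub>R h))"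
    by (intro Ck_op Ck_scaleR Ck_const Ck_bounded_linear bounded_linear_fst bounded_linear_snd)
  from Ck_compose[OF smooth_Ck[OF K0(3)] this] have \<Psi>: "Ck 1 ?\<Psi>" .
  have der0: "((\<lambda>s. LINT z|lborel. w z * ?\<Psi> (s, z)) has_derivative (\<lambda>t. 0)) (at s0)" for s0 :: real
  proof -
    let ?K = "(\<lambda>p. snd p \<odot> \<iota> (fst p *\<^sub>R h)) ` (cball s0 1 \<times> K0)"
    have K: "compact ?K"
      by (intro compact_continuous_image compact_Times K0) (auto intro!: continuous_intros)
    have supp: "?\<Psi> (s, z) = 0" if "s \<in> ball s0 1" "z \<notin> ?K" for s z
    proof (rule ccontr)
      assume "?\<Psi> (s, z) \<noteq> 0"
      then have "z \<odot> (s *\<^sub>R h) \<in> K0" using K0 by auto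
      then have "z \<in> ?K" using that(1) by (intro image_eqI[where x="(s, z \<odot> (s *\<^sub>R h))"]) auto
      then show False using that by blast
    qed
    let ?p = "s0 *\<^sub>R h"
    let ?R = "\<lambda>y. y \<odot> ?p"
    let ?DR = "\<lambda>z. frechet_derivative ?R (at z)"
    have DR: "(?R has_derivative ?DR z) (at z)" for z by (rule right_has_derivative)
    \<comment> \<open>The line through h need not be a one-parameter subgroup. Its velocity at s0, translated back to the identity from the right, is the field needed at this time.\<close>
    define v where "v = frechet_derivative (\<lambda>y. y \<odot> \<iota> ?p) (at ?p) h"
    have DRv: "?DR 0 v = h"
    proof -
      have "(?R has_derivative ?DR 0) (at (?p \<odot> \<iota> ?p))" using DR by simp
      from has_derivative_compose[OF right_has_derivative this]
      have "((\<lambda>y. y) has_derivative (\<lambda>u. ?DR 0 (frechet_derivative (\<lambda>y. y \<odot> \<iota> ?p) (at ?p) u))) (at ?p)"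
        by simp
      from has_derivative_unique[OF this has_derivative_ident] show ?thesis unfolding v_def by metis
    qed
    \<comment> \<open>Both sides are derivatives of y \<mapsto> z \<odot> y \<odot> ?p at the identity.\<close>
    have key: "frechet_derivative ((\<odot>) z) (at ?p) h = ?DR z (LF v z)" for z
    proof -
      have "((\<odot>) z has_derivative frechet_derivative ((\<odot>) z) (at ?p)) (at (0 \<odot> ?p))"
        using left_has_derivative by simp
      from has_derivative_compose[OF DR this]
      have 1: "((\<lambda>y. z \<odot> (y \<odot> ?p)) has_derivative (\<lambda>u. frechet_derivative ((\<odot>) z) (at ?p) (?DR 0 u))) (at 0)" .
      have "(?R has_derivative ?DR z) (at (z \<odot> 0))" using DR by simp
      from has_derivative_compose[OF left_has_derivative this]
      have 2: "((\<lambda>y. z \<odot> (y \<odot> ?p)) has_derivative (\<lambda>u. ?DR z (LF u z))) (at 0)"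
        unfolding left_field_def g_assoc .
      from has_derivative_unique[OF 1 2] have "frechet_derivative ((\<odot>) z) (at ?p) (?DR 0 v) = ?DR z (LF v z)"
        by metis
      then show ?thesis by (simp only: DRv)
    qed
    have D\<Psi>: "frechet_derivative ?\<Psi> (at (s0, z)) (t, 0) = t * Xd v (\<lambda>y. \<phi> (y \<odot> ?p)) z" for t z
    proof -
      have a: "((\<lambda>s. (s, z)) has_derivative (\<lambda>t. (t, 0))) (at s0)" by (auto intro!: derivative_eq_intros)
      have A: "((\<lambda>s. ?\<Psi> (s, z)) has_derivative (\<lambda>t. frechet_derivative ?\<Psi> (at (s0, z)) (t, 0))) (at s0)"
        by (rule has_derivative_compose[OF a Ck_1_has_derivative[OF \<Psi>]])
      have b: "((\<lambda>s. s *\<^sub>R h) has_derivative (\<lambda>t. t *\<^sub>R h)) (at s0)" by (auto intro!: derivative_eq_intros)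
      have c: "((\<lambda>s. z \<odot> (s *\<^sub>R h)) has_derivative (\<lambda>t. frechet_derivative ((\<odot>) z) (at ?p) (t *\<^sub>R h))) (at s0)"
        by (rule has_derivative_compose[OF b left_has_derivative])
      have B: "((\<lambda>s. ?\<Psi> (s, z)) has_derivative (\<lambda>t. frechet_derivative \<phi> (at (z \<odot> ?p))
          (frechet_derivative ((\<odot>) z) (at ?p) (t *\<^sub>R h)))) (at s0)"
        using has_derivative_compose[OF c smooth_has_derivative[OF K0(3)]] by simp
      have "frechet_derivative ?\<Psi> (at (s0, z)) (t, 0) = frechet_derivative \<phi> (at (z \<odot> ?p))
          (frechet_derivative ((\<odot>) z) (at ?p) (t *\<^sub>R h))"
        using has_derivative_unique[OF A B] by metis
      also have "\<dots> = t * frechet_derivative \<phi> (at (z \<odot> ?p)) (?DR z (LF v z))"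
        using linear_scale[OF has_derivative_linear[OF left_has_derivative]]
          linear_scale[OF has_derivative_linear[OF smooth_has_derivative[OF K0(3)]]] by (simp add: key)
      also have "frechet_derivative \<phi> (at (z \<odot> ?p)) (?DR z (LF v z)) = Xd v (\<lambda>y. \<phi> (y \<odot> ?p)) z"
        using Xd_unique[OF has_derivative_compose[OF DR smooth_has_derivative[OF K0(3)]]] by simp
      finally show ?thesis .
    qed
    have "(LINT z|lborel. w z * frechet_derivative ?\<Psi> (at (s0, z)) (t, 0)) = 0" for t
    proof -
      have "(LINT z|lborel. w z * frechet_derivative ?\<Psi> (at (s0, z)) (t, 0))
        = t * (LINT z|lborel. w z * Xd v (\<lambda>y. \<phi> (y \<odot> ?p)) z)"
        unfolding D\<Psi> by (simp add: mult.left_commute)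
      then show ?thesis using 0[OF test_function_right[OF \<phi>]] by simp
    qed
    then show ?thesis
      using has_derivative_integral_param[OF w \<Psi> K zero_less_one supp, of s0] by simp
  qed
  have "(LINT z|lborel. w z * ?\<Psi> (1, z)) = (LINT z|lborel. w z * ?\<Psi> (0, z))"
    using has_derivative_zero_unique[of UNIV "\<lambda>s. LINT z|lborel. w z * ?\<Psi> (s, z)" 0 1] der0 by auto
  then show ?thesis by simp
qed

lemma right_invariant: "test_function \<phi> \<Longrightarrow> (LINT x|lborel. \<phi> (x \<odot> h)) = (LINT x|lborel. \<phi> x)"
  using weight_right_invariant[OF loc_int_continuous[OF continuous_on_const[of _ 1]], of \<phi> h]
    integral_Xd_0[OF test_function_C1_compact] by simp

section \<open>Mollification by group convolution\<close>

text \<open>Because of the symmetry under inversion the kernel \<open>\<rho> (x \<odot> \<iota> z)\<close> has integral \<open>1\<close> in each of its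
variables.\<close>

definition mollifier :: "real \<Rightarrow> ('a \<Rightarrow> real) \<Rightarrow> bool" where
  "mollifier e \<rho> \<longleftrightarrow> test_function \<rho> \<and> (\<forall>x. 0 \<le> \<rho> x) \<and> (\<forall>x. \<rho> (\<iota> x) = \<rho> x) \<and>
     (\<forall>x. x \<notin> ball 0 e \<longrightarrow> \<rho> x = 0) \<and> (LINT x|lborel. \<rho> x) = 1"

lemma mollifier_exists:
  assumes "e > 0" shows "\<exists>\<rho>. mollifier e \<rho>"
proof -
  \<comment> \<open>A neighbourhood of the identity stable under inversion, so that symmetrizing the bump keeps its support small.\<close>
  let ?U = "{x. norm x < e} \<inter> {x. norm (\<iota> x) < e}"
  have "open ?U"
    by (intro open_Int open_Collect_less) (auto intro!: continuous_intros)
  moreover have "0 \<in> ?U" using assms by simp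
  ultimately obtain \<phi> where \<phi>: "test_function \<phi>" "\<And>x. 0 \<le> \<phi> x" "\<phi> 0 > 0" "\<And>x. x \<notin> ?U \<Longrightarrow> \<phi> x = 0"
    using test_function_bump[of ?U 0] by blast
  have \<phi>': "test_function (\<lambda>x. \<phi> (\<iota> x))"
    by (rule test_function_compose[OF \<phi>(1) smooth_inv, of \<iota>]) (auto intro!: continuous_intros)
  define \<psi> where "\<psi> x = \<phi> x + \<phi> (\<iota> x)" for x
  obtain K1 K2 where K: "compact K1" "\<And>x. x \<notin> K1 \<Longrightarrow> \<phi> x = 0" "compact K2" "\<And>x. x \<notin> K2 \<Longrightarrow> \<phi> (\<iota> x) = 0"
    by (metis test_functionE \<phi>(1) \<phi>')
  have t: "test_function (\<lambda>x. c * \<psi> x)" for c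
  proof (rule test_functionI)
    show "smooth (\<lambda>x. c * \<psi> x)" unfolding smooth_def \<psi>_def[abs_def]
      by (intro allI Ck_mult Ck_const Ck_add test_function_Ck \<phi>(1) \<phi>')
    show "compact (K1 \<union> K2)" using K by (intro compact_Un)
  qed (use K in \<open>auto simp: \<psi>_def\<close>)
  let ?I = "LINT x|lborel. \<psi> x"
  have t1: "test_function \<psi>" using t[of 1] by simp
  have pos: "?I > 0"
    by (rule integral_pos_cont[OF test_function_cont[OF t1] test_function_integrable[OF t1], of 0])
      (use \<phi> in \<open>auto simp: \<psi>_def add_nonneg_nonneg\<close>)
  have "mollifier e (\<lambda>x. 1 / ?I * \<psi> x)"
    unfolding mollifier_def
  proof (intro conjI allI impI)
    show "test_function (\<lambda>x. 1 / ?I * \<psi> x)" by (rule t)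
    show "0 \<le> 1 / ?I * \<psi> x" for x using pos \<phi>(2) by (simp add: \<psi>_def)
    show "1 / ?I * \<psi> (\<iota> x) = 1 / ?I * \<psi> x" for x by (simp add: \<psi>_def add.commute)
    show "1 / ?I * \<psi> x = 0" if "x \<notin> ball 0 e" for x
      using that \<phi>(4)[of x] \<phi>(4)[of "\<iota> x"] by (simp add: \<psi>_def)
    show "(LINT x|lborel. 1 / ?I * \<psi> x) = 1" using pos by simp
  qed
  then show ?thesis by blast
qed

text \<open>The convolution of \<open>\<rho>\<close> and \<open>f\<close>, in this order. The kernel does not change when \<open>x\<close> and \<open>z\<close> are both
multiplied from the right by the same element, which makes the convolution commute with left-invariant
fields; see \<open>Xd_mollify\<close>.\<close>

definition mollify :: "('a \<Rightarrow> real) \<Rightarrow> ('a \<Rightarrow> real) \<Rightarrow> 'a \<Rightarrow> real" where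
  "mollify \<rho> f x = (LINT z|lborel. f z * \<rho> (x \<odot> \<iota> z))"

lemma mollifier_Ck: "mollifier e \<rho> \<Longrightarrow> Ck k (\<lambda>p. \<rho> (fst p \<odot> \<iota> (snd p)))"
proof -
  assume "mollifier e \<rho>"
  then have "Ck k \<rho>" by (auto simp: mollifier_def test_function_Ck)
  moreover have "Ck k (\<lambda>p::'a \<times> 'a. fst p \<odot> \<iota> (snd p))"
    by (intro Ck_op Ck_inv Ck_bounded_linear bounded_linear_fst bounded_linear_snd)
  ultimately show ?thesis by (rule Ck_compose)
qed

text \<open>For the integral over \<open>x\<close> this is right invariance. The symmetry of \<open>\<rho>\<close> exchanges the two variables.\<close>

lemma mollifier_slices:
  assumes \<rho>: "mollifier e \<rho>"
  shows "test_function (\<lambda>x. \<rho> (x \<odot> \<iota> z))" "test_function (\<lambda>z. \<rho> (x \<odot> \<iota> z))"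
    "(LINT x|lborel. \<rho> (x \<odot> \<iota> z)) = 1" "(LINT z|lborel. \<rho> (x \<odot> \<iota> z)) = 1"
proof -
  have t: "test_function \<rho>" and sym: "\<And>x. \<rho> (\<iota> x) = \<rho> x" and 1: "(LINT x|lborel. \<rho> x) = 1"
    using \<rho> by (auto simp: mollifier_def)
  show t': "test_function (\<lambda>x. \<rho> (x \<odot> \<iota> z))" for z by (rule test_function_right[OF t])
  show i: "(LINT x|lborel. \<rho> (x \<odot> \<iota> z)) = 1" for z using right_invariant[OF t] 1 by simp
  have eq: "\<rho> (x \<odot> \<iota> z) = \<rho> (z \<odot> \<iota> x)" for z using sym[of "z \<odot> \<iota> x"] by (simp add: g_inv_mult)
  show "test_function (\<lambda>z. \<rho> (x \<odot> \<iota> z))" unfolding eq by (rule t')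
  show "(LINT z|lborel. \<rho> (x \<odot> \<iota> z)) = 1" unfolding eq by (rule i)
qed

lemma mollifier_support:
  assumes \<rho>: "mollifier e \<rho>"
  shows "\<exists>K d. compact K \<and> d > 0 \<and> (\<forall>x z. x \<in> ball x0 d \<longrightarrow> z \<notin> K \<longrightarrow> \<rho> (x \<odot> \<iota> z) = 0)"
proof -
  obtain K0 where K0: "compact K0" "\<And>x. x \<notin> K0 \<Longrightarrow> \<rho> x = 0"
    using \<rho> by (auto simp: mollifier_def elim: test_functionE)
  let ?K = "(\<lambda>p. \<iota> (fst p) \<odot> snd p) ` (K0 \<times> cball x0 1)"
  have "compact ?K"
    by (intro compact_continuous_image compact_Times K0) (auto intro!: continuous_intros)
  moreover have "\<rho> (x \<odot> \<iota> z) = 0" if "x \<in> ball x0 1" "z \<notin> ?K" for x z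
  proof (rule ccontr)
    assume "\<rho> (x \<odot> \<iota> z) \<noteq> 0"
    then have "x \<odot> \<iota> z \<in> K0" using K0 by auto
    then have "z \<in> ?K" using that(1)
      by (intro image_eqI[where x="(x \<odot> \<iota> z, x)"]) (auto simp: g_inv_mult g_assoc)
    then show False using that by blast
  qed
  ultimately show ?thesis by (intro exI[of _ ?K] exI[of _ 1] conjI allI impI zero_less_one)
qed

lemma mollify_C1:
  assumes "mollifier e \<rho>" "loc_int f"
  shows "Ck 1 (mollify \<rho> f)"
    and "frechet_derivative (mollify \<rho> f) (at x) =
      (\<lambda>h. LINT z|lborel. f z * frechet_derivative (\<lambda>p. \<rho> (fst p \<odot> \<iota> (snd p))) (at (x, z)) (h, 0))"
  using Ck_1_integral_param[OF assms(2) mollifier_Ck[OF assms(1), of 1]] mollifier_support[OF assms(1)]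
  unfolding mollify_def[abs_def] by simp_all

definition weak_Xd :: "'a \<Rightarrow> ('a \<Rightarrow> real) \<Rightarrow> ('a \<Rightarrow> real) \<Rightarrow> bool" where
  "weak_Xd v u d \<longleftrightarrow> loc_int u \<and> loc_int d \<and>
     (\<forall>\<phi>. test_function \<phi> \<longrightarrow> (LINT x|lborel. d x * \<phi> x) = - (LINT x|lborel. u x * Xd v \<phi> x))"

text \<open>The kernel is invariant under \<open>(x, z) \<mapsto> (x \<odot> y, z \<odot> y)\<close>, so its derivative along the field in \<open>x\<close> is minus
the one in \<open>z\<close>; the latter is moved to \<open>u\<close> by the definition of weak derivatives.\<close>

lemma Xd_mollify:
  assumes \<rho>: "mollifier e \<rho>" and u: "weak_Xd v u d"
  shows "Xd v (mollify \<rho> u) x = mollify \<rho> d x"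
proof -
  have lu: "loc_int u" using u by (simp add: weak_Xd_def)
  let ?\<Psi> = "\<lambda>p. \<rho> (fst p \<odot> \<iota> (snd p))"
  note \<Psi> = Ck_1_has_derivative[OF mollifier_Ck[OF \<rho>]]
  have eq: "frechet_derivative ?\<Psi> (at (x, z)) (LF v x, 0) = - Xd v (\<lambda>z. \<rho> (x \<odot> \<iota> z)) z" for z
  proof -
    let ?D = "frechet_derivative ?\<Psi> (at (x, z))"
    have D: "(?\<Psi> has_derivative ?D) (at (x \<odot> 0, z \<odot> 0))" using \<Psi> by simp
    have "((\<lambda>y. (x \<odot> y, z \<odot> y)) has_derivative (\<lambda>w. (LF w x, LF w z))) (at 0)"
      unfolding left_field_def by (rule has_derivative_Pair[OF left_has_derivative left_has_derivative])
    from has_derivative_compose[OF this D]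
    have "((\<lambda>y. \<rho> (x \<odot> \<iota> z)) has_derivative (\<lambda>w. ?D (LF w x, LF w z))) (at 0)"
      by (simp add: g_inv_mult g_assoc[symmetric]) 
    from has_derivative_unique[OF this has_derivative_const] have "?D (LF v x, LF v z) = 0" by metis
    moreover have "?D (LF v x, LF v z) = ?D (LF v x, 0) + ?D (0, LF v z)"
      using linear_add[OF has_derivative_linear[OF \<Psi>], of "(x, z)" "(LF v x, 0)" "(0, LF v z)"] by simp
    moreover have "Xd v (\<lambda>z. \<rho> (x \<odot> \<iota> z)) z = ?D (0, LF v z)"
    proof -
      have "((\<lambda>z. (x, z)) has_derivative (\<lambda>h. (0, h))) (at z)" by (auto intro!: derivative_eq_intros)
      from Xd_unique[OF has_derivative_compose[OF this \<Psi>]] show ?thesis by simp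
    qed
    ultimately show ?thesis by linarith
  qed
  have "Xd v (mollify \<rho> u) x = (LINT z|lborel. u z * - Xd v (\<lambda>z. \<rho> (x \<odot> \<iota> z)) z)"
    unfolding Xd_def[of v "mollify \<rho> u"] mollify_C1(2)[OF \<rho> lu] eq ..
  also have "\<dots> = (LINT z|lborel. d z * \<rho> (x \<odot> \<iota> z))"
    using u mollifier_slices(2)[OF \<rho>, of x] by (simp add: weak_Xd_def)
  finally show ?thesis by (simp add: mollify_def)
qed

lemma mollifier_mono: "mollifier e \<rho> \<Longrightarrow> e \<le> d \<Longrightarrow> mollifier d \<rho>"
  unfolding mollifier_def by (auto simp: dist_norm)

lemma mollifier_nonneg: "mollifier e \<rho> \<Longrightarrow> 0 \<le> \<rho> x" by (simp add: mollifier_def)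

lemma mollify_integrand:
  assumes "mollifier e \<rho>" "loc_int f"
  shows "integrable lborel (\<lambda>z. f z * \<rho> (x \<odot> \<iota> z))"
proof -
  obtain K where "compact K" "\<And>z. z \<notin> K \<Longrightarrow> \<rho> (x \<odot> \<iota> z) = 0"
    using test_functionE[OF mollifier_slices(2)[OF assms(1), of x]] by blast
  then show ?thesis
    by (intro loc_int_mult_cont[OF assms(2) test_function_cont[OF mollifier_slices(2)[OF assms(1)]]])
qed

text \<open>Fubini's theorem and the normalization of the kernel in its first variable.\<close>

lemma mollify_L1_le:
  assumes \<rho>: "mollifier e \<rho>" and f: "integrable lborel f"
  shows "(\<integral>\<^sup>+x. ennreal \<bar>mollify \<rho> f x\<bar> \<partial>lborel) \<le> (\<integral>\<^sup>+x. ennreal \<bar>f x\<bar> \<partial>lborel)"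
proof -
  have [measurable]: "f \<in> borel_measurable borel" using f by auto
  have lf: "loc_int f" by (rule loc_int_integrable[OF f])
  have m: "(\<lambda>p. \<rho> (fst p \<odot> \<iota> (snd p))) \<in> borel_measurable (lborel \<Otimes>\<^sub>M lborel)"
    using borel_measurable_continuous_onI[OF Ck_continuous[OF mollifier_Ck[OF \<rho>, of 0]]]
    by (simp add: lborel_prod)
  have [measurable]: "(\<lambda>z. \<rho> (x \<odot> \<iota> z)) \<in> borel_measurable borel" "(\<lambda>x. \<rho> (x \<odot> \<iota> z)) \<in> borel_measurable borel" for x z
    using test_function_borel mollifier_slices[OF \<rho>] by blast+
  have "(\<integral>\<^sup>+x. ennreal \<bar>mollify \<rho> f x\<bar> \<partial>lborel)
      \<le> (\<integral>\<^sup>+x. (\<integral>\<^sup>+z. ennreal \<bar>f z\<bar> * ennreal (\<rho> (x \<odot> \<iota> z)) \<partial>lborel) \<partial>lborel)"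
  proof (rule nn_integral_mono)
    fix x
    show "ennreal \<bar>mollify \<rho> f x\<bar> \<le> (\<integral>\<^sup>+z. ennreal \<bar>f z\<bar> * ennreal (\<rho> (x \<odot> \<iota> z)) \<partial>lborel)"
      using integral_norm_bound_ennreal[OF mollify_integrand[OF \<rho> lf, of x]] mollifier_nonneg[OF \<rho>]
      by (simp add: mollify_def abs_mult ennreal_mult)
  qed
  also have "\<dots> = (\<integral>\<^sup>+z. (\<integral>\<^sup>+x. ennreal \<bar>f z\<bar> * ennreal (\<rho> (x \<odot> \<iota> z)) \<partial>lborel) \<partial>lborel)"
    using lborel_pair.Fubini'[of "\<lambda>x z. ennreal \<bar>f z\<bar> * ennreal (\<rho> (x \<odot> \<iota> z))"] m
    by (simp add: case_prod_beta)
  also have "\<dots> = (\<integral>\<^sup>+z. ennreal \<bar>f z\<bar> \<partial>lborel)"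
  proof (rule nn_integral_cong)
    fix z
    have "(\<integral>\<^sup>+x. ennreal \<bar>f z\<bar> * ennreal (\<rho> (x \<odot> \<iota> z)) \<partial>lborel)
      = ennreal \<bar>f z\<bar> * (\<integral>\<^sup>+x. ennreal (\<rho> (x \<odot> \<iota> z)) \<partial>lborel)"
      by (rule nn_integral_cmult) measurable
    also have "(\<integral>\<^sup>+x. ennreal (\<rho> (x \<odot> \<iota> z)) \<partial>lborel) = 1"
      using nn_integral_eq_integral[OF test_function_integrable[OF mollifier_slices(1)[OF \<rho>, of z]]]
        mollifier_nonneg[OF \<rho>] mollifier_slices(3)[OF \<rho>] by simp
    finally show "(\<integral>\<^sup>+x. ennreal \<bar>f z\<bar> * ennreal (\<rho> (x \<odot> \<iota> z)) \<partial>lborel) = ennreal \<bar>f z\<bar>" by simp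
  qed
  finally show ?thesis .
qed

text \<open>If \<open>y = x \<odot> \<iota> z\<close> then \<open>z = \<iota> y \<odot> x\<close>. The mollification at \<open>x\<close> thus averages \<open>g\<close> over points \<open>\<iota> y \<odot> x\<close>
with \<open>y\<close> close to the identity, and \<open>(y, x) \<mapsto> g (\<iota> y \<odot> x)\<close> is uniformly continuous on compact
sets.\<close>

lemma mollify_uniform:
  assumes g: "continuous_on UNIV g" and K: "compact K" and e: "e > 0"
  shows "\<exists>d>0. \<forall>\<rho>. mollifier d \<rho> \<longrightarrow> (\<forall>x\<in>K. \<bar>mollify \<rho> g x - g x\<bar> \<le> e)"
proof -
  let ?H = "\<lambda>p. g (\<iota> (fst p) \<odot> snd p)"
  have "continuous_on (cball 0 1 \<times> K) ?H"
    by (rule continuous_on_compose2[OF g]) (auto intro!: continuous_intros)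
  then have "uniformly_continuous_on (cball 0 1 \<times> K) ?H"
    using K by (intro compact_uniformly_continuous compact_Times) auto
  then obtain d where d: "d > 0" "\<And>p q. p \<in> cball 0 1 \<times> K \<Longrightarrow> q \<in> cball 0 1 \<times> K \<Longrightarrow> dist q p < d
     \<Longrightarrow> dist (?H q) (?H p) < e" using e unfolding uniformly_continuous_on_def by metis
  show ?thesis
  proof (intro exI[of _ "min d 1"] conjI allI impI ballI)
    show "min d 1 > 0" using d by simp
    fix \<rho> x assume \<rho>: "mollifier (min d 1) \<rho>" and x: "x \<in> K"
    have lg: "loc_int g" by (rule loc_int_continuous[OF g])
    have i: "integrable lborel (\<lambda>z. g z * \<rho> (x \<odot> \<iota> z))" by (rule mollify_integrand[OF \<rho> lg])
    have i1: "integrable lborel (\<lambda>z. \<rho> (x \<odot> \<iota> z))" by (rule test_function_integrable[OF mollifier_slices(2)[OF \<rho>]])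
    have b: "\<bar>(g z - g x) * \<rho> (x \<odot> \<iota> z)\<bar> \<le> e * \<rho> (x \<odot> \<iota> z)" for z
    proof (cases "x \<odot> \<iota> z \<in> ball 0 (min d 1)")
      case True
      let ?y = "x \<odot> \<iota> z"
      have "dist (?H (?y, x)) (?H (0, x)) < e"
        using True x by (intro d(2)) (auto simp: dist_Pair_Pair dist_norm)
      then have "\<bar>g z - g x\<bar> \<le> e" by (simp add: dist_norm g_inv_mult g_assoc)
      then show ?thesis using mollifier_nonneg[OF \<rho>, of ?y] by (simp add: abs_mult mult_right_mono)
    next
      case False
      then show ?thesis using \<rho> by (auto simp: mollifier_def)
    qed
    have "mollify \<rho> g x - g x = (LINT z|lborel. (g z - g x) * \<rho> (x \<odot> \<iota> z))"
      unfolding left_diff_distrib using i i1 mollifier_slices(4)[OF \<rho>, of x] by (simp add: mollify_def)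
    also have "\<bar>\<dots>\<bar> \<le> (LINT z|lborel. e * \<rho> (x \<odot> \<iota> z))"
      by (rule order_trans[OF integral_abs_bound integral_mono])
        (use i i1 b in \<open>auto simp: left_diff_distrib\<close>)
    also have "\<dots> = e" using mollifier_slices(4)[OF \<rho>, of x] by simp
    finally show "\<bar>mollify \<rho> g x - g x\<bar> \<le> e" .
  qed
qed

lemma mollify_measurable:
  assumes "mollifier e \<rho>" "loc_int f"
  shows "mollify \<rho> f \<in> borel_measurable borel" "loc_int (mollify \<rho> f)"
  using Ck_continuous[OF mollify_C1(1)[OF assms]] borel_measurable_continuous_onI loc_int_continuous by blast+

lemma loc_int_diff: "loc_int f \<Longrightarrow> loc_int g \<Longrightarrow> loc_int (\<lambda>x. f x - g x)"
  unfolding loc_int_def by (auto simp: right_diff_distrib)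

lemma loc_int_abs_indicator:
  "loc_int f \<Longrightarrow> compact K \<Longrightarrow> integrable lborel (\<lambda>x. indicator K x * \<bar>f x\<bar>)"
  unfolding loc_int_def using integrable_abs[of lborel "\<lambda>x. indicator K x * f x"] by (auto simp: abs_mult)

text \<open>The mollification on \<open>K\<close> only sees \<open>f\<close> on a compact neighbourhood of \<open>K\<close>. The restriction of \<open>f\<close> to it is
approximated in \<open>L^1\<close> by a continuous function, for which convergence is uniform on \<open>K\<close>, and
\<open>mollify_L1_le\<close> controls the mollification of the difference.\<close>

lemma mollify_tendsto_L1:
  assumes f: "loc_int f" and K: "compact K" and e: "e > 0"
  shows "\<exists>d>0. \<forall>\<rho>. mollifier d \<rho> \<longrightarrow> (LINT x|lborel. indicator K x * \<bar>mollify \<rho> f x - f x\<bar>) \<le> e"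
proof -
  let ?K' = "(\<lambda>p. \<iota> (fst p) \<odot> snd p) ` (cball 0 1 \<times> K)"
  have K': "compact ?K'" using K
    by (intro compact_continuous_image compact_Times) (auto intro!: continuous_intros)
  have sub: "K \<subseteq> ?K'"
  proof
    fix x assume "x \<in> K" then show "x \<in> ?K'" by (intro image_eqI[where x="(0, x)"]) auto
  qed
  define f' where "f' x = indicator ?K' x * f x" for x
  have f': "integrable lborel f'" using f K' unfolding loc_int_def f'_def[abs_def] by blast
  obtain g where g: "continuous_on UNIV g" "integrable lborel g" "(LINT x|lborel. \<bar>f' x - g x\<bar>) < e / 3"
    using continuous_approx_L1[OF f'] e by (meson divide_pos_pos zero_less_numeral)
  define m where "m = measure lborel K"
  have mfin: "emeasure lborel K < \<infinity>" using K emeasure_compact_finite by blast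
  have "e / (3 * (m + 1)) > 0" using e by (simp add: m_def add_nonneg_pos)
  then obtain d where d: "d > 0" "\<And>\<rho> x. mollifier d \<rho> \<Longrightarrow> x \<in> K \<Longrightarrow> \<bar>mollify \<rho> g x - g x\<bar> \<le> e / (3 * (m + 1))"
    using mollify_uniform[OF g(1) K] by metis
  show ?thesis
  proof (intro exI[of _ "min d 1"] conjI allI impI)
    show "min d 1 > 0" using d by simp
    fix \<rho> assume \<rho>: "mollifier (min d 1) \<rho>"
    then have \<rho>d: "mollifier d \<rho>" by (rule mollifier_mono) simp
    have lg: "loc_int g" "loc_int f'" "loc_int (\<lambda>x. f' x - g x)"
      using g f' loc_int_integrable by auto
    have eq: "mollify \<rho> f x = mollify \<rho> f' x" "f x = f' x" if "x \<in> K" for x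
    proof -
      have "f z * \<rho> (x \<odot> \<iota> z) = f' z * \<rho> (x \<odot> \<iota> z)" for z
      proof (cases "x \<odot> \<iota> z \<in> ball 0 (min d 1)")
        case True
        have "z \<in> ?K'" using True that by (intro image_eqI[where x="(x \<odot> \<iota> z, x)"]) (auto simp: g_inv_mult g_assoc)
        then show ?thesis by (simp add: f'_def)
      next
        case False
        then show ?thesis using \<rho> by (auto simp: mollifier_def)
      qed
      then show "mollify \<rho> f x = mollify \<rho> f' x" by (simp only: mollify_def)
      have "x \<in> ?K'" using that sub by (rule subsetD[rotated])
      then show "f x = f' x" by (simp only: f'_def indicator_simps mult_1_left)
    qed
    have lin: "mollify \<rho> f' x - mollify \<rho> g x = mollify \<rho> (\<lambda>x. f' x - g x) x" for x
      using mollify_integrand[OF \<rho> lg(1), of x] mollify_integrand[OF \<rho> lg(2), of x]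
      by (simp add: mollify_def left_diff_distrib)
    have C1: "(\<integral>\<^sup>+x. ennreal \<bar>mollify \<rho> (\<lambda>x. f' x - g x) x\<bar> \<partial>lborel) \<le> ennreal (LINT x|lborel. \<bar>f' x - g x\<bar>)"
      using mollify_L1_le[OF \<rho> Bochner_Integration.integrable_diff[OF f' g(2)]]
        nn_integral_eq_integral[of lborel "\<lambda>x. \<bar>f' x - g x\<bar>"] f' g(2) by simp
    have im: "integrable lborel (mollify \<rho> (\<lambda>x. f' x - g x))"
      using C1 mollify_measurable(1)[OF \<rho> lg(3)] by (intro integrableI_bounded) (auto intro: le_less_trans)
    have C2: "(LINT x|lborel. \<bar>mollify \<rho> (\<lambda>x. f' x - g x) x\<bar>) \<le> (LINT x|lborel. \<bar>f' x - g x\<bar>)"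
      using C1 nn_integral_eq_integral[of lborel "\<lambda>x. \<bar>mollify \<rho> (\<lambda>x. f' x - g x) x\<bar>"] im
      by (simp add: integral_nonneg_AE)
    have le: "indicator K x * \<bar>mollify \<rho> f x - f x\<bar> \<le>
        \<bar>mollify \<rho> (\<lambda>x. f' x - g x) x\<bar> + e / (3 * (m + 1)) * indicator K x + \<bar>f' x - g x\<bar>" for x
    proof (cases "x \<in> K")
      case True
      then show ?thesis using d(2)[OF \<rho>d True] lin[of x] by (simp add: eq)
    qed simp
    have iK: "integrable lborel (\<lambda>x. e / (3 * (m + 1)) * indicat_real K x)"
      using mfin K borel_compact by (intro integrable_mult_right integrable_real_indicator) auto
    have "(LINT x|lborel. indicator K x * \<bar>mollify \<rho> f x - f x\<bar>) \<le>
      (LINT x|lborel. \<bar>mollify \<rho> (\<lambda>x. f' x - g x) x\<bar> + e / (3 * (m + 1)) * indicator K x + \<bar>f' x - g x\<bar>)"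
      using loc_int_abs_indicator[OF loc_int_diff[OF mollify_measurable(2)[OF \<rho> f] f] K] im iK f' g(2) le
      by (intro integral_mono) auto
    also have "\<dots> = (LINT x|lborel. \<bar>mollify \<rho> (\<lambda>x. f' x - g x) x\<bar>) + e / (3 * (m + 1)) * m + (LINT x|lborel. \<bar>f' x - g x\<bar>)"
      using im iK f' g(2) by (simp add: m_def)
    also have "\<dots> \<le> e / 3 + e / 3 + e / 3"
    proof -
      have "m \<ge> 0" by (simp add: m_def)
      then have "e / (3 * (m + 1)) * m \<le> e / 3" using e by (simp add: field_simps)
      then show ?thesis using C2 g(3) by linarith
    qed
    finally show "(LINT x|lborel. indicator K x * \<bar>mollify \<rho> f x - f x\<bar>) \<le> e" by simp
  qed
qed

lemma mollifier_sequence: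
  "\<exists>\<rho>. (\<forall>n. mollifier (1 / real (Suc n)) (\<rho> n)) \<and>
    (\<forall>f K. loc_int f \<longrightarrow> compact K \<longrightarrow>
       (\<lambda>n. LINT x|lborel. indicator K x * \<bar>mollify (\<rho> n) f x - f x\<bar>) \<longlonglongrightarrow> 0)"
proof -
  have "\<forall>n. \<exists>\<rho>. mollifier (1 / real (Suc n)) \<rho>" using mollifier_exists by simp
  then obtain \<rho> where \<rho>: "\<And>n. mollifier (1 / real (Suc n)) (\<rho> n)" by metis
  moreover have "(\<lambda>n. LINT x|lborel. indicator K x * \<bar>mollify (\<rho> n) f x - f x\<bar>) \<longlonglongrightarrow> 0"
    if f: "loc_int f" "compact K" for f K
  proof (rule LIMSEQ_I)
    fix e :: real assume e: "e > 0"
    obtain d where d: "d > 0" "\<And>\<rho>. mollifier d \<rho> \<Longrightarrow> (LINT x|lborel. indicator K x * \<bar>mollify \<rho> f x - f x\<bar>) \<le> e / 2"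
      using mollify_tendsto_L1[OF f, of "e/2"] e by (metis half_gt_zero)
    obtain n0 where n0: "1 / real (Suc n0) < d" using d(1) nat_approx_posE by blast
    have "\<bar>LINT x|lborel. indicator K x * \<bar>mollify (\<rho> n) f x - f x\<bar>\<bar> < e" if "n \<ge> n0" for n
    proof -
      have "1 / real (Suc n) \<le> 1 / real (Suc n0)" using that by (simp add: frac_le)
      then have "mollifier d (\<rho> n)" using n0 by (intro mollifier_mono[OF \<rho>]) linarith
      from d(2)[OF this] have "(LINT x|lborel. indicator K x * \<bar>mollify (\<rho> n) f x - f x\<bar>) \<le> e / 2" .
      moreover have "(LINT x|lborel. indicator K x * \<bar>mollify (\<rho> n) f x - f x\<bar>) \<ge> 0" by simp
      ultimately show ?thesis using e by linarith
    qed
    then show "\<exists>n0. \<forall>n\<ge>n0. norm ((LINT x|lborel. indicator K x * \<bar>mollify (\<rho> n) f x - f x\<bar>) - 0) < e"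
      by auto
  qed
  ultimately show ?thesis by blast
qed

section \<open>The weak chain rule\<close>

text \<open>For the mollifications \<open>u\<^sub>n\<close> of \<open>u\<close>, with derivatives \<open>d\<^sub>n\<close>, this is integration by parts. Along a
subsequence \<open>u\<^sub>n\<close> converges almost everywhere on the support of \<open>F\<close>, so \<open>h (u\<^sub>n)\<close> and \<open>k (u\<^sub>n)\<close> converge
boundedly. Together with the convergence of \<open>d\<^sub>n\<close> to \<open>d\<close> in \<open>L^1\<close> this allows the passage to the limit in
both integrals.\<close>

lemma weak_chain_rule:
  assumes u: "weak_Xd v u d" and F: "test_function F"
    and h: "\<And>y. (h has_real_derivative k y) (at y)" and k: "continuous_on UNIV k"
    and hM: "\<And>y. \<bar>h y\<bar> \<le> M" and kM: "\<And>y. \<bar>k y\<bar> \<le> M"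
  shows "(LINT x|lborel. h (u x) * Xd v F x) = - (LINT x|lborel. k (u x) * d x * F x)"
proof -
  obtain \<rho> where \<rho>: "\<And>n. mollifier (1 / real (Suc n)) (\<rho> n)"
    and lim: "\<And>f K. loc_int f \<Longrightarrow> compact K \<Longrightarrow>
       (\<lambda>n. LINT x|lborel. indicator K x * \<bar>mollify (\<rho> n) f x - f x\<bar>) \<longlonglongrightarrow> 0"
    using mollifier_sequence by blast
  obtain K where K: "compact K" "\<And>x. x \<notin> K \<Longrightarrow> F x = 0" using test_functionE[OF F] by blast
  have lu: "loc_int u" and ld: "loc_int d" using u by (auto simp: weak_Xd_def)
  have [measurable]: "u \<in> borel_measurable borel" "d \<in> borel_measurable borel"
    using lu ld by (auto simp: loc_int_def)
  have hc: "continuous_on UNIV h" using DERIV_isCont[OF h] by (auto simp: continuous_on_eq_continuous_at)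
  have [measurable]: "h \<in> borel_measurable borel" "k \<in> borel_measurable borel" "F \<in> borel_measurable borel"
    "Xd v F \<in> borel_measurable borel"
    using hc k test_function_cont[OF F] C1_Xd[OF test_function_Ck[OF F]] by (auto intro: borel_measurable_continuous_onI)
  define un where "un n = mollify (\<rho> n) u" for n
  define dn where "dn n = mollify (\<rho> n) d" for n
  have un1: "Ck 1 (un n)" for n unfolding un_def by (rule mollify_C1(1)[OF \<rho> lu])
  have unX: "Xd v (un n) x = dn n x" for n x unfolding un_def dn_def by (rule Xd_mollify[OF \<rho> u])
  have ldn: "loc_int (dn n)" "loc_int (un n)" for n
    unfolding dn_def un_def using mollify_measurable[OF \<rho>] ld lu by auto
  have [measurable]: "un n \<in> borel_measurable borel" "dn n \<in> borel_measurable borel" for n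
    using ldn by (auto simp: loc_int_def)
  have h1: "Ck 1 h" unfolding One_nat_def
  proof (rule Ck_SucI)
    show "(h has_derivative (\<lambda>t. k y * t)) (at y)" for y using h[of y] unfolding has_field_derivative_def .
    show "Ck 0 (\<lambda>y. k y * b)" for b using k by (auto intro: continuous_intros)
  qed
  have hu1: "Ck 1 (\<lambda>x. h (un n x))" for n by (rule Ck_compose[OF h1 un1])
  have Xhu: "Xd v (\<lambda>x. h (un n x)) x = k (un n x) * dn n x" for n x
  proof -
    have "((\<lambda>x. h (un n x)) has_derivative (\<lambda>t. k (un n x) * frechet_derivative (un n) (at x) t)) (at x)"
      using has_derivative_compose[OF Ck_1_has_derivative[OF un1]] h[of "un n x"]
      unfolding has_field_derivative_def by blast
    from Xd_unique[OF this, of v] show ?thesis using unX[of n x] by (simp add: Xd_def)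
  qed
  have parts: "(LINT x|lborel. h (un n x) * Xd v F x) = - (LINT x|lborel. k (un n x) * dn n x * F x)" for n
    using integral_Xd_by_parts[OF hu1 test_function_C1_compact[OF F]] by (simp add: Xhu)
  have XF0: "Xd v F x = 0" if "x \<notin> K" for x
    using Xd_outside[OF compact_imp_closed[OF K(1)] K(2) that] .
  obtain C where C: "C \<ge> 0" "\<And>x. \<bar>F x\<bar> \<le> C"
    using compact_supp_bounded[OF test_function_cont[OF F] K] by blast
  have M0: "M \<ge> 0" using hM[of 0] by linarith
  have iu: "integrable lborel (\<lambda>x. indicator K x * (un n x - u x))" for n
    using loc_int_diff[OF ldn(2) lu] K(1) by (auto simp: loc_int_def)
  have "(\<lambda>n. LINT x|lborel. norm (indicator K x * (un n x - u x))) \<longlonglongrightarrow> 0"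
    using lim[OF lu K(1)] unfolding un_def by (simp add: abs_mult)
  from tendsto_L1_AE_subseq[OF iu this] obtain r where r: "strict_mono r"
    and ae: "AE x in lborel. (\<lambda>n. indicator K x * (un (r n) x - u x)) \<longlonglongrightarrow> 0" by blast
  have conv: "(\<lambda>n. un (r n) x) \<longlonglongrightarrow> u x" if "x \<in> K" "(\<lambda>n. indicator K x * (un (r n) x - u x)) \<longlonglongrightarrow> 0" for x
    using that by (simp add: LIM_zero_iff)
  have A: "(\<lambda>n. LINT x|lborel. h (un (r n) x) * Xd v F x) \<longlonglongrightarrow> (LINT x|lborel. h (u x) * Xd v F x)"
  proof (rule integral_dominated_convergence)
    show "integrable lborel (\<lambda>x. M * \<bar>Xd v F x\<bar>)"
      using Xd_integrable[OF test_function_C1_compact[OF F]] by auto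
    show "AE x in lborel. norm (h (un (r n) x) * Xd v F x) \<le> M * \<bar>Xd v F x\<bar>" for n
      using hM by (auto simp: abs_mult intro!: mult_right_mono)
    show "AE x in lborel. (\<lambda>n. h (un (r n) x) * Xd v F x) \<longlonglongrightarrow> h (u x) * Xd v F x"
      using ae
    proof eventually_elim
      case (elim x)
      show ?case
      proof (cases "x \<in> K")
        case True
        have "(\<lambda>n. h (un (r n) x)) \<longlonglongrightarrow> h (u x)"
          by (rule continuous_on_tendsto_compose[OF hc conv[OF True elim]]) auto
        then show ?thesis by (intro tendsto_intros)
      qed (simp add: XF0)
    qed
  qed measurable
  have idF: "integrable lborel (\<lambda>x. d x * F x)"
    by (rule loc_int_mult_cont[OF ld test_function_cont[OF F] K])
  \<comment> \<open>The limit of the right-hand side is split: first with d instead of its mollification, by dominated convergence, then (B1) the difference, by convergence in the mean.\<close>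
  have B2: "(\<lambda>n. LINT x|lborel. k (un (r n) x) * (d x * F x)) \<longlonglongrightarrow> (LINT x|lborel. k (u x) * (d x * F x))"
  proof (rule integral_dominated_convergence)
    show "integrable lborel (\<lambda>x. M * \<bar>d x * F x\<bar>)" using idF by auto
    show "AE x in lborel. norm (k (un (r n) x) * (d x * F x)) \<le> M * \<bar>d x * F x\<bar>" for n
      using kM by (auto simp: abs_mult[of "k _"] intro!: mult_right_mono)
    show "AE x in lborel. (\<lambda>n. k (un (r n) x) * (d x * F x)) \<longlonglongrightarrow> k (u x) * (d x * F x)"
      using ae
    proof eventually_elim
      case (elim x)
      show ?case
      proof (cases "x \<in> K")
        case True
        have "(\<lambda>n. k (un (r n) x)) \<longlonglongrightarrow> k (u x)"
          by (rule continuous_on_tendsto_compose[OF k conv[OF True elim]]) auto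
        then show ?thesis by (intro tendsto_intros)
      qed (simp add: K)
    qed
  qed measurable
  have ikd: "integrable lborel (\<lambda>x. k (un n x) * (dn n x * F x))" "integrable lborel (\<lambda>x. k (un n x) * (d x * F x))" for n
  proof -
    have ik: "integrable lborel (\<lambda>x. k (un n x) * g x)" if g: "integrable lborel g" for g
    proof (rule Bochner_Integration.integrable_bound)
      show "integrable lborel (\<lambda>x. M * g x)" using g by simp
      show "(\<lambda>x. k (un n x) * g x) \<in> borel_measurable lborel" using g by measurable
      show "AE x in lborel. norm (k (un n x) * g x) \<le> norm (M * g x)"
        using kM M0 by (auto simp: abs_mult intro!: mult_right_mono)
    qed
    show "integrable lborel (\<lambda>x. k (un n x) * (dn n x * F x))"
      by (rule ik[OF loc_int_mult_cont[OF ldn(1) test_function_cont[OF F] K]])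
    show "integrable lborel (\<lambda>x. k (un n x) * (d x * F x))" by (rule ik[OF idF])
  qed
  have B1: "(\<lambda>n. LINT x|lborel. k (un (r n) x) * ((dn (r n) x - d x) * F x)) \<longlonglongrightarrow> 0"
  proof (rule Lim_null_comparison)
    have "norm (LINT x|lborel. k (un n x) * ((dn n x - d x) * F x))
      \<le> M * C * (LINT x|lborel. indicator K x * \<bar>dn n x - d x\<bar>)" for n
    proof -
      have "\<bar>k (un n x) * ((dn n x - d x) * F x)\<bar> \<le> M * C * (indicator K x * \<bar>dn n x - d x\<bar>)" for x
      proof (cases "x \<in> K")
        case True
        have "\<bar>k (un n x)\<bar> * (\<bar>F x\<bar> * \<bar>dn n x - d x\<bar>) \<le> M * (C * \<bar>dn n x - d x\<bar>)"
          using kM C M0 by (intro mult_mono mult_right_mono) auto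
        then show ?thesis using True by (simp add: abs_mult mult_ac)
      qed (simp add: K)
      then have "norm (LINT x|lborel. k (un n x) * ((dn n x - d x) * F x))
         \<le> (LINT x|lborel. M * C * (indicator K x * \<bar>dn n x - d x\<bar>))"
        unfolding real_norm_def
        using loc_int_abs_indicator[OF loc_int_diff[OF ldn(1) ld] K(1)] ikd
        by (intro order_trans[OF integral_abs_bound] integral_mono)
          (auto simp: left_diff_distrib right_diff_distrib)
      then show ?thesis by simp
    qed
    then show "\<forall>\<^sub>F n in sequentially. norm (LINT x|lborel. k (un (r n) x) * ((dn (r n) x - d x) * F x))
      \<le> M * C * (LINT x|lborel. indicator K x * \<bar>dn (r n) x - d x\<bar>)" by simp
    have "(\<lambda>n. LINT x|lborel. indicator K x * \<bar>dn (r n) x - d x\<bar>) \<longlonglongrightarrow> 0"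
      using LIMSEQ_subseq_LIMSEQ[OF lim[OF ld K(1)] r] by (simp add: o_def dn_def)
    then show "(\<lambda>n. M * C * (LINT x|lborel. indicator K x * \<bar>dn (r n) x - d x\<bar>)) \<longlonglongrightarrow> 0"
      by (rule tendsto_mult_right_zero)
  qed
  have "(LINT x|lborel. h (un (r n) x) * Xd v F x) = - ((LINT x|lborel. k (un (r n) x) * ((dn (r n) x - d x) * F x))
      + (LINT x|lborel. k (un (r n) x) * (d x * F x)))" for n
    unfolding parts using ikd[of "r n"]
    by (simp add: left_diff_distrib right_diff_distrib mult.assoc)
  then have "(\<lambda>n. LINT x|lborel. h (un (r n) x) * Xd v F x) \<longlonglongrightarrow> - (0 + (LINT x|lborel. k (u x) * (d x * F x)))"
    by (simp only:) (intro tendsto_intros B1 B2)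
  from LIMSEQ_unique[OF A this] show ?thesis by (simp add: mult.assoc)
qed

section \<open>Commutators\<close>

lemma Xd_test_function: "test_function \<phi> \<Longrightarrow> test_function (Xd v \<phi>)"
proof -
  assume \<phi>: "test_function \<phi>"
  then obtain K where K: "compact K" "\<And>x. x \<notin> K \<Longrightarrow> \<phi> x = 0" by (metis test_functionE)
  show ?thesis
    by (rule test_functionI[OF _ K(1) Xd_outside[OF compact_imp_closed[OF K(1)] K(2)]])
      (unfold smooth_def, intro allI Ck_Xd test_function_Ck[OF \<phi>])
qed

lemma Xd_bracket_0:
  assumes \<phi>: "Ck 2 \<phi>"
  shows "Xd v (Xd w \<phi>) 0 - Xd w (Xd v \<phi>) 0 = Xd (lie_bracket G v w) \<phi> 0"
proof -
  have lin: "linear (frechet_derivative \<phi> (at 0))"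
    using has_derivative_linear[OF Ck_1_has_derivative[OF Ck_le[OF \<phi>, of 1]]] by simp
  have "Xd v (Xd w \<phi>) 0 = frechet_derivative (\<lambda>y. frechet_derivative \<phi> (at y) w) (at 0) v
      + frechet_derivative \<phi> (at 0) (frechet_derivative (LF w) (at 0) v)" for v w
    unfolding Xd_def[of v] LF_0 unfolding Xd_def[abs_def]
    using frechet_derivative_along_field[OF \<phi> Ck_LF[of 1 w], of 0 v] by simp
  then have "Xd v (Xd w \<phi>) 0 - Xd w (Xd v \<phi>) 0 = frechet_derivative \<phi> (at 0) (frechet_derivative (LF w) (at 0) v)
     - frechet_derivative \<phi> (at 0) (frechet_derivative (LF v) (at 0) w)"
    using second_derivative_symmetric[OF \<phi>, of w 0 v] by simp
  also have "\<dots> = Xd (lie_bracket G v w) \<phi> 0"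
    by (simp add: Xd_def lie_bracket_def vf_bracket_def linear_diff[OF lin])
  finally show ?thesis .
qed

text \<open>Left translation by \<open>g\<close> commutes with the fields and moves the identity of \<open>Xd_bracket_0\<close> to the point \<open>g\<close>.\<close>

lemma Xd_bracket:
  assumes \<phi>: "test_function \<phi>"
  shows "Xd v (Xd w \<phi>) g - Xd w (Xd v \<phi>) g = Xd (lie_bracket G v w) \<phi> g"
proof -
  let ?\<psi> = "\<lambda>x. \<phi> (g \<odot> x)"
  have l: "Xd v (\<lambda>x. f (g \<odot> x)) = (\<lambda>x. Xd v f (g \<odot> x))" if "test_function f" for v f
    using Xd_left[OF test_function_diff[OF that]] by auto
  have "Ck 2 ?\<psi>" by (rule Ck_compose[OF test_function_Ck[OF \<phi>] Ck_left])
  from Xd_bracket_0[OF this, of v w]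
  have "Xd v (Xd w \<phi>) (g \<odot> 0) - Xd w (Xd v \<phi>) (g \<odot> 0) = Xd (lie_bracket G v w) \<phi> (g \<odot> 0)"
    unfolding l[OF \<phi>] l[OF Xd_test_function[OF \<phi>]] .
  then show ?thesis by simp
qed

section \<open>Volume of gauge balls\<close>

definition \<sigma>0 :: real where "\<sigma>0 = measure \<sigma> {x. N x = 1}"

lemma space_sigma: "space \<sigma> = {x. N x = 1}" and finite_sigma: "finite_measure \<sigma>"
  using polar sets_eq_imp_space_eq[of \<sigma> "restrict_space borel {x. N x = 1}"]
  by (auto simp: polar_measure_def space_restrict_space)

lemma N_dil_sphere: "s > 0 \<Longrightarrow> y \<in> space \<sigma> \<Longrightarrow> N (dil G s y) = s"
  by (simp add: N_dil space_sigma)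

lemma gball_borel [measurable]: "gball N r \<in> sets borel"
  unfolding gball_def by measurable

lemma gball_lebesgue: "gball N r \<in> sets lebesgue"
  by (rule sets_completionI_sets) (simp add: gball_borel)

lemma power_integral: "r \<ge> 0 \<Longrightarrow> (LINT s|lborel. indicator {0..r} s * s ^ (Q - 1)) = r ^ Q / Q"
  using integral_power[of 0 r "Q - 1"] Q_pos by (simp add: mult.commute)

lemma power_integrable: "integrable lborel (\<lambda>s::real. indicator {0..r} s * s ^ (Q - 1))"
proof -
  have "continuous_on {0..r} (\<lambda>s. s ^ (Q - 1))" by (intro continuous_intros)
  from borel_integrable_compact[OF compact_Icc this] show ?thesis by simp
qed

text \<open>The polar coordinate formula speaks about integrable functions, and it is not known in advance that
balls have finite volume. On compact sets it yields a bound independent of the set, from which finiteness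
follows in \<open>gball_volume\<close>.\<close>

lemma measure_compact_gball_le:
  assumes K: "compact K" and r: "r \<ge> 0"
  shows "measure lborel (K \<inter> gball N r) \<le> \<sigma>0 * (r ^ Q / Q)"
proof -
  interpret finite_measure \<sigma> by (rule finite_sigma)
  let ?A = "K \<inter> gball N r"
  have A: "?A \<in> sets borel" by (intro sets.Int borel_compact K gball_borel)
  have fin: "emeasure lborel ?A < \<infinity>"
    using emeasure_mono[of ?A K lborel] emeasure_compact_finite[OF K] K borel_compact
    by (auto intro: le_less_trans)
  let ?I = "\<lambda>s. LINT y|\<sigma>. indicat_real ?A (dil G s y)"
  have \<sigma>0: "\<sigma>0 = measure \<sigma> (space \<sigma>)" by (simp add: \<sigma>0_def space_sigma)
  have I0: "0 \<le> ?I s" for s by simp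
  \<comment> \<open>Functions that are not integrable have integral 0 by convention, so the bound holds for them as well.\<close>
  have I1: "?I s \<le> \<sigma>0" for s
  proof (cases "integrable \<sigma> (\<lambda>y. indicat_real ?A (dil G s y))")
    case True
    have "?I s \<le> (LINT y|\<sigma>. 1)" by (rule integral_mono[OF True]) (auto simp: indicator_def)
    then show ?thesis by (simp add: \<sigma>0)
  next
    case False
    then show ?thesis by (simp add: not_integrable_integral_eq \<sigma>0)
  qed
  have I2: "?I s = 0" if "s > 0" "\<not> s < r" for s
  proof -
    have "?I s = (LINT y|\<sigma>. 0)"
      by (rule Bochner_Integration.integral_cong) (use that N_dil_sphere in \<open>auto simp: gball_def indicator_def\<close>)
    then show ?thesis by simp
  qed
  have "measure lborel ?A = (LINT x|lborel. indicat_real ?A x)" using A by simp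
  also have "\<dots> = (LINT s|lborel. indicator {0<..} s *\<^sub>R (?I s * s ^ (Q - 1)))"
    using polar_formula[of "indicat_real ?A"] A fin
    by (simp add: set_lebesgue_integral_def)
  also have "\<dots> \<le> (LINT s|lborel. \<sigma>0 * (indicator {0..r} s * s ^ (Q - 1)))"
  proof (cases "integrable lborel (\<lambda>s. indicator {0<..} s *\<^sub>R (?I s * s ^ (Q - 1)))")
    case True
    show ?thesis
    proof (rule integral_mono[OF True])
      show "integrable lborel (\<lambda>s. \<sigma>0 * (indicator {0..r} s * s ^ (Q - 1)))" using power_integrable by simp
      show "indicator {0<..} s *\<^sub>R (?I s * s ^ (Q - 1)) \<le> \<sigma>0 * (indicator {0..r} s * s ^ (Q - 1))" for s
        using I1[of s] I2[of s] by (auto simp: indicator_def intro!: mult_right_mono) (simp add: \<sigma>0_def)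
    qed
  next
    case False
    then show ?thesis using power_integral[OF r] r by (simp add: not_integrable_integral_eq \<sigma>0)
  qed
  also have "\<dots> = \<sigma>0 * (r ^ Q / Q)" using power_integral[OF r] by simp
  finally show ?thesis .
qed

lemma gball_volume:
  assumes r: "r \<ge> 0"
  shows "emeasure lborel (gball N r) = ennreal (\<sigma>0 * (r ^ Q / Q))"
proof -
  interpret finite_measure \<sigma> by (rule finite_sigma)
  let ?B = "gball N r"
  have \<sigma>0: "\<sigma>0 = measure \<sigma> (space \<sigma>)" by (simp add: \<sigma>0_def space_sigma)
  \<comment> \<open>The ball is exhausted by its intersections with Euclidean balls.\<close>
  have "emeasure lborel ?B \<le> ennreal (\<sigma>0 * (r ^ Q / Q))"
  proof -
    have "(SUP n::nat. emeasure lborel (cball 0 (real n) \<inter> ?B)) = emeasure lborel (\<Union>n::nat. cball 0 (real n) \<inter> ?B)"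
      by (rule SUP_emeasure_incseq) (auto simp: incseq_def intro: borel_closed)
    also have "(\<Union>n::nat. cball 0 (real n) \<inter> ?B) = ?B"
      using real_arch_simple by (auto simp: dist_norm)
    finally have "emeasure lborel ?B = (SUP n::nat. emeasure lborel (cball 0 (real n) \<inter> ?B))" by simp
    also have "\<dots> \<le> ennreal (\<sigma>0 * (r ^ Q / Q))"
    proof (rule SUP_least)
      fix n :: nat
      have "emeasure lborel (cball 0 (real n) \<inter> ?B) \<le> emeasure lborel (cball (0::'a) (real n))"
        by (rule emeasure_mono) auto
      also have "\<dots> < \<infinity>" by (rule emeasure_compact_finite) (rule compact_cball)
      finally have "emeasure lborel (cball 0 (real n) \<inter> ?B) = ennreal (measure lborel (cball 0 (real n) \<inter> ?B))"
        by (intro emeasure_eq_ennreal_measure) auto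
      also have "\<dots> \<le> ennreal (\<sigma>0 * (r ^ Q / Q))"
        by (intro ennreal_leI measure_compact_gball_le r) auto
      finally show "emeasure lborel (cball 0 (real n) \<inter> ?B) \<le> ennreal (\<sigma>0 * (r ^ Q / Q))" .
    qed
    finally show ?thesis .
  qed
  then have fin: "emeasure lborel ?B < \<infinity>" by (rule le_less_trans) simp
  then have i: "integrable lborel (indicat_real ?B)" by (intro integrable_real_indicator) auto
  let ?I = "\<lambda>s. LINT y|\<sigma>. indicat_real ?B (dil G s y)"
  have I: "?I s = \<sigma>0 * indicator {..<r} s" if "s > 0" for s
  proof -
    have "?I s = (LINT y|\<sigma>. indicator {..<r} s)"
      by (rule Bochner_Integration.integral_cong) (use that N_dil_sphere in \<open>auto simp: gball_def indicator_def\<close>)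
    then show ?thesis by (simp add: \<sigma>0)
  qed
  have "measure lborel ?B = (LINT x|lborel. indicat_real ?B x)" by simp
  also have "\<dots> = (LINT s|lborel. indicator {0<..} s *\<^sub>R (?I s * s ^ (Q - 1)))"
    using polar_formula[OF i] by (simp add: set_lebesgue_integral_def)
  also have "\<dots> = (LINT s|lborel. indicator {0<..} s *\<^sub>R (\<sigma>0 * indicator {..<r} s * s ^ (Q - 1)))"
  proof -
    have "indicator {0<..} s *\<^sub>R (?I s * s ^ (Q - 1)) = indicator {0<..} s *\<^sub>R (\<sigma>0 * indicator {..<r} s * s ^ (Q - 1))" for s
      using I[of s] by (cases "s > 0") simp_all
    then show ?thesis by (simp only:)
  qed
  also have "\<dots> = (LINT s|lborel. \<sigma>0 * (indicator {0..r} s * s ^ (Q - 1)))"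
  proof (rule integral_cong_AE)
    have "AE s in lborel. s \<noteq> (0::real) \<and> s \<noteq> r" using AE_lborel_singleton[of 0] AE_lborel_singleton[of r] by eventually_elim auto
    then show "AE s in lborel. indicator {0<..} s *\<^sub>R (\<sigma>0 * indicator {..<r} s * s ^ (Q - 1)) = \<sigma>0 * (indicator {0..r} s * s ^ (Q - 1))"
      by eventually_elim (auto simp: indicator_def)
  qed auto
  also have "\<dots> = \<sigma>0 * (r ^ Q / Q)" using power_integral[OF r] by simp
  finally show ?thesis using fin emeasure_eq_ennreal_measure[of lborel ?B] by (simp add: less_top)
qed

text \<open>The unit ball is a nonempty open set.\<close>

lemma sigma0_pos: "\<sigma>0 > 0"
proof -
  have "open (gball N 1)" unfolding gball_def using continuous_N by (intro open_Collect_less) (auto intro: continuous_intros)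
  moreover have "0 \<in> gball N 1" using N_0[of 0] by (simp add: gball_def)
  ultimately have "\<not> negligible (gball N 1)" using open_not_negligible by blast
  then have "gball N 1 \<notin> null_sets lborel"
    using null_sets_completionI negligible_iff_null_sets by blast
  then have "emeasure lborel (gball N 1) \<noteq> 0" using null_setsI[of lborel "gball N 1"] by auto
  then have "\<sigma>0 * (1 / Q) > 0" using gball_volume[of 1] by (simp add: ennreal_eq_0_iff not_le)
  then show ?thesis using Q_pos by (simp add: zero_less_mult_iff zero_less_divide_iff)
qed

section \<open>Borel representatives\<close>

lemma locally_integrable_iff_borel:
  assumes "f \<in> borel_measurable borel"
  shows "locally_integrable f \<longleftrightarrow> loc_int f"
proof -
  have "set_integrable lebesgue K f \<longleftrightarrow> integrable lborel (\<lambda>x. indicator K x * f x)" if "compact K" for K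
  proof -
    have "(\<lambda>x. indicator K x *\<^sub>R f x) \<in> borel_measurable lborel"
      using assms borel_compact[OF that] by (intro borel_measurable_scaleR borel_measurable_indicator) auto
    from integrable_completion[OF this] show ?thesis by (simp add: set_integrable_def)
  qed
  moreover have "f \<in> borel_measurable lebesgue" using assms by (auto intro: measurable_completion)
  ultimately show ?thesis unfolding locally_integrable_def loc_int_def using assms by blast
qed

lemma locally_integrable_borel_version:
  fixes f :: "'a \<Rightarrow> real"
  assumes "locally_integrable f"
  obtains g where "loc_int g" "AE x in lebesgue. f x = g x"
proof -
  obtain g where g: "g \<in> borel_measurable borel" "AE x in lborel. f x = g x"
    using completion_ex_borel_measurable_real[of f lborel] assms by (auto simp: locally_integrable_def)
  have ae: "AE x in lebesgue. f x = g x" by (rule AE_completion[OF g(2)])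
  have "locally_integrable g" unfolding locally_integrable_def
  proof (intro conjI allI impI)
    show gm: "g \<in> borel_measurable lebesgue" using g(1) by (auto intro: measurable_completion)
    fix K :: "'a set" assume K: "compact K"
    then have "set_integrable lebesgue K f" using assms by (auto simp: locally_integrable_def)
    then show "set_integrable lebesgue K g" unfolding set_integrable_def
    proof (rule integrable_cong_AE_imp)
      show "(\<lambda>x. indicat_real K x *\<^sub>R g x) \<in> borel_measurable lebesgue"
        using gm fmeasurableD[OF lmeasurable_compact[OF K]]
        by (intro borel_measurable_scaleR borel_measurable_indicator)
      show "AE x in lebesgue. indicat_real K x *\<^sub>R f x = indicat_real K x *\<^sub>R g x"
        using ae by eventually_elim simp
    qed
  qed
  then show ?thesis using that[of g] ae locally_integrable_iff_borel[OF g(1)] by blast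
qed

lemma lebesgue_integral_version:
  assumes f: "f \<in> borel_measurable lebesgue" and g: "g \<in> borel_measurable borel" and ae: "AE x in lebesgue. f x = g x"
  shows "(LINT x|lebesgue. f x) = (LINT x|lborel. (g x :: real))"
proof -
  have "(LINT x|lebesgue. f x) = (LINT x|lebesgue. g x)"
    using assms by (intro integral_cong_AE) (auto intro: measurable_completion)
  also have "\<dots> = (LINT x|lborel. g x)" using g by (intro integral_completion) auto
  finally show ?thesis .
qed

lemma Xd_borel: "test_function \<phi> \<Longrightarrow> Xd v \<phi> \<in> borel_measurable borel"
  by (rule test_function_borel[OF Xd_test_function])

lemma weak_hgrad_borel_version:
  assumes w: "has_weak_hgrad G u D"
  obtains u' D' where "AE x in lebesgue. u x = u' x"
    "\<And>i. i < rank G \<Longrightarrow> AE x in lebesgue. D x i = D' x i"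
    "\<And>i. i < rank G \<Longrightarrow> weak_Xd (frame G i) u' (\<lambda>x. D' x i)" "loc_int u'"
proof -
  have lu: "locally_integrable u" using w by (simp add: has_weak_hgrad_def)
  obtain u' where u': "loc_int u'" "AE x in lebesgue. u x = u' x"
    using locally_integrable_borel_version[OF lu] by blast
  have "\<exists>d. loc_int d \<and> (AE x in lebesgue. D x i = d x)" if "i < rank G" for i
    using locally_integrable_borel_version[of "\<lambda>x. D x i"] w that unfolding has_weak_hgrad_def by blast
  then obtain d where d: "\<And>i. i < rank G \<Longrightarrow> loc_int (d i) \<and> (AE x in lebesgue. D x i = d i x)" by metis
  have "weak_Xd (frame G i) u' (d i)" if i: "i < rank G" for i
    unfolding weak_Xd_def
  proof (intro conjI allI impI)
    show "loc_int u'" "loc_int (d i)" using u' d[OF i] by auto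
    then have [measurable]: "u' \<in> borel_measurable borel" "d i \<in> borel_measurable borel" by (auto simp: loc_int_def)
    fix \<phi> :: "'a \<Rightarrow> real" assume \<phi>: "test_function \<phi>"
    note [measurable] = test_function_borel[OF \<phi>] Xd_borel[OF \<phi>]
    have m: "u \<in> borel_measurable lebesgue" "(\<lambda>x. D x i) \<in> borel_measurable lebesgue"
      using w i by (auto simp: has_weak_hgrad_def locally_integrable_def)
    have m': "\<phi> \<in> borel_measurable lebesgue" "Xd v \<phi> \<in> borel_measurable lebesgue" for v
      using test_function_borel[OF \<phi>] Xd_borel[OF \<phi>] by (auto intro: measurable_completion)
    have "(LINT x|lebesgue. \<phi> x * D x i) = (LINT x|lborel. d i x * \<phi> x)"
      using d[OF i] m m' by (intro lebesgue_integral_version) (auto elim!: eventually_mono)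
    moreover have "(LINT x|lebesgue. hgrad G \<phi> x i * u x) = (LINT x|lborel. u' x * Xd (frame G i) \<phi> x)"
      unfolding hgrad_Xd using u'(2) m m' by (intro lebesgue_integral_version) (auto elim!: eventually_mono)
    ultimately show "(LINT x|lborel. d i x * \<phi> x) = - (LINT x|lborel. u' x * Xd (frame G i) \<phi> x)"
      using w i \<phi> by (simp add: has_weak_hgrad_def)
  qed
  then show ?thesis using that[of u' "\<lambda>x i. d i x"] u' d by blast
qed

section \<open>The horizontal perimeter\<close>

definition admissible :: "(nat \<Rightarrow> 'a \<Rightarrow> real) \<Rightarrow> bool" where
  "admissible F \<longleftrightarrow> (\<forall>i<rank G. test_function (F i)) \<and> (\<forall>x. (\<Sum>i<rank G. (F i x)\<^sup>2) \<le> 1)"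

definition hdiv :: "(nat \<Rightarrow> 'a \<Rightarrow> real) \<Rightarrow> 'a \<Rightarrow> real" where
  "hdiv F x = (\<Sum>i<rank G. Xd (frame G i) (F i) x)"

lemma hdiv_test_function:
  assumes "admissible F" shows "test_function (hdiv F)"
proof -
  have t: "test_function (Xd (frame G i) (F i))" if "i < rank G" for i
    using assms that Xd_test_function by (simp add: admissible_def)
  then have "\<forall>i\<in>{..<rank G}. \<exists>K. compact K \<and> (\<forall>x. x \<notin> K \<longrightarrow> Xd (frame G i) (F i) x = 0)"
    by (metis lessThan_iff test_functionE)
  then obtain K where K: "\<And>i. i < rank G \<Longrightarrow> compact (K i) \<and> (\<forall>x. x \<notin> K i \<longrightarrow> Xd (frame G i) (F i) x = 0)"
    by (metis lessThan_iff)
  show ?thesis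
  proof (rule test_functionI)
    show "smooth (hdiv F)" unfolding smooth_def hdiv_def[abs_def]
      using t by (intro allI Ck_sum test_function_Ck) auto
    show "compact (\<Union>i\<in>{..<rank G}. K i)" using K by (intro compact_UN) auto
    show "hdiv F x = 0" if "x \<notin> (\<Union>i\<in>{..<rank G}. K i)" for x
      using that K unfolding hdiv_def by (intro sum.neutral) auto
  qed
qed

lemma hdiv_by_parts:
  assumes F: "admissible F" and \<phi>: "test_function \<phi>"
  shows "(LINT x|lborel. hdiv F x * \<phi> x) = - (LINT x|lborel. (\<Sum>i<rank G. Xd (frame G i) \<phi> x * F i x))"
proof -
  have Fi: "test_function (F i)" if "i < rank G" for i using F that by (simp add: admissible_def)
  note i = C1_compact_Xd_mult_integrable[OF test_function_Ck[OF \<phi>] test_function_C1_compact[OF Fi]]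
  have "(LINT x|lborel. hdiv F x * \<phi> x) = (LINT x|lborel. (\<Sum>i<rank G. \<phi> x * Xd (frame G i) (F i) x))"
    by (simp add: hdiv_def sum_distrib_right sum_distrib_left mult.commute)
  also have "\<dots> = (\<Sum>i<rank G. (LINT x|lborel. \<phi> x * Xd (frame G i) (F i) x))"
    using i(1) by (intro Bochner_Integration.integral_sum) auto
  also have "\<dots> = (\<Sum>i<rank G. - (LINT x|lborel. Xd (frame G i) \<phi> x * F i x))"
    using integral_Xd_by_parts[OF test_function_Ck[OF \<phi>] test_function_C1_compact[OF Fi]] by (intro sum.cong) auto
  also have "\<dots> = - (LINT x|lborel. (\<Sum>i<rank G. Xd (frame G i) \<phi> x * F i x))"
    using i(2) by (subst Bochner_Integration.integral_sum) (auto simp: sum_negf)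
  finally show ?thesis .
qed

lemma admissible_pairing_borel:
  assumes F: "admissible F" and \<phi>: "test_function \<phi>"
  shows "(\<lambda>x. \<Sum>i<rank G. Xd (frame G i) \<phi> x * F i x) \<in> borel_measurable borel"
proof (intro borel_measurable_sum borel_measurable_times)
  fix i assume "i \<in> {..<rank G}"
  then have "test_function (F i)" using F by (simp add: admissible_def)
  then show "F i \<in> borel_measurable borel" by (rule test_function_borel)
  show "Xd (frame G i) \<phi> \<in> borel_measurable borel" by (rule Xd_borel[OF \<phi>])
qed

lemma integral_hgrad_pairing:
  assumes F: "admissible F" and \<phi>: "test_function \<phi>"
  shows "(LINT x|lebesgue. (\<Sum>i<rank G. hgrad G \<phi> x i * F i x)) = - (LINT x|lborel. hdiv F x * \<phi> x)"
proof -
  have "(LINT x|lebesgue. (\<Sum>i<rank G. hgrad G \<phi> x i * F i x)) = (LINT x|lborel. (\<Sum>i<rank G. Xd (frame G i) \<phi> x * F i x))"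
    unfolding hgrad_Xd using admissible_pairing_borel[OF F \<phi>] by (intro integral_completion) auto
  then show ?thesis using hdiv_by_parts[OF F \<phi>] by simp
qed

lemma is_hdiv_hdiv: "admissible F \<Longrightarrow> is_hdiv G F (hdiv F)"
proof -
  assume F: "admissible F"
  note t = hdiv_test_function[OF F]
  have "locally_integrable (hdiv F)"
    using locally_integrable_iff_borel[OF test_function_borel[OF t]] loc_int_continuous[OF test_function_cont[OF t]] by simp
  moreover have "(LINT x|lebesgue. \<phi> x * hdiv F x) = (LINT x|lborel. hdiv F x * \<phi> x)" if "test_function \<phi>" for \<phi>
    using test_function_borel[OF t] test_function_borel[OF that]
    by (subst integral_completion) (auto simp: mult.commute)
  ultimately show ?thesis unfolding is_hdiv_def using integral_hgrad_pairing[OF F] by simp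
qed

text \<open>The weak divergence is unique almost everywhere by the fundamental lemma.\<close>

lemma is_hdiv_AE:
  assumes F: "admissible F" and g: "is_hdiv G F g"
  shows "AE x in lebesgue. g x = hdiv F x"
proof -
  have lg: "locally_integrable g" using g by (simp add: is_hdiv_def)
  obtain g' where g': "loc_int g'" "AE x in lebesgue. g x = g' x"
    using locally_integrable_borel_version[OF lg] by blast
  note t = hdiv_test_function[OF F]
  have lh: "loc_int (hdiv F)" by (rule loc_int_continuous[OF test_function_cont[OF t]])
  have "AE x in lborel. g' x - hdiv F x = 0"
  proof (rule test_function_fundamental[OF loc_int_diff[OF g'(1) lh]])
    fix \<phi> :: "'a \<Rightarrow> real" assume \<phi>: "test_function \<phi>"
    have gm: "g' \<in> borel_measurable borel" using g'(1) by (simp add: loc_int_def)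
    have p: "\<phi> \<in> borel_measurable lebesgue" using test_function_borel[OF \<phi>] by (auto intro: measurable_completion)
    have q: "g \<in> borel_measurable lebesgue" using lg by (simp add: locally_integrable_def)
    have "(LINT x|lebesgue. \<phi> x * g x) = (LINT x|lborel. g' x * \<phi> x)"
      using p q g'(2) gm test_function_borel[OF \<phi>]
      by (intro lebesgue_integral_version) (auto elim!: eventually_mono)
    then have "(LINT x|lborel. g' x * \<phi> x) = (LINT x|lborel. hdiv F x * \<phi> x)"
      using g \<phi> integral_hgrad_pairing[OF F \<phi>] by (simp add: is_hdiv_def)
    moreover obtain K where K: "compact K" "\<And>x. x \<notin> K \<Longrightarrow> \<phi> x = 0" using test_functionE[OF \<phi>] by blast
    ultimately show "(LINT x|lborel. (g' x - hdiv F x) * \<phi> x) = 0"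
      using loc_int_mult_cont[OF g'(1) test_function_cont[OF \<phi>] K] loc_int_mult_cont[OF lh test_function_cont[OF \<phi>] K]
      by (simp add: left_diff_distrib)
  qed
  then have "AE x in lebesgue. g' x = hdiv F x" by (intro AE_completion) simp
  with g'(2) show ?thesis by eventually_elim simp
qed

text \<open>Since weak divergences agree almost everywhere with the pointwise ones, the supremum may be taken over
the fields alone.\<close>

lemma hperimeter_eq:
  assumes E: "E \<in> sets lebesgue"
  shows "hperimeter G E = (SUP F\<in>{F. admissible F}. ennreal (LINT x:E|lebesgue. hdiv F x))"
proof -
  have eq: "(LINT x:E|lebesgue. g x) = (LINT x:E|lebesgue. hdiv F x)" if F: "admissible F" and g: "is_hdiv G F g" for F g
    unfolding set_lebesgue_integral_def
  proof (rule integral_cong_AE)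
    have gm: "g \<in> borel_measurable lebesgue" using g by (simp add: is_hdiv_def locally_integrable_def)
    then show "(\<lambda>x. indicat_real E x *\<^sub>R g x) \<in> borel_measurable lebesgue" using E by measurable
    have "hdiv F \<in> borel_measurable lebesgue" using test_function_borel[OF hdiv_test_function[OF F]]
      by (auto intro: measurable_completion)
    then show "(\<lambda>x. indicat_real E x *\<^sub>R hdiv F x) \<in> borel_measurable lebesgue" using E by measurable
    show "AE x in lebesgue. indicat_real E x *\<^sub>R g x = indicat_real E x *\<^sub>R hdiv F x"
      using is_hdiv_AE[OF F g] by eventually_elim simp
  qed
  have "{ennreal (LINT x:E|lebesgue. g x) | F g. (\<forall>i<rank G. test_function (F i)) \<and> (\<forall>x. (\<Sum>i<rank G. (F i x)\<^sup>2) \<le> 1) \<and> is_hdiv G F g}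
     = (\<lambda>F. ennreal (LINT x:E|lebesgue. hdiv F x)) ` {F. admissible F}" (is "?L = ?R")
  proof
    show "?L \<subseteq> ?R" using eq by (fastforce simp: admissible_def)
    show "?R \<subseteq> ?L" using is_hdiv_hdiv by (fastforce simp: admissible_def)
  qed
  then show ?thesis unfolding hperimeter_def by simp
qed

lemma frame_layer:
  assumes "i < rank G" shows "frame G i \<in> layer G 1"
proof -
  have "frame G i \<in> span (frame G ` {..<rank G})" using assms by (intro span_base) auto
  then show ?thesis using carnot by (simp add: carnot_group_def)
qed

lemma step_pos: "1 \<in> {1..step G}" using strat by (simp add: stratification_def)

lemma set_integral_lborel:
  assumes "E \<in> sets borel" "test_function f"
  shows "(LINT x:E|lebesgue. f x) = (LINT x|lborel. indicator E x * f x)"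
  unfolding set_lebesgue_integral_def using assms test_function_borel[OF assms(2)]
  by (subst integral_completion) auto

text \<open>An admissible field is transplanted from the unit ball to the ball of radius \<open>R\<close> by a dilation. This
divides its divergence by \<open>R\<close>, and the volume element contributes \<open>R ^ Q\<close>.\<close>

lemma hperimeter_gball_ge:
  assumes R: "R > 0"
  shows "ennreal (R ^ (Q - 1)) * hperimeter G (gball N 1) \<le> hperimeter G (gball N R)"
proof -
  have B: "gball N r \<in> sets lebesgue" for r by (rule gball_lebesgue)
  have "ennreal (R ^ (Q - 1)) * ennreal (LINT x:gball N 1|lebesgue. hdiv F x) \<le> hperimeter G (gball N R)"
    if F: "admissible F" for F
  proof -
    let ?d = "dil G (1 / R)"
    let ?F = "\<lambda>i x. F i (?d x)"
    have R': "1 / R > 0" using R by simp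
    have F': "admissible ?F" using F test_function_dil[OF R'] by (auto simp: admissible_def)
    have h: "hdiv ?F x = 1 / R * hdiv F (?d x)" for x
    proof -
      have "Xd (frame G i) (\<lambda>x. F i (?d x)) x = 1 / R * Xd (frame G i) (F i) (?d x)" if "i < rank G" for i
        using Xd_dil[OF R' step_pos frame_layer[OF that] test_function_diff, of "F i" x] F that
        by (simp add: admissible_def)
      then show ?thesis by (simp add: hdiv_def sum_distrib_left)
    qed
    note [measurable] = test_function_borel[OF hdiv_test_function[OF F]] test_function_borel[OF hdiv_test_function[OF F']]
    have "(LINT x:gball N R|lebesgue. hdiv ?F x) = (LINT x|lborel. indicator (gball N R) x * hdiv ?F x)"
      by (rule set_integral_lborel[OF gball_borel hdiv_test_function[OF F']])
    also have "\<dots> = R ^ Q * (LINT x|lborel. indicator (gball N R) (dil G R x) * hdiv ?F (dil G R x))"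
      by (rule integral_dil[OF R]) measurable
    also have "\<dots> = R ^ Q * (LINT x|lborel. 1 / R * (indicator (gball N 1) x * hdiv F x))"
    proof -
      have "indicator (gball N R) (dil G R x) * hdiv ?F (dil G R x) = 1 / R * (indicator (gball N 1) x * hdiv F x)" for x
        using R by (simp add: h dil_inverse' gball_def indicator_def N_dil)
      then show ?thesis by simp
    qed
    also have "\<dots> = R ^ (Q - 1) * (LINT x|lborel. indicator (gball N 1) x * hdiv F x)"
    proof -
      have "R ^ Q = R * R ^ (Q - 1)" using Q_pos by (metis Suc_diff_1 less_eq_Suc_le One_nat_def power_Suc)
      then show ?thesis using R by simp
    qed
    also have "(LINT x|lborel. indicator (gball N 1) x * hdiv F x) = (LINT x:gball N 1|lebesgue. hdiv F x)"
      by (rule set_integral_lborel[OF gball_borel hdiv_test_function[OF F], symmetric])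
    finally have "ennreal (R ^ (Q - 1)) * ennreal (LINT x:gball N 1|lebesgue. hdiv F x) = ennreal (LINT x:gball N R|lebesgue. hdiv ?F x)"
      using R by (simp add: ennreal_mult'[symmetric])
    also have "\<dots> \<le> hperimeter G (gball N R)"
      unfolding hperimeter_eq[OF B] using F' by (intro SUP_upper) auto
    finally show ?thesis .
  qed
  then show ?thesis unfolding hperimeter_eq[OF B, of 1] SUP_mult_left_ennreal
    by (intro SUP_least) auto
qed

section \<open>Positivity of the perimeter of the unit ball\<close>

text \<open>If the perimeter were zero, the indicator \<open>w\<close> of the ball would be annihilated, in the weak sense, by
the fields of the frame. The set of all \<open>v\<close> whose field annihilates \<open>w\<close> is a subspace closed under brackets,
so it contains all layers. By \<open>weight_right_invariant\<close> the integral of \<open>w x * \<phi> (x \<odot> h)\<close> over \<open>x\<close> is then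
independent of \<open>h\<close>, and positive if \<open>\<phi>\<close> is a bump at the identity. Integrated over all \<open>h\<close> it is infinite,
but by Fubini's theorem the result is the product of the finite integrals of \<open>w\<close> and \<open>\<phi>\<close>.\<close>

lemma hperimeter_unit_ball_pos: "hperimeter G (gball N 1) > 0"
proof (rule ccontr)
  assume "\<not> hperimeter G (gball N 1) > 0"
  then have P0: "hperimeter G (gball N 1) = 0" by simp
  let ?B = "gball N 1"
  have B: "?B \<in> sets lebesgue" by (rule gball_lebesgue)
  have Bfin: "emeasure lborel ?B < \<infinity>" by (simp add: gball_volume)
  define w where "w = indicat_real ?B"
  have wi: "integrable lborel w" unfolding w_def using Bfin by (intro integrable_real_indicator) auto
  have lw: "loc_int w" by (rule loc_int_integrable[OF wi])
  have le0: "(LINT x|lborel. w x * hdiv F x) \<le> 0" if F: "admissible F" for F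
  proof -
    have "ennreal (LINT x:?B|lebesgue. hdiv F x) \<le> hperimeter G ?B"
      unfolding hperimeter_eq[OF B] using F by (intro SUP_upper) auto
    then have "(LINT x:?B|lebesgue. hdiv F x) \<le> 0" using P0 by (simp add: ennreal_eq_0_iff)
    then show ?thesis using set_integral_lborel[OF gball_borel hdiv_test_function[OF F], of 1] by (simp add: w_def)
  qed
  have frame0: "(LINT x|lborel. w x * Xd (frame G i) \<phi> x) = 0" if i: "i < rank G" and \<phi>: "test_function \<phi>" for i \<phi>
  proof -
    obtain K where K: "compact K" "\<And>x. x \<notin> K \<Longrightarrow> \<phi> x = 0" "smooth \<phi>" using test_functionE[OF \<phi>] by blast
    obtain C where C: "C \<ge> 0" "\<And>x. \<bar>\<phi> x\<bar> \<le> C" using compact_supp_bounded[OF test_function_cont[OF \<phi>] K(1,2)] by blast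
    \<comment> \<open>Both signs of a small multiple of the test function are admissible as the only nonzero component of a field.\<close>
    have key: "c * (LINT x|lborel. w x * Xd (frame G i) \<phi> x) \<le> 0" if c: "\<bar>c\<bar> = 1 / (C + 1)" for c
    proof -
      define F where "F j x = (if j = i then c * \<phi> x else 0)" for j :: nat and x
      have b: "(c * \<phi> x)\<^sup>2 \<le> 1" for x
      proof -
        have "\<bar>c * \<phi> x\<bar> \<le> 1 / (C + 1) * C" unfolding abs_mult c using C by (intro mult_left_mono) auto
        also have "\<dots> \<le> 1" using C by simp
        finally show ?thesis by (simp add: abs_square_le_1)
      qed
      have tc: "test_function (\<lambda>x. c * \<phi> x)"
        by (rule test_functionI[OF _ K(1)]) (use K in \<open>auto simp: smooth_def intro!: Ck_mult Ck_const\<close>)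
      have t0: "test_function (\<lambda>x. 0)" by (rule test_functionI[of _ "{}"]) (auto simp: smooth_def Ck_const)
      have Fs: "F i = (\<lambda>x. c * \<phi> x)" "j \<noteq> i \<Longrightarrow> F j = (\<lambda>x. 0)" for j by (auto simp: F_def)
      have "(\<Sum>j<rank G. (F j x)\<^sup>2) = (c * \<phi> x)\<^sup>2" for x
        using i by (subst sum.remove[of _ i]) (auto simp: F_def)
      then have adm: "admissible F" unfolding admissible_def using tc t0 b Fs by (metis)
      have X0: "Xd v (\<lambda>x. 0) x = 0" for v x by (simp add: Xd_def)
      have "hdiv F x = Xd (frame G i) (F i) x" for x unfolding hdiv_def
        using i by (subst sum.remove[of _ i]) (auto simp: Fs X0)
      moreover have "Xd (frame G i) (\<lambda>x. c * \<phi> x) x = c * Xd (frame G i) \<phi> x" for x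
        using Xd_unique[OF has_derivative_mult_right[OF smooth_has_derivative[OF K(3)]]] by (simp add: Xd_def)
      ultimately have "hdiv F x = c * Xd (frame G i) \<phi> x" for x by (simp add: Fs)
      then have "(LINT x|lborel. w x * hdiv F x) = (LINT x|lborel. c * (w x * Xd (frame G i) \<phi> x))"
        by (simp add: mult.left_commute)
      then show ?thesis using le0[OF adm] by simp
    qed
    have "\<bar>1 / (C + 1)\<bar> = 1 / (C + 1)" "\<bar>- (1 / (C + 1))\<bar> = 1 / (C + 1)" "1 / (C + 1) > 0" using C by auto
    with key[of "1 / (C + 1)"] key[of "- (1 / (C + 1))"]
    have "1 / (C + 1) * (LINT x|lborel. w x * Xd (frame G i) \<phi> x) = 0" by linarith
    then show ?thesis using \<open>1 / (C + 1) > 0\<close> by simp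
  qed
  define S where "S = {v. \<forall>\<phi>. test_function \<phi> \<longrightarrow> (LINT x|lborel. w x * Xd v \<phi> x) = 0}"
  have iX: "integrable lborel (\<lambda>x. w x * Xd v \<phi> x)" if \<phi>: "test_function \<phi>" for v \<phi>
  proof -
    obtain K where "compact K" "\<And>x. x \<notin> K \<Longrightarrow> Xd v \<phi> x = 0" using test_functionE[OF Xd_test_function[OF \<phi>]] by blast
    then show ?thesis by (intro loc_int_mult_cont[OF lw test_function_cont[OF Xd_test_function[OF \<phi>]]])
  qed
  have S: "subspace S" unfolding subspace_def S_def
    using Xd_linear[OF test_function_diff] iX by (simp add: distrib_left mult.left_commute)
  have L1: "layer G 1 \<subseteq> S"
  proof -
    have "frame G ` {..<rank G} \<subseteq> S" using frame0 by (auto simp: S_def)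
    then have "span (frame G ` {..<rank G}) \<subseteq> S" using S by (rule span_minimal)
    then show ?thesis using carnot by (simp add: carnot_group_def)
  qed
  have L: "layer G j \<subseteq> S" if "j \<in> {1..step G}" for j
    using that
  proof (induction j)
    case (Suc j)
    show ?case
    proof (cases "j = 0")
      case True
      then show ?thesis using L1 by simp
    next
      case False
      then have j: "j \<in> {1..<step G}" "j \<in> {1..step G}" using Suc.prems by auto
      have "{lie_bracket G v u | v u. v \<in> layer G 1 \<and> u \<in> layer G j} \<subseteq> S"
      proof safe
        fix v u assume v: "v \<in> layer G 1" and u: "u \<in> layer G j"
        have vu: "v \<in> S" "u \<in> S" using v u L1 Suc.IH[OF j(2)] by auto
        show "lie_bracket G v u \<in> S" unfolding S_def
        proof (safe)
          fix \<phi> :: "'a \<Rightarrow> real" assume \<phi>: "test_function \<phi>"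
          have "(LINT x|lborel. w x * Xd (lie_bracket G v u) \<phi> x)
             = (LINT x|lborel. w x * Xd v (Xd u \<phi>) x - w x * Xd u (Xd v \<phi>) x)"
            by (simp add: Xd_bracket[OF \<phi>, symmetric] right_diff_distrib)
          also have "\<dots> = (LINT x|lborel. w x * Xd v (Xd u \<phi>) x) - (LINT x|lborel. w x * Xd u (Xd v \<phi>) x)"
            by (intro Bochner_Integration.integral_diff iX Xd_test_function \<phi>)
          also have "\<dots> = 0" using vu Xd_test_function[OF \<phi>] by (simp add: S_def)
          finally show "(LINT x|lborel. w x * Xd (lie_bracket G v u) \<phi> x) = 0" .
        qed
      qed
      then have "span {lie_bracket G v u | v u. v \<in> layer G 1 \<and> u \<in> layer G j} \<subseteq> S" using S by (rule span_minimal)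
      then show ?thesis using strat j(1) by (simp add: stratification_def)
    qed
  qed simp
  have all: "v \<in> S" for v
  proof -
    obtain a where a: "\<And>j. j \<in> {1..step G} \<Longrightarrow> a j \<in> layer G j" "v = (\<Sum>j = 1..step G. a j)"
      using layer_decomposition by blast
    show ?thesis unfolding a(2) using a(1) L by (intro subspace_sum[OF S]) blast
  qed
  have "open ?B" unfolding gball_def using continuous_N by (intro open_Collect_less) (auto intro: continuous_intros)
  moreover have "0 \<in> ?B" using N_0[of 0] by (simp add: gball_def)
  ultimately obtain \<phi> where \<phi>: "test_function \<phi>" "\<And>x. 0 \<le> \<phi> x" "\<phi> 0 > 0" "\<And>x. x \<notin> ?B \<Longrightarrow> \<phi> x = 0"
    using test_function_bump[of ?B 0] by blast
  let ?c = "LINT x|lborel. \<phi> x"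
  have c: "?c > 0" by (rule integral_pos_cont[OF test_function_cont[OF \<phi>(1)] test_function_integrable[OF \<phi>(1)] \<phi>(2,3)])
  have "w x * \<phi> x = \<phi> x" for x using \<phi>(4)[of x] by (auto simp: w_def indicator_def)
  then have wc: "(LINT x|lborel. w x * \<phi> x) = ?c" by (simp only:)
  have inv: "(LINT x|lborel. w x * \<phi> (x \<odot> h)) = ?c" for h
    using weight_right_invariant[OF lw _ \<phi>(1), of h] all wc by (auto simp: S_def)
  have [measurable]: "w \<in> borel_measurable borel" "\<phi> \<in> borel_measurable borel"
    using lw test_function_borel[OF \<phi>(1)] by (auto simp: loc_int_def)
  have mm: "(\<lambda>p. \<phi> (fst p \<odot> snd p)) \<in> borel_measurable (lborel \<Otimes>\<^sub>M lborel)"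
    using borel_measurable_continuous_onI[OF continuous_on_compose2[OF test_function_cont[OF \<phi>(1)]
        continuous_op[OF continuous_on_fst[OF continuous_on_id] continuous_on_snd[OF continuous_on_id]]]]
    by (simp add: lborel_prod)
  have w0: "0 \<le> w x" for x by (simp add: w_def)
  have n1: "(\<integral>\<^sup>+x. ennreal (w x) * ennreal (\<phi> (x \<odot> h)) \<partial>lborel) = ennreal ?c" for h
  proof -
    have t: "test_function (\<lambda>x. \<phi> (x \<odot> h))" by (rule test_function_right[OF \<phi>(1)])
    obtain K where "compact K" "\<And>x. x \<notin> K \<Longrightarrow> \<phi> (x \<odot> h) = 0" using test_functionE[OF t] by blast
    then have "integrable lborel (\<lambda>x. w x * \<phi> (x \<odot> h))" by (rule loc_int_mult_cont[OF lw test_function_cont[OF t]])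
    from nn_integral_eq_integral[OF this] show ?thesis using inv[of h] w0 \<phi>(2) by (simp add: ennreal_mult)
  qed
  have n2: "(\<integral>\<^sup>+h. ennreal (w x) * ennreal (\<phi> (x \<odot> h)) \<partial>lborel) = ennreal (w x) * ennreal ?c" for x
  proof -
    have [measurable]: "(\<lambda>h. \<phi> (x \<odot> h)) \<in> borel_measurable borel"
      using test_function_cont[OF \<phi>(1)] by (intro borel_measurable_continuous_onI continuous_on_compose2[OF test_function_cont[OF \<phi>(1)]] continuous_intros) auto
    have "C1_compact (\<lambda>h. \<phi> (x \<odot> h))" by (rule C1_compact_left[OF test_function_C1_compact[OF \<phi>(1)]])
    then have i: "integrable lborel (\<lambda>h. \<phi> (x \<odot> h))" unfolding C1_compact_def using integrable_cont_compact[OF Ck_continuous] by blast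
    have "(\<integral>\<^sup>+h. ennreal (w x) * ennreal (\<phi> (x \<odot> h)) \<partial>lborel) = ennreal (w x) * (\<integral>\<^sup>+h. ennreal (\<phi> (x \<odot> h)) \<partial>lborel)"
      by (rule nn_integral_cmult) measurable
    also have "(\<integral>\<^sup>+h. ennreal (\<phi> (x \<odot> h)) \<partial>lborel) = ennreal ?c"
      using nn_integral_eq_integral[OF i] \<phi>(2) integral_left[of \<phi> x] by simp
    finally show ?thesis .
  qed
  have "(\<integral>\<^sup>+h. ennreal ?c \<partial>(lborel::'a measure)) = (\<integral>\<^sup>+h. (\<integral>\<^sup>+x. ennreal (w x) * ennreal (\<phi> (x \<odot> h)) \<partial>lborel) \<partial>lborel)"
    by (simp add: n1)
  also have "\<dots> = (\<integral>\<^sup>+x. (\<integral>\<^sup>+h. ennreal (w x) * ennreal (\<phi> (x \<odot> h)) \<partial>lborel) \<partial>lborel)"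
    using lborel_pair.Fubini'[of "\<lambda>x h. ennreal (w x) * ennreal (\<phi> (x \<odot> h))"] mm by (simp add: case_prod_beta)
  also have "\<dots> = (\<integral>\<^sup>+x. ennreal (w x) \<partial>lborel) * ennreal ?c"
    unfolding n2 by (rule nn_integral_multc) measurable
  also have "\<dots> < \<infinity>"
    using nn_integral_eq_integral[OF wi] w0 by (simp add: ennreal_mult'[symmetric])
  finally show False using c by (simp add: ennreal_mult_eq_top_iff)
qed

section \<open>A coarea inequality\<close>

lemma hnorm_nonneg: "0 \<le> hnorm G c" by (simp add: hnorm_def sum_nonneg)

lemma pairing_le_hnorm:
  assumes "(\<Sum>i<rank G. (c i)\<^sup>2) \<le> 1"
  shows "\<bar>\<Sum>i<rank G. d i * c i\<bar> \<le> hnorm G d"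
proof -
  have "\<bar>\<Sum>i<rank G. d i * c i\<bar> \<le> (\<Sum>i<rank G. \<bar>d i\<bar> * \<bar>c i\<bar>)"
    using sum_abs[of "\<lambda>i. d i * c i" "{..<rank G}"] by (simp add: abs_mult)
  also have "\<dots> \<le> L2_set d {..<rank G} * L2_set c {..<rank G}" by (rule L2_set_mult_ineq)
  also have "\<dots> \<le> L2_set d {..<rank G} * 1"
    using assms by (intro mult_left_mono L2_set_nonneg) (simp add: L2_set_def)
  finally show ?thesis by (simp add: L2_set_def hnorm_def)
qed

text \<open>Integrate by parts: the ramp of \<open>u\<close> has gradient \<open>D / (s - t)\<close> where \<open>t < u x < s\<close> and zero outside
\<open>{x. t \<le> u x \<and> u x \<le> s}\<close>, and the pairing with the field is at most \<open>hnorm G (D x)\<close>. The chain rule is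
applied to the ramps built from \<open>soft_abs\<close>; their derivatives converge to a multiple of
a difference of signs, which takes half of the slope on \<open>{u = t}\<close> and \<open>{u = s}\<close>. This is why both
levels are included in the region of integration.\<close>

lemma coarea_ramp:
  assumes u: "\<And>i. i < rank G \<Longrightarrow> weak_Xd (frame G i) u (\<lambda>x. D x i)" and lu: "loc_int u"
    and F: "admissible F" and ts: "t < s"
    and intD: "integrable lborel (\<lambda>x. indicator {x. t \<le> u x \<and> u x \<le> s} x * hnorm G (D x))"
  shows "(LINT x|lborel. ramp t s (u x) * hdiv F x)
    \<le> 1 / (s - t) * (LINT x|lborel. indicator {x. t \<le> u x \<and> u x \<le> s} x * hnorm G (D x))"
proof -
  let ?c = "2 * (s - t)"
  have c: "?c > 0" using ts by simp
  define h where "h n y = (soft_abs n (y - t) - soft_abs n (y - s)) / ?c + 1 / 2" for n y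
  define k where "k n y = ((y - t) / soft_abs n (y - t) - (y - s) / soft_abs n (y - s)) / ?c" for n y
  define k0 where "k0 y = (sgn (y - t) - sgn (y - s)) / ?c" for y
  have hder: "(h n has_real_derivative k n y) (at y)" for n y
  proof -
    have "((\<lambda>y. soft_abs n (y - b)) has_real_derivative (y - b) / soft_abs n (y - b)) (at y)" for b
    proof -
      have "((\<lambda>y. y - b) has_real_derivative 1) (at y)" by (auto intro!: derivative_eq_intros)
      from DERIV_chain2[OF soft_abs_deriv this] show ?thesis by simp
    qed
    from DERIV_cdivide[OF DERIV_diff[OF this[of t] this[of s]], of ?c]
    have "((\<lambda>y. (soft_abs n (y - t) - soft_abs n (y - s)) / ?c) has_real_derivative k n y) (at y)" by (simp add: k_def)
    from DERIV_add[OF this DERIV_const[of "1/2"]] show ?thesis by (simp add: h_def[abs_def])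
  qed
  have soft_abs_cont: "continuous_on UNIV (\<lambda>y. soft_abs n (y - b))" for n b
    unfolding soft_abs_def by (intro continuous_intros)
  have kc: "continuous_on UNIV (k n)" for n
    unfolding k_def[abs_def] using soft_abs_pos[of n] c
    by (intro continuous_intros soft_abs_cont) (auto simp: less_imp_neq[symmetric])
  have h1: "\<bar>h n y\<bar> \<le> 1" for n y
  proof -
    have "\<bar>soft_abs n (y - t) - soft_abs n (y - s)\<bar> \<le> s - t" using soft_abs_lipschitz[of n "y - t" "y - s"] ts by simp
    then have "\<bar>(soft_abs n (y - t) - soft_abs n (y - s)) / ?c\<bar> \<le> 1 / 2" using ts by (simp add: abs_div_pos[symmetric] field_simps)
    then show ?thesis unfolding h_def by linarith
  qed
  have k1: "\<bar>k n y\<bar> \<le> 1 / (s - t)" for n y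
  proof -
    have "\<bar>(y - t) / soft_abs n (y - t) - (y - s) / soft_abs n (y - s)\<bar> \<le> 2"
      using soft_abs_ratio_le[of "y - t" n] soft_abs_ratio_le[of "y - s" n] by linarith
    then have "\<bar>(y - t) / soft_abs n (y - t) - (y - s) / soft_abs n (y - s)\<bar> / ?c \<le> 2 / ?c" using c by (intro divide_right_mono) auto
    then have "\<bar>k n y\<bar> \<le> 2 / ?c" by (simp only: k_def abs_divide abs_of_pos[OF c])
    also have "2 / ?c = 1 / (s - t)" using ts by (simp add: field_simps)
    finally show ?thesis .
  qed
  have hlim: "(\<lambda>n. h n y) \<longlonglongrightarrow> ramp t s y" for y
    unfolding h_def ramp_def using c by (intro tendsto_intros soft_abs_lim) auto
  have klim: "(\<lambda>n. k n y) \<longlonglongrightarrow> k0 y" for y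
    unfolding k_def k0_def using c by (intro tendsto_intros soft_abs_ratio_lim) auto
  have Fi: "test_function (F i)" if "i < rank G" for i using F that by (simp add: admissible_def)
  have [measurable]: "u \<in> borel_measurable borel" using lu by (simp add: loc_int_def)
  have Dm[measurable]: "(\<lambda>x. D x i) \<in> borel_measurable borel" if "i < rank G" for i
    using u[OF that] by (simp add: weak_Xd_def loc_int_def)
  have [measurable]: "h n \<in> borel_measurable borel" "k n \<in> borel_measurable borel" for n
    using kc DERIV_isCont[OF hder] by (auto intro!: borel_measurable_continuous_onI simp: continuous_on_eq_continuous_at)
  have [measurable]: "k0 \<in> borel_measurable borel" unfolding k0_def[abs_def] by measurable
  let ?P = "\<lambda>x. \<Sum>i<rank G. D x i * F i x"
  have iDF: "integrable lborel (\<lambda>x. D x i * F i x)" if i: "i < rank G" for i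
  proof -
    obtain K where K: "compact K" "\<And>x. x \<notin> K \<Longrightarrow> F i x = 0" using test_functionE[OF Fi[OF i]] by blast
    show ?thesis using u[OF i] by (intro loc_int_mult_cont[OF _ test_function_cont[OF Fi[OF i]] K]) (auto simp: weak_Xd_def)
  qed
  have iP: "integrable lborel ?P" using iDF by (intro Bochner_Integration.integrable_sum) auto
  have ik: "integrable lborel (\<lambda>x. q (u x) * g x)" if "integrable lborel g" "q \<in> borel_measurable borel" "\<And>y. \<bar>q y\<bar> \<le> C"
    for g and q :: "real \<Rightarrow> real" and C
  proof (rule Bochner_Integration.integrable_bound)
    show "integrable lborel (\<lambda>x. C * g x)" using that by simp
    show "(\<lambda>x. q (u x) * g x) \<in> borel_measurable lborel" using that by measurable
    have "C \<ge> 0" using that(3)[of 0] by linarith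
    then show "AE x in lborel. norm (q (u x) * g x) \<le> norm (C * g x)"
      using that(3) by (auto simp: abs_mult intro!: mult_right_mono)
  qed
  have step: "(LINT x|lborel. h n (u x) * hdiv F x) = - (LINT x|lborel. k n (u x) * ?P x)" for n
  proof -
    have X: "integrable lborel (Xd (frame G i) (F i))" if "i < rank G" for i
      by (rule Xd_integrable[OF test_function_C1_compact[OF Fi[OF that]]])
    have "(LINT x|lborel. h n (u x) * hdiv F x) = (\<Sum>i<rank G. LINT x|lborel. h n (u x) * Xd (frame G i) (F i) x)"
      unfolding hdiv_def sum_distrib_left
      by (rule Bochner_Integration.integral_sum) (use ik[where q="h n" and C=1, OF X _ h1] in auto)
    also have "\<dots> = (\<Sum>i<rank G. - (LINT x|lborel. k n (u x) * (D x i * F i x)))"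
    proof (rule sum.cong[OF refl])
      fix i assume "i \<in> {..<rank G}"
      then have i: "i < rank G" by simp
      have "\<bar>h n y\<bar> \<le> max 1 (1 / (s - t))" "\<bar>k n y\<bar> \<le> max 1 (1 / (s - t))" for y
        using h1[of n y] k1[of n y] by linarith+
      from weak_chain_rule[OF u[OF i] Fi[OF i] hder kc this]
      show "(LINT x|lborel. h n (u x) * Xd (frame G i) (F i) x) = - (LINT x|lborel. k n (u x) * (D x i * F i x))"
        by (simp add: mult.assoc)
    qed
    also have "\<dots> = - (LINT x|lborel. k n (u x) * ?P x)"
      unfolding sum_distrib_left
      by (subst Bochner_Integration.integral_sum) (use ik[where q="k n" and C="1 / (s - t)", OF iDF _ k1] in \<open>auto simp: sum_negf\<close>)
    finally show ?thesis .
  qed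
  have ih: "integrable lborel (hdiv F)" by (rule test_function_integrable[OF hdiv_test_function[OF F]])
  have [measurable]: "hdiv F \<in> borel_measurable borel" "?P \<in> borel_measurable borel" using ih iP by auto
  have L: "(\<lambda>n. LINT x|lborel. h n (u x) * hdiv F x) \<longlonglongrightarrow> (LINT x|lborel. ramp t s (u x) * hdiv F x)"
  proof (rule integral_dominated_convergence)
    show "integrable lborel (\<lambda>x. \<bar>hdiv F x\<bar>)" using ih by simp
    have "\<bar>h n (u x) * hdiv F x\<bar> \<le> 1 * \<bar>hdiv F x\<bar>" for n x unfolding abs_mult by (rule mult_right_mono[OF h1]) simp
    then show "AE x in lborel. norm (h n (u x) * hdiv F x) \<le> \<bar>hdiv F x\<bar>" for n by simp
    show "AE x in lborel. (\<lambda>n. h n (u x) * hdiv F x) \<longlonglongrightarrow> ramp t s (u x) * hdiv F x"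
      by (intro AE_I2 tendsto_mult hlim tendsto_const)
  qed (auto simp: ramp_def)
  have R: "(\<lambda>n. LINT x|lborel. k n (u x) * ?P x) \<longlonglongrightarrow> (LINT x|lborel. k0 (u x) * ?P x)"
  proof (rule integral_dominated_convergence)
    show "integrable lborel (\<lambda>x. 1 / (s - t) * \<bar>?P x\<bar>)" using iP by (intro integrable_mult_right integrable_abs)
    have "\<bar>k n (u x) * ?P x\<bar> \<le> 1 / (s - t) * \<bar>?P x\<bar>" for n x unfolding abs_mult by (rule mult_right_mono[OF k1]) simp
    then show "AE x in lborel. norm (k n (u x) * ?P x) \<le> 1 / (s - t) * \<bar>?P x\<bar>" for n by simp
    show "AE x in lborel. (\<lambda>n. k n (u x) * ?P x) \<longlonglongrightarrow> k0 (u x) * ?P x"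
      by (intro AE_I2 tendsto_mult klim tendsto_const)
  qed measurable
  have "(LINT x|lborel. ramp t s (u x) * hdiv F x) = - (LINT x|lborel. k0 (u x) * ?P x)"
    using L tendsto_minus[OF R] unfolding step by (rule LIMSEQ_unique)
  also have "\<dots> = (LINT x|lborel. - (k0 (u x) * ?P x))" by simp
  also have "\<dots> \<le> (LINT x|lborel. 1 / (s - t) * (indicator {x. t \<le> u x \<and> u x \<le> s} x * hnorm G (D x)))"
  proof (rule integral_mono)
    have "\<bar>k0 y\<bar> \<le> 1 / (s - t)" for y using LIMSEQ_le_const2[OF tendsto_rabs[OF klim]] k1 by blast
    from ik[where q=k0, OF iP _ this] show "integrable lborel (\<lambda>x. - (k0 (u x) * ?P x))" by simp
    show "integrable lborel (\<lambda>x. 1 / (s - t) * (indicator {x. t \<le> u x \<and> u x \<le> s} x * hnorm G (D x)))"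
      using intD by simp
    fix x
    have kb: "\<bar>k0 (u x)\<bar> \<le> 1 / (s - t) * indicator {x. t \<le> u x \<and> u x \<le> s} x"
      using ts by (auto simp: k0_def indicator_def sgn_real_def field_simps)
    have "\<bar>?P x\<bar> \<le> hnorm G (D x)" using F by (intro pairing_le_hnorm) (simp add: admissible_def)
    with kb have "\<bar>k0 (u x)\<bar> * \<bar>?P x\<bar> \<le> (1 / (s - t) * indicator {x. t \<le> u x \<and> u x \<le> s} x) * hnorm G (D x)"
      using ts by (intro mult_mono) auto
    then show "- (k0 (u x) * ?P x) \<le> 1 / (s - t) * (indicator {x. t \<le> u x \<and> u x \<le> s} x * hnorm G (D x))"
      by (simp only: abs_mult[symmetric] mult.assoc)
  qed
  also have "\<dots> = 1 / (s - t) * (LINT x|lborel. indicator {x. t \<le> u x \<and> u x \<le> s} x * hnorm G (D x))" by simp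
  finally show ?thesis .
qed

lemma ramp_cases: "t < s \<Longrightarrow> y \<le> t \<Longrightarrow> ramp t s y = 0" "t < s \<Longrightarrow> s \<le> y \<Longrightarrow> ramp t s y = 1"
  by (auto simp: ramp_def field_simps)

lemma ramp_bound: "t < s \<Longrightarrow> \<bar>ramp t s y\<bar> \<le> 1"
proof -
  assume ts: "t < s"
  have "\<bar>\<bar>y - t\<bar> - \<bar>y - s\<bar>\<bar> \<le> s - t" using ts by linarith
  then have "\<bar>(\<bar>y - t\<bar> - \<bar>y - s\<bar>) / (2 * (s - t))\<bar> \<le> 1 / 2" using ts by (simp add: abs_div_pos[symmetric] field_simps)
  then show ?thesis unfolding ramp_def by linarith
qed

lemma ramp_integral_tendsto:
  assumes [measurable]: "u \<in> borel_measurable borel" and g: "integrable lborel g"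
  shows "((\<lambda>s. LINT x|lborel. ramp t s (u x) * g x) \<longlongrightarrow> (LINT x|lborel. indicator {x. t < u x} x * g x)) (at_right t)"
  unfolding tendsto_at_iff_sequentially
proof (intro allI impI)
  fix X assume X: "\<forall>i. X i \<in> {t<..} - {t}" "X \<longlonglongrightarrow> t"
  have [measurable]: "g \<in> borel_measurable borel" using g by auto
  have Xt: "t < X n" for n using X(1) by auto
  have "(\<lambda>n. LINT x|lborel. ramp t (X n) (u x) * g x) \<longlonglongrightarrow> (LINT x|lborel. indicator {x. t < u x} x * g x)"
  proof (rule integral_dominated_convergence)
    show "integrable lborel (\<lambda>x. \<bar>g x\<bar>)" using g by simp
    have "\<bar>ramp t (X n) (u x) * g x\<bar> \<le> 1 * \<bar>g x\<bar>" for n x unfolding abs_mult by (rule mult_right_mono[OF ramp_bound[OF Xt]]) simp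
    then show "AE x in lborel. norm (ramp t (X n) (u x) * g x) \<le> \<bar>g x\<bar>" for n by simp
    have "(\<lambda>n. ramp t (X n) (u x)) \<longlonglongrightarrow> indicator {x. t < u x} x" for x
    proof (rule tendsto_eventually, cases "t < u x")
      case True
      have "\<forall>\<^sub>F n in sequentially. X n < u x" using order_tendstoD(2)[OF X(2) True] .
      then show "\<forall>\<^sub>F n in sequentially. ramp t (X n) (u x) = indicator {x. t < u x} x"
        by eventually_elim (use True ramp_cases(2)[OF Xt] in auto)
    next
      case False
      then show "\<forall>\<^sub>F n in sequentially. ramp t (X n) (u x) = indicator {x. t < u x} x"
        using ramp_cases(1)[OF Xt] by auto
    qed
    then show "AE x in lborel. (\<lambda>n. ramp t (X n) (u x) * g x) \<longlonglongrightarrow> indicator {x. t < u x} x * g x"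
      by (intro AE_I2 tendsto_mult tendsto_const)
  qed (auto simp: ramp_def)
  then show "((\<lambda>s. LINT x|lborel. ramp t s (u x) * g x) \<circ> X) \<longlonglongrightarrow> (LINT x|lborel. indicator {x. t < u x} x * g x)"
    by (simp add: o_def)
qed

text \<open>Let \<open>M t\<close> be the integral of \<open>hnorm G (D x)\<close> over \<open>{x. a < u x \<and> u x < t}\<close>. If a field pairs with the
superlevel set at \<open>t\<close> to more than \<open>\<kappa>'\<close>, it still does so with the ramps from \<open>t\<close> to nearby \<open>s > t\<close>, and
\<open>coarea_ramp\<close> bounds the difference quotient of \<open>M\<close> over such intervals from below. So the right lower
derivative of \<open>M\<close> is at least \<open>\<kappa>\<close> everywhere, and \<open>increment_lower_bound\<close> applies.\<close>

lemma coarea_lower_bound: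
  assumes u: "\<And>i. i < rank G \<Longrightarrow> weak_Xd (frame G i) u (\<lambda>x. D x i)" and lu: "loc_int u"
    and ab: "a < b" and \<kappa>: "0 < \<kappa>"
    and intD: "integrable lborel (\<lambda>x. indicator {x. a < u x \<and> u x < b} x * hnorm G (D x))"
    and per: "\<And>t \<kappa>'. a < t \<Longrightarrow> t < b \<Longrightarrow> \<kappa>' < \<kappa> \<Longrightarrow>
       \<exists>F. admissible F \<and> \<kappa>' < (LINT x|lborel. indicator {x. t < u x} x * hdiv F x)"
  shows "\<kappa> * (b - a) \<le> (LINT x|lborel. indicator {x. a < u x \<and> u x < b} x * hnorm G (D x))"
proof -
  let ?N = "\<lambda>x. hnorm G (D x)"
  let ?I = "LINT x|lborel. indicator {x. a < u x \<and> u x < b} x * ?N x"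
  have [measurable]: "u \<in> borel_measurable borel" using lu by (simp add: loc_int_def)
  have Dm: "(\<lambda>x. D x i) \<in> borel_measurable borel" if "i < rank G" for i
    using u[OF that] by (simp add: weak_Xd_def loc_int_def)
  have [measurable]: "(\<lambda>x. \<Sum>i<rank G. (D x i)\<^sup>2) \<in> borel_measurable borel"
    using Dm by (intro borel_measurable_sum borel_measurable_power) auto
  have [measurable]: "?N \<in> borel_measurable borel" unfolding hnorm_def by measurable
  have int: "integrable lborel (\<lambda>x. indicator {x. P (u x)} x * ?N x)"
    if "\<And>y. P y \<Longrightarrow> a < y \<and> y < b" "Measurable.pred borel P" for P
  proof (rule Bochner_Integration.integrable_bound[OF intD])
    show "(\<lambda>x. indicator {x. P (u x)} x * ?N x) \<in> borel_measurable lborel" using that(2) by measurable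
    show "AE x in lborel. norm (indicator {x. P (u x)} x * ?N x) \<le> norm (indicator {x. a < u x \<and> u x < b} x * ?N x)"
      using that(1) by (auto simp: indicator_def)
  qed
  define M where "M t = (LINT x|lborel. indicator {x. a < u x \<and> u x < t} x * ?N x)" for t
  have iM: "integrable lborel (\<lambda>x. indicator {x. a < u x \<and> u x < t} x * ?N x)" if "t \<le> b" for t
    using int[of "\<lambda>y. a < y \<and> y < t"] that by auto
  have Mmono: "M s \<le> M t" if "s \<le> t" "t \<le> b" for s t
    unfolding M_def using that iM hnorm_nonneg by (intro integral_mono) (auto simp: indicator_def)
  have M0: "0 \<le> M t" for t unfolding M_def using hnorm_nonneg by (intro integral_nonneg_AE) auto
  have main: "\<kappa>1 * (b' - a') \<le> ?I" if k1: "0 \<le> \<kappa>1" "\<kappa>1 < \<kappa>" and a'b': "a < a'" "a' \<le> b'" "b' < b" for \<kappa>1 a' b'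
  proof -
    have "\<kappa>1 * (b' - a') \<le> M b' - M a'"
    proof (rule increment_lower_bound[OF _ _ k1(1) a'b'(2)])
      show "M s \<le> M t" if "a' \<le> s" "s \<le> t" "t \<le> b'" for s t using Mmono that a'b' by simp
      fix t assume t: "a' \<le> t" "t < b'"
      \<comment> \<open>An intermediate value leaves room for a field that is almost optimal and for the passage from the superlevel set to a ramp.\<close>
      define \<kappa>2 where "\<kappa>2 = (\<kappa>1 + \<kappa>) / 2"
      have k2: "\<kappa>1 < \<kappa>2" "\<kappa>2 < \<kappa>" "0 < \<kappa>2" using k1 by (auto simp: \<kappa>2_def)
      obtain F where F: "admissible F" "\<kappa>2 < (LINT x|lborel. indicator {x. t < u x} x * hdiv F x)"
        using per[OF _ _ k2(2), of t] t a'b' by auto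
      have "((\<lambda>s. LINT x|lborel. ramp t s (u x) * hdiv F x) \<longlongrightarrow> (LINT x|lborel. indicator {x. t < u x} x * hdiv F x)) (at_right t)"
        by (rule ramp_integral_tendsto) (use test_function_integrable[OF hdiv_test_function[OF F(1)]] in auto)
      from order_tendstoD(1)[OF this F(2)] obtain r where r: "r > t" "\<And>s. t < s \<Longrightarrow> s < r \<Longrightarrow> \<kappa>2 < (LINT x|lborel. ramp t s (u x) * hdiv F x)"
        unfolding eventually_at_right[OF less_add_one] by blast
      \<comment> \<open>The ramp estimate includes the level s, while M excludes its endpoint; hence s is chosen below s' and then tends to it.\<close>
      have key: "\<kappa>2 * (s' - t) \<le> M s' - M t" if s': "t < s'" "s' < r" "s' \<le> b'" for s'
      proof (rule dense_le_bounded)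
        show "0 < \<kappa>2 * (s' - t)" using k2 s' by simp
        fix w assume w: "0 < w" "w < \<kappa>2 * (s' - t)"
        define s where "s = t + w / \<kappa>2"
        have s: "t < s" "s < s'" using w k2 by (auto simp: s_def field_simps)
        have i1: "integrable lborel (\<lambda>x. indicator {x. t \<le> u x \<and> u x \<le> s} x * ?N x)"
          using int[of "\<lambda>y. t \<le> y \<and> y \<le> s"] s s' t a'b' by auto
        have "\<kappa>2 < (LINT x|lborel. ramp t s (u x) * hdiv F x)" using s s' by (intro r(2)) auto
        also have "\<dots> \<le> 1 / (s - t) * (LINT x|lborel. indicator {x. t \<le> u x \<and> u x \<le> s} x * ?N x)"
          by (rule coarea_ramp[OF u lu F(1) s(1) i1])
        finally have "\<kappa>2 * (s - t) \<le> (LINT x|lborel. indicator {x. t \<le> u x \<and> u x \<le> s} x * ?N x)"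
          using s by (simp add: field_simps)
        also have "\<dots> \<le> (LINT x|lborel. indicator {x. a < u x \<and> u x < s'} x * ?N x - indicator {x. a < u x \<and> u x < t} x * ?N x)"
          using s s' t a'b' hnorm_nonneg
          by (intro integral_mono[OF i1] Bochner_Integration.integrable_diff iM) (auto simp: indicator_def)
        also have "\<dots> = M s' - M t" unfolding M_def using s' t a'b'
          by (intro Bochner_Integration.integral_diff iM) auto
        finally show "w \<le> M s' - M t" using k2 by (simp add: s_def)
      qed
      show "\<exists>\<eta>>0. \<forall>s. t < s \<and> s < t + \<eta> \<and> s \<le> b' \<longrightarrow> \<kappa>1 * (s - t) \<le> M s - M t"
      proof (intro exI[of _ "r - t"] conjI allI impI)
        fix s assume s: "t < s \<and> s < t + (r - t) \<and> s \<le> b'"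
        have "\<kappa>1 * (s - t) \<le> \<kappa>2 * (s - t)" using k2 s by (intro mult_right_mono) auto
        also have "\<dots> \<le> M s - M t" using s by (intro key) auto
        finally show "\<kappa>1 * (s - t) \<le> M s - M t" .
      qed (use r in simp)
    qed
    also have "\<dots> \<le> M b" using M0[of a'] Mmono[of b' b] a'b' by simp
    finally show ?thesis by (simp add: M_def)
  qed
  have "((\<lambda>e. (\<kappa> - e) * ((b - e) - (a + e))) \<longlongrightarrow> (\<kappa> - 0) * ((b - 0) - (a + 0))) (at_right 0)"
    by (intro tendsto_intros)
  moreover have "\<forall>\<^sub>F e in at_right 0. (\<kappa> - e) * ((b - e) - (a + e)) \<le> ?I"
    unfolding eventually_at_right[OF zero_less_one]
  proof (intro exI[of _ "min \<kappa> ((b - a) / 2)"] conjI allI impI)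
    show "0 < min \<kappa> ((b - a) / 2)" using \<kappa> ab by simp
    fix e assume "0 < e" "e < min \<kappa> ((b - a) / 2)"
    then show "(\<kappa> - e) * ((b - e) - (a + e)) \<le> ?I" by (intro main) auto
  qed
  ultimately have "(\<kappa> - 0) * ((b - 0) - (a + 0)) \<le> ?I"
    by (rule tendsto_upperbound) (simp add: trivial_limit_at_right_real)
  then show ?thesis by simp
qed

section \<open>The radial profile\<close>

definition ball_vol :: "real \<Rightarrow> real" where "ball_vol r = \<sigma>0 * (r ^ Q / Q)"

lemma emeasure_gball: "r \<ge> 0 \<Longrightarrow> emeasure lebesgue (gball N r) = ennreal (ball_vol r)"
  using gball_volume[of r] gball_borel by (simp add: ball_vol_def)

lemma ball_vol_nonneg: "r \<ge> 0 \<Longrightarrow> ball_vol r \<ge> 0" unfolding ball_vol_def using sigma0_pos by simp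

lemma ball_vol_pos: "r > 0 \<Longrightarrow> ball_vol r > 0" unfolding ball_vol_def using sigma0_pos Q_pos by auto

lemma ball_vol_mono: "0 \<le> r \<Longrightarrow> r \<le> s \<Longrightarrow> ball_vol r \<le> ball_vol s"
  unfolding ball_vol_def using sigma0_pos by (intro mult_left_mono divide_right_mono power_mono) auto

lemma ball_vol_strict_mono: "0 \<le> r \<Longrightarrow> r < s \<Longrightarrow> ball_vol r < ball_vol s"
  unfolding ball_vol_def using sigma0_pos Q_pos
  by (intro mult_strict_left_mono divide_strict_right_mono power_strict_mono) auto

lemma ball_vol_surj:
  assumes "v \<ge> 0" obtains R where "R \<ge> 0" "ball_vol R = v"
proof
  let ?R = "root Q (v * Q / \<sigma>0)"
  have "v * Q / \<sigma>0 \<ge> 0" using assms sigma0_pos by auto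
  then show "?R \<ge> 0" "ball_vol ?R = v" using Q_pos sigma0_pos by (auto simp: ball_vol_def)
qed

lemma ball_vol_increment: "0 < r \<Longrightarrow> r < s \<Longrightarrow> ball_vol s - ball_vol r \<le> \<sigma>0 * s ^ (Q - 1) * (s - r)"
proof -
  assume rs: "0 < r" "r < s"
  have der: "(ball_vol has_real_derivative \<sigma>0 * z ^ (Q - 1)) (at z)" for z
    unfolding ball_vol_def[abs_def] using Q_pos by (auto intro!: derivative_eq_intros)
  obtain z where z: "r < z" "z < s" "ball_vol s - ball_vol r = (s - r) * (\<sigma>0 * z ^ (Q - 1))"
    using MVT2[OF rs(2) der] by blast
  have "\<sigma>0 * z ^ (Q - 1) \<le> \<sigma>0 * s ^ (Q - 1)" using z rs sigma0_pos by (intro mult_left_mono power_mono) auto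
  then have "(s - r) * (\<sigma>0 * z ^ (Q - 1)) \<le> (s - r) * (\<sigma>0 * s ^ (Q - 1))" by (rule mult_left_mono) (use rs in simp)
  then show ?thesis unfolding z(3) by (simp only: mult.commute[of "s - r"])
qed

lemma shell_measure: "0 \<le> r \<Longrightarrow> r \<le> s \<Longrightarrow> emeasure lborel {x. r \<le> N x \<and> N x < s} = ennreal (ball_vol s - ball_vol r)"
proof -
  assume rs: "0 \<le> r" "r \<le> s"
  have "{x. r \<le> N x \<and> N x < s} = gball N s - gball N r" by (auto simp: gball_def)
  moreover have "gball N r \<subseteq> gball N s" using rs by (auto simp: gball_def)
  ultimately show ?thesis
    using gball_volume[of r, folded ball_vol_def] gball_volume[of s, folded ball_vol_def] rs gball_borel ball_vol_nonneg[of r]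
    by (simp add: emeasure_Diff ennreal_minus)
qed

text \<open>In polar coordinates the points with radius in a null set \<open>Z\<close> have measure zero, since almost every
radius contributes nothing. They are cut into bounded pieces to have integrable indicators.\<close>

lemma AE_gauge_radius:
  assumes P: "AE r in lborel. 0 < r \<longrightarrow> P r"
  shows "AE x in lborel. P (N x)"
proof -
  interpret finite_measure \<sigma> by (rule finite_sigma)
  obtain Z where Z: "Z \<in> null_sets lborel" "{r. \<not> (0 < r \<longrightarrow> P r)} \<subseteq> Z"
    using P by (auto elim!: AE_E simp: null_sets_def)
  have Zm[measurable]: "Z \<in> sets borel" using Z(1) by auto
  have "AE x in lborel. \<not> (N x \<in> Z \<and> 0 < N x \<and> N x < real n)" for n
  proof -
    let ?A = "{x. N x \<in> Z \<and> 0 < N x \<and> N x < real n}"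
    have Am: "?A \<in> sets borel" by measurable
    have "emeasure lborel ?A \<le> emeasure lborel (gball N (real n))"
      by (intro emeasure_mono) (auto simp: gball_def)
    also have "\<dots> < \<infinity>" by (simp add: gball_volume)
    finally have fin: "emeasure lborel ?A < \<infinity>" .
    have i: "integrable lborel (indicat_real ?A)" using Am fin by (intro integrable_real_indicator) auto
    let ?I = "\<lambda>s. LINT y|\<sigma>. indicat_real ?A (dil G s y)"
    have I: "?I s = 0" if "s > 0" "s \<notin> Z" for s
    proof -
      have "?I s = (LINT y|\<sigma>. 0)"
        by (rule Bochner_Integration.integral_cong) (use that N_dil_sphere in \<open>auto simp: indicator_def\<close>)
      then show ?thesis by simp
    qed
    have "measure lborel ?A = (LINT x|lborel. indicat_real ?A x)" using Am by simp
    also have "\<dots> = (LINT s|lborel. indicator {0<..} s *\<^sub>R (?I s * s ^ (Q - 1)))"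
      using polar_formula[OF i] by (simp only: set_lebesgue_integral_def)
    also have "\<dots> = 0"
    proof (rule integral_eq_zero_AE)
      show "AE s in lborel. indicator {0<..} s *\<^sub>R (?I s * s ^ (Q - 1)) = 0"
        using AE_not_in[OF Z(1)]
      proof eventually_elim
        case (elim s)
        then show ?case using I[of s] by (cases "s > 0") simp_all
      qed
    qed
    finally have "?A \<in> null_sets lborel" using measure_0_imp_null_set[of ?A lborel] fin Am by simp
    from AE_not_in[OF this] show ?thesis by eventually_elim simp
  qed
  then have "AE x in lborel. \<forall>n. \<not> (N x \<in> Z \<and> 0 < N x \<and> N x < real n)" unfolding AE_all_countable by blast
  moreover have "AE x in lborel. N x \<noteq> 0" using AE_lborel_singleton[of 0] by eventually_elim (simp add: N_0)
  ultimately show ?thesis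
  proof eventually_elim
    case (elim x)
    have "N x > 0" using elim(2) N_nonneg[of x] by simp
    moreover obtain n :: nat where "N x < real n" using reals_Archimedean2 by blast
    ultimately have "N x \<notin> Z" using elim(1) by blast
    then show ?case using Z(2) \<open>N x > 0\<close> by blast
  qed
qed

context
  fixes u :: "'a \<Rightarrow> real" and K :: "'a set"
  assumes um[measurable]: "u \<in> borel_measurable borel" and K: "compact K"
    and uK: "AE x in lborel. x \<notin> K \<longrightarrow> u x = 0"
begin

lemma level_borel: "{x. t < u x} \<in> sets borel" by measurable

lemma level_finite: "0 \<le> t \<Longrightarrow> emeasure lborel {x. t < u x} < \<infinity>"
proof -
  assume t: "0 \<le> t"
  have "emeasure lborel {x. t < u x} \<le> emeasure lborel K"
  proof (rule emeasure_mono_AE)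
    show "AE x in lborel. x \<in> {x. t < u x} \<longrightarrow> x \<in> K" using uK by eventually_elim (use t in auto)
  qed (use K borel_compact in auto)
  then show ?thesis using emeasure_compact_finite[OF K] by (rule le_less_trans)
qed

lemma level_antimono: "t \<le> t' \<Longrightarrow> emeasure lborel {x. t' < u x} \<le> emeasure lborel {x. t < u x}"
  by (intro emeasure_mono) auto

text \<open>The levels whose supremum is the profile, with the volume of the ball made explicit.\<close>

definition heights :: "real \<Rightarrow> ennreal set" where
  "heights r = {ennreal t | t. 0 \<le> t \<and> emeasure lborel {x. t < u x} > ennreal (ball_vol r)}"

lemma profile_eq: "0 \<le> r \<Longrightarrow> profile N u r = enn2real (Sup (heights r))"
  unfolding profile_def heights_def using emeasure_gball[of r] level_borel by simp

text \<open>The superlevel sets at height \<open>n\<close> have finite measure and decrease to the empty set, so for large \<open>n\<close> they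
are smaller than the ball of radius \<open>r\<close>.\<close>

lemma heights_bounded:
  assumes r: "r > 0" shows "Sup (heights r) < \<infinity>"
proof -
  have "(\<lambda>n. emeasure lborel {x. real n < u x}) \<longlonglongrightarrow> emeasure lborel (\<Inter>n. {x. real n < u x})"
    using level_finite by (intro Lim_emeasure_decseq) (auto simp: decseq_def less_top)
  also have "(\<Inter>n. {x. real n < u x}) = {}"
  proof -
    have "\<exists>n. \<not> real n < u x" for x using reals_Archimedean2[of "u x"] by (metis less_asym)
    then show ?thesis by auto
  qed
  finally have "(\<lambda>n. emeasure lborel {x. real n < u x}) \<longlonglongrightarrow> 0" by simp
  from order_tendstoD(2)[OF this, of "ennreal (ball_vol r)"]
  obtain n where n: "emeasure lborel {x. real n < u x} < ennreal (ball_vol r)"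
    using ball_vol_pos[OF r] by (auto simp: eventually_sequentially)
  have "Sup (heights r) \<le> ennreal (real n)"
  proof (rule Sup_least)
    fix y assume "y \<in> heights r"
    then obtain t where t: "y = ennreal t" "0 \<le> t" "emeasure lborel {x. t < u x} > ennreal (ball_vol r)"
      by (auto simp: heights_def)
    have "t \<le> real n"
    proof (rule ccontr)
      assume "\<not> t \<le> real n"
      then have "emeasure lborel {x. t < u x} \<le> emeasure lborel {x. real n < u x}" by (intro level_antimono) simp
      then show False using t(3) n by simp
    qed
    then show "y \<le> ennreal (real n)" using t by (simp add: ennreal_leI)
  qed
  then show ?thesis by (rule le_less_trans) simp
qed

lemma profile_ennreal: "r > 0 \<Longrightarrow> ennreal (profile N u r) = Sup (heights r)"
  using heights_bounded[of r] profile_eq[of r] by (simp add: less_top)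

text \<open>Together with \<open>above_profile\<close>: for heights strictly between \<open>profile N u s\<close> and \<open>profile N u r\<close> the volume
of the superlevel set lies between \<open>ball_vol r\<close> and \<open>ball_vol s\<close>.\<close>

lemma below_profile:
  assumes "r > 0" "0 \<le> t" "t < profile N u r"
  shows "emeasure lborel {x. t < u x} > ennreal (ball_vol r)"
proof -
  have "ennreal t < Sup (heights r)" unfolding profile_ennreal[OF assms(1), symmetric]
    using assms(2,3) by (intro ennreal_lessI) auto
  then obtain t' where t': "ennreal t < ennreal t'" "0 \<le> t'" "emeasure lborel {x. t' < u x} > ennreal (ball_vol r)"
    unfolding less_Sup_iff by (auto simp: heights_def)
  then have "t \<le> t'" using assms(2) by (simp add: ennreal_less_iff)
  from level_antimono[OF this] t'(3) show ?thesis by simp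
qed

lemma above_profile:
  assumes "r > 0" "profile N u r < t"
  shows "emeasure lborel {x. t < u x} \<le> ennreal (ball_vol r)"
proof (rule ccontr)
  have p0: "0 \<le> profile N u r" by (simp add: profile_def)
  assume "\<not> ?thesis"
  then have "ennreal t \<in> heights r" using assms(2) p0 by (auto simp: heights_def not_le)
  then have "ennreal t \<le> ennreal (profile N u r)" unfolding profile_ennreal[OF assms(1)] by (rule Sup_upper)
  then show False using assms(2) p0 by simp
qed

lemma profile_nonneg: "0 \<le> profile N u r" by (simp add: profile_def)

lemma profile_antimono: "0 < r \<Longrightarrow> r \<le> s \<Longrightarrow> profile N u s \<le> profile N u r"
proof -
  assume rs: "0 < r" "r \<le> s"
  have "heights s \<subseteq> heights r" using ball_vol_mono[of r s] rs
    by (auto simp: heights_def intro: le_less_trans[OF ennreal_leI])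
  then have "ennreal (profile N u s) \<le> ennreal (profile N u r)"
    using rs by (simp add: profile_ennreal Sup_subset_mono)
  then show ?thesis using profile_nonneg by simp
qed

section \<open>The symmetrization inequality\<close>

context
  fixes D :: "'a \<Rightarrow> nat \<Rightarrow> real" and C :: real
  assumes wD: "\<And>i. i < rank G \<Longrightarrow> weak_Xd (frame G i) u (\<lambda>x. D x i)" and lu: "loc_int u"
    and perC: "perimeter_constant G N C" and Pfin: "hperimeter G (gball N 1) < \<infinity>"
begin

abbreviation unit_per where "unit_per \<equiv> enn2real (hperimeter G (gball N 1))"

lemma unit_per_pos: "unit_per > 0" using hperimeter_unit_ball_pos Pfin by (simp add: enn2real_positive_iff)

lemma C_pos: "1 \<le> C" using perC by (simp add: perimeter_constant_def)

abbreviation "Csym \<equiv> \<sigma>0 / unit_per * C"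

lemma Csym_pos: "Csym > 0" using unit_per_pos C_pos sigma0_pos by simp

lemma hnorm_borel [measurable]: "(\<lambda>x. hnorm G (D x)) \<in> borel_measurable borel"
proof -
  have "(\<lambda>x. D x i) \<in> borel_measurable borel" if "i < rank G" for i
    using wD[OF that] by (simp add: weak_Xd_def loc_int_def)
  then have [measurable]: "(\<lambda>x. \<Sum>i<rank G. (D x i)\<^sup>2) \<in> borel_measurable borel"
    by (intro borel_measurable_sum borel_measurable_power) auto
  show ?thesis unfolding hnorm_def by measurable
qed

text \<open>A weak gradient is only locally integrable, but for nonnegative \<open>a\<close> the set lies in the compact
support of \<open>u\<close> up to a null set.\<close>

lemma hnorm_integrable_on_level:
  assumes "0 \<le> a" shows "integrable lborel (\<lambda>x. indicator {x. a < u x \<and> u x < b} x * hnorm G (D x))"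
proof -
  have i: "integrable lborel (\<lambda>x. \<Sum>i<rank G. indicator K x * \<bar>D x i\<bar>)"
    using wD K by (intro Bochner_Integration.integrable_sum loc_int_abs_indicator) (auto simp: weak_Xd_def)
  show ?thesis
  proof (rule Bochner_Integration.integrable_bound[OF i])
    have le: "hnorm G (D x) \<le> (\<Sum>i<rank G. \<bar>D x i\<bar>)" for x
      using L2_set_le_sum_abs[of "D x" "{..<rank G}"] by (simp add: hnorm_def L2_set_def)
    show "AE x in lborel. norm (indicator {x. a < u x \<and> u x < b} x * hnorm G (D x)) \<le> norm (\<Sum>i<rank G. indicator K x * \<bar>D x i\<bar>)"
      using uK
    proof eventually_elim
      case (elim x)
      show ?case
      proof (cases "a < u x \<and> u x < b")
        case True
        then have "x \<in> K" using elim assms by auto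
        then show ?thesis using True le[of x] hnorm_nonneg[of "D x"] by (simp add: sum_nonneg)
      qed simp
    qed
  qed measurable
qed

text \<open>The superlevel set has the volume of a ball of some radius \<open>R \<ge> r\<close>. The perimeter constant compares it with
this ball, whose perimeter is at least \<open>R ^ (Q - 1)\<close> times that of the unit ball.\<close>

lemma level_perimeter_lower_bound:
  assumes r: "r > 0" and t: "0 \<le> t" "t < profile N u r"
  shows "ennreal (unit_per * r ^ (Q - 1) / C) \<le> hperimeter G {x. t < u x}"
proof -
  let ?E = "{x. t < u x}"
  have Em: "?E \<in> sets lebesgue" by (rule sets_completionI_sets) (simp add: level_borel)
  obtain v where v: "v \<ge> 0" "emeasure lborel ?E = ennreal v" using level_finite[OF t(1)] by (cases "emeasure lborel ?E") auto
  obtain R where R: "R \<ge> 0" "ball_vol R = v" using ball_vol_surj[OF v(1)] by blast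
  have "ball_vol r < ball_vol R" using below_profile[OF r t] unfolding v(2) R(2) by (simp add: ennreal_less_iff ball_vol_pos[OF r] less_imp_le)
  then have rR: "r \<le> R" using ball_vol_mono[of R r] R r by (cases "r \<le> R") auto
  have Eeq: "emeasure lebesgue ?E = ennreal v" using v(2) level_borel by simp
  have "hperimeter G (gball N R) \<le> ennreal C * hperimeter G ?E"
    using perC Em R emeasure_gball[OF R(1)] Eeq unfolding perimeter_constant_def by auto
  moreover have "ennreal (r ^ (Q - 1)) * hperimeter G (gball N 1) \<le> hperimeter G (gball N R)"
  proof -
    have "ennreal (r ^ (Q - 1)) * hperimeter G (gball N 1) \<le> ennreal (R ^ (Q - 1)) * hperimeter G (gball N 1)"
      using rR r by (intro mult_right_mono ennreal_leI power_mono) auto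
    also have "\<dots> \<le> hperimeter G (gball N R)" using rR r by (intro hperimeter_gball_ge) auto
    finally show ?thesis .
  qed
  ultimately have "ennreal (r ^ (Q - 1)) * hperimeter G (gball N 1) \<le> ennreal C * hperimeter G ?E" by (rule order_trans[rotated])
  moreover have "hperimeter G (gball N 1) = ennreal unit_per" using Pfin by (simp add: less_top)
  ultimately have le: "ennreal (r ^ (Q - 1) * unit_per) \<le> ennreal C * hperimeter G ?E"
    using r by (simp add: ennreal_mult)
  show ?thesis
  proof (cases "hperimeter G ?E")
    case (real q)
    then have "r ^ (Q - 1) * unit_per \<le> C * q" using le C_pos by (simp add: ennreal_mult[symmetric])
    then have "unit_per * r ^ (Q - 1) / C \<le> q" using C_pos by (simp add: divide_le_eq mult.commute)
    then show ?thesis using real by (simp add: ennreal_leI)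
  qed simp
qed

text \<open>The coarea inequality with the perimeter bound at radius \<open>r\<close> controls the drop of the profile from \<open>r\<close> to \<open>s\<close>
by the integral of the gradient over the heights in between; Jensen's inequality on this set, whose volume is
at most that of the shell, gives \<open>p\<close>-th powers. The ratio \<open>s / r\<close> enters because perimeters are measured at
the inner radius, but the volume of the shell is bounded by means of the outer one.\<close>

lemma shell_estimate:
  assumes r: "0 < r" "r < s" and p: "p \<ge> 1"
  shows "ennreal (((profile N u r - profile N u s) / (s - r)) powr p * (ball_vol s - ball_vol r))
    \<le> ennreal ((Csym * (s / r) ^ (Q - 1)) powr p) *
       (\<integral>\<^sup>+x. indicator {x. profile N u s < u x \<and> u x < profile N u r} x * ennreal (hnorm G (D x) powr p) \<partial>lborel)"
    (is "?L \<le> ennreal ?K * ?J")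
proof (cases "profile N u s < profile N u r")
  case False
  then have "profile N u r - profile N u s = 0" using profile_antimono[of r s] r by simp
  then show ?thesis by simp
next
  case True
  let ?t1 = "profile N u r" and ?t2 = "profile N u s"
  let ?w = "ball_vol s - ball_vol r"
  define \<kappa> where "\<kappa> = unit_per * r ^ (Q - 1) / C"
  have w0: "?w > 0" using ball_vol_strict_mono[of r s] r by simp
  have \<kappa>0: "\<kappa> > 0" unfolding \<kappa>_def using unit_per_pos r C_pos by simp
  \<comment> \<open>The volume bounds hold at heights strictly inside the interval, so the estimate is first proved for a shorter interval of length d, centred in it.\<close>
  have sub: "ennreal ((d / (s - r)) powr p * ?w) \<le> ennreal ?K * ?J" if d: "0 < d" "d < ?t1 - ?t2" for d
  proof -
    define a where "a = ?t2 + (?t1 - ?t2 - d) / 2"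
    define b where "b = ?t1 - (?t1 - ?t2 - d) / 2"
    have ab: "?t2 < a" "a < b" "b < ?t1" "b - a = d" using d by (auto simp: a_def b_def field_simps)
    have a0: "0 \<le> a" using profile_nonneg[of s] ab by linarith
    let ?U = "{x. a < u x \<and> u x < b}"
    have Um: "?U \<in> sets lborel" by simp
    let ?A = "LINT x|lborel. indicator ?U x * hnorm G (D x)"
    have iU: "integrable lborel (\<lambda>x. indicator ?U x * hnorm G (D x))" by (rule hnorm_integrable_on_level[OF a0])
    have A: "\<kappa> * (b - a) \<le> ?A"
    proof (rule coarea_lower_bound[OF wD lu ab(2) \<kappa>0 iU])
      fix t \<kappa>' assume t: "a < t" "t < b" and k': "\<kappa>' < \<kappa>"
      have Em: "{x. t < u x} \<in> sets lebesgue" by (rule sets_completionI_sets) (simp add: level_borel)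
      have "ennreal \<kappa>' < ennreal \<kappa>" using k' \<kappa>0 by (rule ennreal_lessI[rotated])
      also have "\<dots> \<le> hperimeter G {x. t < u x}" unfolding \<kappa>_def using t ab a0 by (intro level_perimeter_lower_bound r(1)) auto
      finally obtain F where F: "admissible F" "ennreal \<kappa>' < ennreal (LINT x:{x. t < u x}|lebesgue. hdiv F x)"
        unfolding hperimeter_eq[OF Em] less_SUP_iff by blast
      then have "\<kappa>' < (LINT x:{x. t < u x}|lebesgue. hdiv F x)" by (metis ennreal_leI not_le)
      then show "\<exists>F. admissible F \<and> \<kappa>' < (LINT x|lborel. indicator {x. t < u x} x * hdiv F x)"
        using F(1) set_integral_lborel[OF level_borel hdiv_test_function[OF F(1)]] by metis
    qed
    have Ufin: "emeasure lborel ?U < \<infinity>"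
      using emeasure_mono[of ?U "{x. a < u x}" lborel] level_finite[OF a0] level_borel by (auto intro: le_less_trans)
    have Umeas: "measure lborel ?U \<le> ?w"
    proof -
      have e1: "emeasure lborel {x. a < u x} \<le> ennreal (ball_vol s)" using ab r by (intro above_profile) auto
      have e2: "ennreal (ball_vol r) < emeasure lborel {x. b < u x}" using ab a0 r by (intro below_profile) auto
      have "emeasure lborel ?U \<le> emeasure lborel ({x. a < u x} - {x. b < u x})" by (intro emeasure_mono) auto
      also have "\<dots> = emeasure lborel {x. a < u x} - emeasure lborel {x. b < u x}"
        using ab a0 level_finite[of b] by (intro emeasure_Diff) (auto simp: less_top)
      also have "\<dots> \<le> ennreal (ball_vol s) - ennreal (ball_vol r)" using e1 e2 by (intro ennreal_minus_mono) auto
      also have "\<dots> = ennreal ?w" using ball_vol_pos[OF r(1)] by (simp add: ennreal_minus)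
      finally show ?thesis using w0 by (simp add: measure_def enn2real_leI)
    qed
    let ?JU = "\<integral>\<^sup>+x. indicator ?U x * ennreal (hnorm G (D x) powr p) \<partial>lborel"
    have mean: "ennreal (?A powr p) \<le> ennreal (measure lborel ?U powr (p - 1)) * ?JU"
      by (rule power_mean_inequality[OF p Um Ufin hnorm_nonneg _ iU]) simp
    have J: "?JU \<le> ?J" using ab by (intro nn_integral_mono mult_right_mono) (auto simp: indicator_def)
    have "(d / (s - r)) powr p * ?w \<le> (1 / (\<kappa> * (s - r))) powr p * ?w * ?A powr p"
    proof -
      have "d / (s - r) \<le> 1 / (\<kappa> * (s - r)) * ?A"
      proof -
        have "\<kappa> * d \<le> ?A" using A ab(4) by simp
        then have "\<kappa> * d / (\<kappa> * (s - r)) \<le> ?A / (\<kappa> * (s - r))" using \<kappa>0 r by (intro divide_right_mono) auto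
        moreover have "\<kappa> * d / (\<kappa> * (s - r)) = d / (s - r)" using \<kappa>0 by (intro mult_divide_mult_cancel_left) auto
        ultimately show ?thesis by simp
      qed
      then have "(d / (s - r)) powr p \<le> (1 / (\<kappa> * (s - r)) * ?A) powr p" using d r p by (intro powr_mono2) auto
      also have "\<dots> = (1 / (\<kappa> * (s - r))) powr p * ?A powr p"
        by (rule powr_mult)
      finally have "(d / (s - r)) powr p * ?w \<le> (1 / (\<kappa> * (s - r))) powr p * ?A powr p * ?w" using w0 by (intro mult_right_mono) auto
      then show ?thesis by (simp add: mult_ac)
    qed
    then have "ennreal ((d / (s - r)) powr p * ?w) \<le> ennreal ((1 / (\<kappa> * (s - r))) powr p * ?w) * ennreal (?A powr p)"
      using w0 by (simp add: ennreal_mult[symmetric] ennreal_leI)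
    also have "\<dots> \<le> ennreal ((1 / (\<kappa> * (s - r))) powr p * ?w) * (ennreal (?w powr (p - 1)) * ?J)"
    proof (intro mult_left_mono order_trans[OF mean] mult_mono J)
      show "ennreal (measure lborel ?U powr (p - 1)) \<le> ennreal (?w powr (p - 1))"
        using Umeas p by (intro ennreal_leI powr_mono2) auto
    qed auto
    also have "\<dots> = ennreal ((1 / (\<kappa> * (s - r))) powr p * ?w * ?w powr (p - 1)) * ?J"
      using w0 by (simp add: ennreal_mult mult.assoc)
    also have "(1 / (\<kappa> * (s - r))) powr p * ?w * ?w powr (p - 1) = (?w / (\<kappa> * (s - r))) powr p"
    proof -
      have "?w * ?w powr (p - 1) = ?w powr p" using powr_add[of ?w 1 "p - 1"] w0 by simp
      moreover have "(1 / (\<kappa> * (s - r))) powr p * ?w powr p = (1 / (\<kappa> * (s - r)) * ?w) powr p"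
        by (rule powr_mult[symmetric])
      ultimately show ?thesis by (simp add: mult.assoc)
    qed
    also have "ennreal ((?w / (\<kappa> * (s - r))) powr p) * ?J \<le> ennreal ?K * ?J"
    proof (intro mult_right_mono ennreal_leI powr_mono2)
      have "?w / (\<kappa> * (s - r)) \<le> (\<sigma>0 * s ^ (Q - 1) * (s - r)) / (\<kappa> * (s - r))"
        using ball_vol_increment[OF r] \<kappa>0 r by (intro divide_right_mono) auto
      also have "\<dots> = \<sigma>0 * s ^ (Q - 1) / \<kappa>" using r by simp
      also have "\<dots> = Csym * (s / r) ^ (Q - 1)"
        unfolding \<kappa>_def using unit_per_pos C_pos r by (simp add: power_divide field_simps)
      finally show "?w / (\<kappa> * (s - r)) \<le> Csym * (s / r) ^ (Q - 1)" .
    qed (use p w0 \<kappa>0 r in auto)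
    finally show ?thesis .
  qed
  show ?thesis
  proof (cases "ennreal ?K * ?J")
    case (real q)
    let ?f = "\<lambda>d. (d / (s - r)) powr p * ?w"
    have "(?f \<longlongrightarrow> ?f (?t1 - ?t2)) (at_left (?t1 - ?t2))"
      using True r p by (intro tendsto_intros) auto
    moreover have "\<forall>\<^sub>F d in at_left (?t1 - ?t2). ?f d \<le> q"
    proof -
      have "\<forall>\<^sub>F d in at_left (?t1 - ?t2). d \<in> {0<..<?t1 - ?t2}"
        using True by (intro eventually_at_left_real) simp
      then show ?thesis
      proof eventually_elim
        case (elim d)
        then show ?case using sub[of d] real by simp
      qed
    qed
    ultimately have "?f (?t1 - ?t2) \<le> q" by (rule tendsto_upperbound) simp
    then show ?thesis using real by (simp add: ennreal_leI)
  qed simp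
qed

text \<open>A geometric grid: the ratio of consecutive radii, and with it the constant of \<open>shell_estimate\<close>, is the same
for all shells, and it tends to \<open>1\<close> with growing \<open>n\<close>.\<close>

definition grid :: "nat \<Rightarrow> int \<Rightarrow> real" where "grid n j = exp (real_of_int j / real (Suc n))"

text \<open>The profile decreases, so the order of the difference makes the base of the power nonnegative.\<close>

definition grid_slope :: "real \<Rightarrow> nat \<Rightarrow> int \<Rightarrow> real" where
  "grid_slope p n j = ((profile N u (grid n j) - profile N u (grid n (j + 1)))
     / (grid n (j + 1) - grid n j)) powr p"

text \<open>The cell of the grid that contains the radius \<open>r\<close>.\<close>

definition grid_index :: "nat \<Rightarrow> real \<Rightarrow> int" where "grid_index n r = \<lfloor>real (Suc n) * ln r\<rfloor>"

lemma grid_mono: "j \<le> k \<Longrightarrow> grid n j \<le> grid n k"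
  unfolding grid_def by (simp add: divide_right_mono)

lemma grid_strict: "grid n j < grid n (j + 1)"
  unfolding grid_def by (simp add: divide_strict_right_mono)

lemma grid_pos: "0 < grid n j" by (simp add: grid_def)

lemma grid_ratio: "grid n (j + 1) / grid n j = exp (1 / real (Suc n))"
  unfolding grid_def exp_diff[symmetric] by (simp add: diff_divide_distrib[symmetric])

lemma grid_index_bounds:
  assumes r: "r > 0"
  shows "grid n (grid_index n r) \<le> r" "r < grid n (grid_index n r + 1)"
proof -
  let ?m = "real (Suc n)"
  have m: "?m > 0" by simp
  have "real_of_int (grid_index n r) / ?m \<le> ln r" "ln r < real_of_int (grid_index n r + 1) / ?m"
    unfolding grid_index_def using m by (simp_all only: pos_divide_le_eq pos_less_divide_eq mult.commute[of "ln r"]) linarith+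
  then have "exp (real_of_int (grid_index n r) / ?m) \<le> exp (ln r)" "exp (ln r) < exp (real_of_int (grid_index n r + 1) / ?m)"
    by simp_all
  then show "grid n (grid_index n r) \<le> r" "r < grid n (grid_index n r + 1)"
    using r by (simp_all add: grid_def)
qed

lemma grid_tendsto:
  assumes r: "r > 0"
  shows "(\<lambda>n. grid n (grid_index n r)) \<longlonglongrightarrow> r" "(\<lambda>n. grid n (grid_index n r + 1)) \<longlonglongrightarrow> r"
proof -
  have e1: "(\<lambda>n. exp (1 / real (Suc n))) \<longlonglongrightarrow> exp 0"
    using LIMSEQ_inverse_real_of_nat by (intro tendsto_exp) (simp add: inverse_eq_divide)
  have ratio: "grid n (grid_index n r + 1) = exp (1 / real (Suc n)) * grid n (grid_index n r)" for n
    using grid_ratio[of n "grid_index n r"] grid_pos[of n "grid_index n r"] by (simp add: divide_eq_eq)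
  have up: "(\<lambda>n. r * exp (1 / real (Suc n))) \<longlonglongrightarrow> r"
    using tendsto_mult[OF tendsto_const[of r] e1] by simp
  show hi: "(\<lambda>n. grid n (grid_index n r + 1)) \<longlonglongrightarrow> r"
  proof (rule tendsto_sandwich[OF _ _ tendsto_const up])
    show "\<forall>\<^sub>F n in sequentially. r \<le> grid n (grid_index n r + 1)"
      by (intro always_eventually allI less_imp_le grid_index_bounds(2)[OF r])
    show "\<forall>\<^sub>F n in sequentially. grid n (grid_index n r + 1) \<le> r * exp (1 / real (Suc n))"
      unfolding ratio using grid_index_bounds(1)[OF r] by (intro always_eventually allI) (simp add: mult.commute)
  qed
  have "(\<lambda>n. grid n (grid_index n r + 1) / exp (1 / real (Suc n))) \<longlonglongrightarrow> r / exp 0"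
    by (intro tendsto_divide hi e1) simp
  then show "(\<lambda>n. grid n (grid_index n r)) \<longlonglongrightarrow> r" unfolding ratio by simp
qed

text \<open>By the chain rule the quotient of gradients is the \<open>p\<close>-th power of the modulus of the derivative of the
profile. This derivative is the limit of difference quotients over the cells that contain the radius.\<close>

lemma energy_pointwise:
  assumes r: "N x > 0" and d\<psi>: "profile N u differentiable (at (N x))" and dN: "N differentiable (at x)" and p: "p \<ge> 1"
  shows "(\<lambda>n. grid_slope p n (grid_index n (N x))) \<longlonglongrightarrow> rearrangement_energy G N p u x"
proof -
  let ?\<psi> = "profile N u" and ?r = "N x"
  obtain d where d: "(?\<psi> has_real_derivative d) (at ?r)" using d\<psi> unfolding real_differentiable_def by blast
  have dd: "deriv ?\<psi> ?r = d" by (rule DERIV_imp_deriv[OF d])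
  have hg: "hgrad G (rearrangement N u) x i = d * hgrad G N x i" for i
  proof -
    have "(rearrangement N u has_derivative (\<lambda>h. d * frechet_derivative N (at x) h)) (at x)"
      unfolding rearrangement_def[abs_def]
      using has_derivative_compose[OF dN[unfolded frechet_derivative_works] d[unfolded has_field_derivative_def]] .
    from frechet_derivative_at[OF this] show ?thesis unfolding hgrad_def by metis
  qed
  have hn: "hnorm G (hgrad G (rearrangement N u) x) = \<bar>d\<bar> * hnorm G (hgrad G N x)"
    unfolding hnorm_def by (simp add: hg power_mult_distrib sum_distrib_left[symmetric] real_sqrt_mult)
  have en: "rearrangement_energy G N p u x = \<bar>d\<bar> powr p"
  proof (cases "hnorm G (hgrad G N x) = 0")
    case True then show ?thesis by (simp add: rearrangement_energy_def dd)
  next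
    case False
    then show ?thesis by (simp add: rearrangement_energy_def hn powr_mult)
  qed
  let ?lo = "\<lambda>n. grid n (grid_index n ?r)" and ?hi = "\<lambda>n. grid n (grid_index n ?r + 1)"
  have "(\<lambda>n. (?\<psi> (?hi n) - ?\<psi> (?lo n)) / (?hi n - ?lo n)) \<longlonglongrightarrow> d"
    by (rule straddle_difference_quotient[OF d grid_tendsto[OF r] grid_index_bounds(1)[OF r]
          less_imp_le[OF grid_index_bounds(2)[OF r]] grid_strict])
  from tendsto_minus[OF this] have lim: "(\<lambda>n. (?\<psi> (?lo n) - ?\<psi> (?hi n)) / (?hi n - ?lo n)) \<longlonglongrightarrow> - d"
    by (simp add: minus_divide_left)
  have nn: "0 \<le> (?\<psi> (?lo n) - ?\<psi> (?hi n)) / (?hi n - ?lo n)" for n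
    using profile_antimono[OF grid_pos less_imp_le[OF grid_strict]] grid_strict[of n "grid_index n ?r"]
    by (intro divide_nonneg_pos) auto
  have "0 \<le> - d" using LIMSEQ_le_const[OF lim] nn by blast
  then have "\<bar>d\<bar> = - d" by simp
  moreover have "(\<lambda>n. ((?\<psi> (?lo n) - ?\<psi> (?hi n)) / (?hi n - ?lo n)) powr p) \<longlonglongrightarrow> (- d) powr p"
    using p nn by (intro tendsto_powr'[OF lim tendsto_const]) auto
  ultimately show ?thesis by (simp add: en grid_slope_def)
qed

lemma grid_slope_borel: "(\<lambda>x. grid_slope p n (grid_index n (N x))) \<in> borel_measurable borel"
proof -
  have "(\<lambda>x. grid_index n (N x)) \<in> borel \<rightarrow>\<^sub>M count_space UNIV" unfolding grid_index_def by measurable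
  moreover have "grid_slope p n \<in> count_space UNIV \<rightarrow>\<^sub>M borel" by simp
  ultimately show ?thesis by (rule measurable_compose)
qed

text \<open>Sum \<open>shell_estimate\<close> over the grid. The sets of points \<open>x\<close> where \<open>u x\<close> lies strictly between two consecutive
values of the profile are disjoint, so their energies add up to at most the whole energy.\<close>

lemma shell_sum_estimate:
  assumes p: "p \<ge> 1"
  shows "(\<integral>\<^sup>+x. ennreal (grid_slope p n (grid_index n (N x))) \<partial>lborel)
    \<le> ennreal ((Csym * exp (1 / real (Suc n)) ^ (Q - 1)) powr p) * (\<integral>\<^sup>+x. ennreal (hnorm G (D x) powr p) \<partial>lborel)"
proof -
  let ?lo = "grid n" and ?K = "(Csym * exp (1 / real (Suc n)) ^ (Q - 1)) powr p" and ?\<psi> = "profile N u"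
  define A where "A j = {x. ?lo j \<le> N x \<and> N x < ?lo (j + 1)}" for j
  define U where "U j = {x. ?\<psi> (?lo (j + 1)) < u x \<and> u x < ?\<psi> (?lo j)}" for j
  have [measurable]: "A j \<in> sets borel" "U j \<in> sets borel" for j unfolding A_def U_def by measurable
  \<comment> \<open>The shells are indexed by integers; int_decode enumerates them for countable additivity.\<close>
  have "(\<integral>\<^sup>+x. ennreal (grid_slope p n (grid_index n (N x))) \<partial>lborel)
     \<le> (\<integral>\<^sup>+x. (\<Sum>i. ennreal (grid_slope p n (int_decode i)) * indicator (A (int_decode i)) x) \<partial>lborel)"
  proof (rule nn_integral_mono_AE)
    have "AE x in lborel. x \<noteq> (0::'a)" by (rule AE_lborel_singleton)
    then show "AE x in lborel. ennreal (grid_slope p n (grid_index n (N x)))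
        \<le> (\<Sum>i. ennreal (grid_slope p n (int_decode i)) * indicator (A (int_decode i)) x)"
    proof eventually_elim
      case (elim x)
      have r: "N x > 0" using elim N_0[of x] N_nonneg[of x] by simp
      let ?i = "int_encode (grid_index n (N x))"
      have "x \<in> A (grid_index n (N x))" using grid_index_bounds[OF r] by (simp add: A_def)
      then have "ennreal (grid_slope p n (grid_index n (N x)))
         = (\<Sum>i\<in>{?i}. ennreal (grid_slope p n (int_decode i)) * indicator (A (int_decode i)) x)" by simp
      also have "\<dots> \<le> (\<Sum>i. ennreal (grid_slope p n (int_decode i)) * indicator (A (int_decode i)) x)"
        by (rule sum_le_suminf) auto
      finally show ?case .
    qed
  qed
  also have "\<dots> = (\<Sum>i. \<integral>\<^sup>+x. ennreal (grid_slope p n (int_decode i)) * indicator (A (int_decode i)) x \<partial>lborel)"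
    by (rule nn_integral_suminf) measurable
  also have "\<dots> \<le> (\<Sum>i. ennreal ?K * (\<integral>\<^sup>+x. indicator (U (int_decode i)) x * ennreal (hnorm G (D x) powr p) \<partial>lborel))"
  proof (rule suminf_le)
    fix i
    let ?j = "int_decode i"
    note pos = grid_pos[of n ?j] and str = grid_strict[of n ?j]
    have "(\<integral>\<^sup>+x. ennreal (grid_slope p n ?j) * indicator (A ?j) x \<partial>lborel) = ennreal (grid_slope p n ?j) * emeasure lborel (A ?j)"
      by (rule nn_integral_cmult_indicator) simp
    also have "emeasure lborel (A ?j) = ennreal (ball_vol (?lo (?j + 1)) - ball_vol (?lo ?j))"
      unfolding A_def using pos str by (intro shell_measure) auto
    also have "ennreal (grid_slope p n ?j) * \<dots> = ennreal (grid_slope p n ?j * (ball_vol (?lo (?j + 1)) - ball_vol (?lo ?j)))"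
      using ball_vol_strict_mono[of "?lo ?j" "?lo (?j + 1)"] pos str by (intro ennreal_mult[symmetric]) (auto simp: grid_slope_def)
    also have "\<dots> \<le> ennreal ?K * (\<integral>\<^sup>+x. indicator (U ?j) x * ennreal (hnorm G (D x) powr p) \<partial>lborel)"
      using shell_estimate[OF pos str p] unfolding grid_ratio grid_slope_def U_def .
    finally show "(\<integral>\<^sup>+x. ennreal (grid_slope p n ?j) * indicator (A ?j) x \<partial>lborel)
       \<le> ennreal ?K * (\<integral>\<^sup>+x. indicator (U ?j) x * ennreal (hnorm G (D x) powr p) \<partial>lborel)" .
  qed auto
  also have "\<dots> = ennreal ?K * (\<Sum>i. \<integral>\<^sup>+x. indicator (U (int_decode i)) x * ennreal (hnorm G (D x) powr p) \<partial>lborel)"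
    by (rule ennreal_suminf_cmult)
  also have "(\<Sum>i. \<integral>\<^sup>+x. indicator (U (int_decode i)) x * ennreal (hnorm G (D x) powr p) \<partial>lborel)
     = (\<integral>\<^sup>+x. (\<Sum>i. indicator (U (int_decode i)) x * ennreal (hnorm G (D x) powr p)) \<partial>lborel)"
    by (rule nn_integral_suminf[symmetric]) measurable
  also have "\<dots> \<le> (\<integral>\<^sup>+x. ennreal (hnorm G (D x) powr p) \<partial>lborel)"
  proof (rule nn_integral_mono)
    fix x
    have disj: "U j \<inter> U k = {}" if "j < k" for j k
    proof -
      have "?\<psi> (?lo k) \<le> ?\<psi> (?lo (j + 1))"
        using that by (intro profile_antimono grid_pos grid_mono) simp
      then show ?thesis by (auto simp: U_def)
    qed
    have "disjoint_family (\<lambda>i. U (int_decode i))" unfolding disjoint_family_on_def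
    proof (intro ballI impI)
      fix i i' :: nat assume "i \<noteq> i'"
      then have "int_decode i \<noteq> int_decode i'" using inj_int_decode by (simp add: inj_eq)
      then show "U (int_decode i) \<inter> U (int_decode i') = {}"
        using disj[of "int_decode i" "int_decode i'"] disj[of "int_decode i'" "int_decode i"] by (auto simp: neq_iff)
    qed
    from suminf_indicator[OF this, of x]
    have "(\<Sum>i. indicator (U (int_decode i)) x * ennreal (hnorm G (D x) powr p))
       = indicator (\<Union>i. U (int_decode i)) x * ennreal (hnorm G (D x) powr p)" by simp
    also have "\<dots> \<le> 1 * ennreal (hnorm G (D x) powr p)" by (intro mult_right_mono) (auto simp: indicator_def)
    finally show "(\<Sum>i. indicator (U (int_decode i)) x * ennreal (hnorm G (D x) powr p)) \<le> ennreal (hnorm G (D x) powr p)"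
      by simp
  qed
  finally show ?thesis by (simp add: mult_left_mono)
qed

text \<open>Fatou's lemma along the refining grids, whose constants tend to the desired one.\<close>

lemma rearrangement_energy_le:
  assumes p: "p \<ge> 1" and Nd: "AE x in lborel. N differentiable (at x)"
  shows "(\<integral>\<^sup>+x. ennreal (rearrangement_energy G N p u x) \<partial>lborel)
    \<le> ennreal (Csym powr p) * (\<integral>\<^sup>+x. ennreal (hnorm G (D x) powr p) \<partial>lborel)"
proof (cases "(\<integral>\<^sup>+x. ennreal (hnorm G (D x) powr p) \<partial>lborel)")
  case top
  have "0 < Csym powr p" using less_imp_neq[OF Csym_pos] by (simp only: powr_gt_zero)
  then have "ennreal (Csym powr p) \<noteq> 0" by (simp only: ennreal_eq_0_iff not_le)
  then show ?thesis using top by (simp add: ennreal_mult_top)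
next
  case (real I)
  let ?K = "\<lambda>n. (Csym * exp (1 / real (Suc n)) ^ (Q - 1)) powr p"
  have "AE r in lborel. 0 < r \<longrightarrow> profile N u differentiable (at r)"
    by (rule antimono_AE_differentiable[OF profile_antimono])
  from AE_gauge_radius[OF this] have "AE x in lborel. profile N u differentiable (at (N x))" .
  moreover have "AE x in lborel. x \<noteq> (0::'a)" by (rule AE_lborel_singleton)
  ultimately have "AE x in lborel. ennreal (rearrangement_energy G N p u x)
     = liminf (\<lambda>n. ennreal (grid_slope p n (grid_index n (N x))))"
    using Nd
  proof eventually_elim
    case (elim x)
    have r: "N x > 0" using elim(2) N_0[of x] N_nonneg[of x] by simp
    have "(\<lambda>n. ennreal (grid_slope p n (grid_index n (N x)))) \<longlonglongrightarrow> ennreal (rearrangement_energy G N p u x)"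
      by (intro tendsto_ennrealI energy_pointwise r elim p)
    then show ?case by (intro lim_imp_Liminf[symmetric]) simp_all
  qed
  then have "(\<integral>\<^sup>+x. ennreal (rearrangement_energy G N p u x) \<partial>lborel)
     = (\<integral>\<^sup>+x. liminf (\<lambda>n. ennreal (grid_slope p n (grid_index n (N x)))) \<partial>lborel)"
    by (rule nn_integral_cong_AE)
  also have "\<dots> \<le> liminf (\<lambda>n. \<integral>\<^sup>+x. ennreal (grid_slope p n (grid_index n (N x))) \<partial>lborel)"
    using grid_slope_borel by (intro nn_integral_liminf) simp
  also have "\<dots> \<le> liminf (\<lambda>n. ennreal (?K n * I))"
  proof (rule Liminf_mono, intro always_eventually allI)
    fix n
    show "(\<integral>\<^sup>+x. ennreal (grid_slope p n (grid_index n (N x))) \<partial>lborel) \<le> ennreal (?K n * I)"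
      using shell_sum_estimate[OF p, of n] real by (simp add: ennreal_mult)
  qed
  also have "\<dots> = ennreal (Csym powr p * I)"
  proof (rule lim_imp_Liminf)
    have "(\<lambda>n. exp (1 / real (Suc n))) \<longlonglongrightarrow> exp 0"
      using LIMSEQ_inverse_real_of_nat by (intro tendsto_exp) (simp add: inverse_eq_divide)
    then have "(\<lambda>n. Csym * exp (1 / real (Suc n)) ^ (Q - 1)) \<longlonglongrightarrow> Csym * exp 0 ^ (Q - 1)"
      by (intro tendsto_mult tendsto_const tendsto_power)
    then have "(\<lambda>n. Csym * exp (1 / real (Suc n)) ^ (Q - 1)) \<longlonglongrightarrow> Csym" by simp
    then have "?K \<longlonglongrightarrow> Csym powr p" using Csym_pos by (intro tendsto_powr tendsto_const) auto
    then show "(\<lambda>n. ennreal (?K n * I)) \<longlonglongrightarrow> ennreal (Csym powr p * I)"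
      by (intro tendsto_ennrealI tendsto_mult tendsto_const)
  qed simp
  also have "\<dots> = ennreal (Csym powr p) * ennreal I" using real by (simp add: ennreal_mult)
  finally show ?thesis using real by simp
qed

end

end

end

text \<open>The profile sees \<open>u\<close> only through the volumes of superlevel sets, so a Borel representative may be used
in its place.\<close>

lemma profile_cong_AE:
  assumes "u \<in> borel_measurable lebesgue" "v \<in> borel_measurable lebesgue" "AE x in lebesgue. u x = v x"
  shows "profile N u = profile N v"
proof
  fix r
  have "emeasure lebesgue {x. t < u x} = emeasure lebesgue {x. t < v x}" for t
  proof (rule emeasure_eq_AE)
    show "AE x in lebesgue. x \<in> {x. t < u x} \<longleftrightarrow> x \<in> {x. t < v x}" using assms(3) by eventually_elim simp
    show "{x. t < u x} \<in> sets lebesgue" "{x. t < v x} \<in> sets lebesgue"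
      using borel_measurable_less[OF borel_measurable_const assms(1)] borel_measurable_less[OF borel_measurable_const assms(2)]
      by (auto simp: pred_def)
  qed
  then show "profile N u r = profile N v r" by (simp add: profile_def)
qed

theorem theorem5p1:
  fixes G :: "('a::euclidean_space) carnot"
    and N :: "'a \<Rightarrow> real"
    and \<sigma> :: "'a measure"
    and C_per :: real
  assumes "carnot_group G"
    and "carnot_gauge G N"
    and "AE x in lebesgue. N differentiable (at x)"
    and "hperimeter G (gball N 1) < \<infinity>"
    and "polar_measure G N \<sigma>"
    and "perimeter_constant G N C_per"
  shows "\<exists>C_sym>0.
    C_sym = measure \<sigma> {x. N x = 1} / enn2real (hperimeter G (gball N 1)) * C_per \<and>
    (\<forall>p\<ge>1. \<forall>u\<in>sobolev G p. \<forall>Du.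
       (AE x in lebesgue. 0 \<le> u x) \<longrightarrow>
       (\<exists>K. compact K \<and> (AE x in lebesgue. x \<notin> K \<longrightarrow> u x = 0)) \<longrightarrow>
       has_weak_hgrad G u Du \<longrightarrow>
       (\<integral>\<^sup>+ x. ennreal (rearrangement_energy G N p u x) \<partial>lebesgue)
         \<le> ennreal (C_sym powr p) * (\<integral>\<^sup>+ x. ennreal (hnorm G (Du x) powr p) \<partial>lebesgue))"
proof -
  interpret carnot_polar G N \<sigma> using assms by unfold_locales
  let ?C = "\<sigma>0 / enn2real (hperimeter G (gball N 1)) * C_per"
  have P: "enn2real (hperimeter G (gball N 1)) > 0"
    using hperimeter_unit_ball_pos assms(4) by (simp add: enn2real_positive_iff)
  have C: "C_per \<ge> 1" using assms(6) by (simp add: perimeter_constant_def)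
  have Nd: "AE x in lborel. N differentiable (at x)" using assms(3) by (simp add: AE_completion_iff)
  have main: "(\<integral>\<^sup>+ x. ennreal (rearrangement_energy G N p u x) \<partial>lebesgue)
         \<le> ennreal (?C powr p) * (\<integral>\<^sup>+ x. ennreal (hnorm G (Du x) powr p) \<partial>lebesgue)"
    if p: "p \<ge> 1" and K: "compact K" "AE x in lebesgue. x \<notin> K \<longrightarrow> u x = 0" and w: "has_weak_hgrad G u Du"
    for p u Du K
  proof -
    obtain u' D where u': "AE x in lebesgue. u x = u' x"
      "\<And>i. i < rank G \<Longrightarrow> AE x in lebesgue. Du x i = D x i"
      "\<And>i. i < rank G \<Longrightarrow> weak_Xd (frame G i) u' (\<lambda>x. D x i)" "loc_int u'"
      using weak_hgrad_borel_version[OF w] by metis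
    have u'b: "u' \<in> borel_measurable borel" using u'(4) by (simp add: loc_int_def)
    have "AE x in lebesgue. x \<notin> K \<longrightarrow> u' x = 0" using K(2) u'(1) by eventually_elim simp
    then have u'K: "AE x in lborel. x \<notin> K \<longrightarrow> u' x = 0" by (simp add: AE_completion_iff)
    have "profile N u = profile N u'"
      using w u'(1) u'b by (intro profile_cong_AE)
        (auto simp: has_weak_hgrad_def locally_integrable_def intro: measurable_completion)
    then have "rearrangement_energy G N p u x = rearrangement_energy G N p u' x" for x
      by (simp add: rearrangement_energy_def rearrangement_def[abs_def])
    then have "(\<integral>\<^sup>+ x. ennreal (rearrangement_energy G N p u x) \<partial>lebesgue)
       = (\<integral>\<^sup>+ x. ennreal (rearrangement_energy G N p u' x) \<partial>lborel)" by (simp add: nn_integral_completion)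
    also have "\<dots> \<le> ennreal (?C powr p) * (\<integral>\<^sup>+ x. ennreal (hnorm G (D x) powr p) \<partial>lborel)"
      by (rule rearrangement_energy_le[OF u'b K(1) u'K u'(3,4) assms(6,4) p Nd])
    also have "(\<integral>\<^sup>+ x. ennreal (hnorm G (D x) powr p) \<partial>lborel) = (\<integral>\<^sup>+ x. ennreal (hnorm G (Du x) powr p) \<partial>lebesgue)"
    proof -
      have "AE x in lebesgue. \<forall>i\<in>{..<rank G}. Du x i = D x i"
        using u'(2) by (intro AE_finite_allI) auto
      then have "AE x in lebesgue. ennreal (hnorm G (D x) powr p) = ennreal (hnorm G (Du x) powr p)"
        by eventually_elim (simp add: hnorm_def)
      from nn_integral_cong_AE[OF this] show ?thesis by (simp add: nn_integral_completion)
    qed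
    finally show ?thesis .
  qed
  show ?thesis
  proof (intro exI[of _ ?C] conjI allI impI ballI)
    show "?C > 0" using P C sigma0_pos by simp
    show "?C = measure \<sigma> {x. N x = 1} / enn2real (hperimeter G (gball N 1)) * C_per" by (simp add: \<sigma>0_def)
  qed (use main in blast)
qed

end
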